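(* Assume $0\notin\Gamma_\mu$, let $s\in I_\mu^\circ\setminus\{0\}$, and assume either (i) $s<0$ and there is $\varkappa_0>1$ such that for $\mu$-a.e. $g$: $g>0$ and $\max_{i,j}g^{i,j}\le\varkappa_0\min_{i,j}g^{i,j}$; or (ii) $s>0$ and there is $\varkappa>1$ such that for $\mu$-a.e. $g$: $g>0$ and $\max_ig^{i,j}\le\varkappa\min_ig^{i,j}$ for all $1\le j\le d$. Then, for any $0<\gamma\le\min\{|s|,1\}$, $f\in\mathcal S$ and $n\ge1$, $$P_{s,f}^n=\kappa(s)^nM_{s,f}+L_{s,f}^n,$$ where, for $\varphi\in\mathscr B_\gamma$ and $v\in\mathcal S_\epsilon$, $$M_{s,f}\varphi(v)=\nu_{s,f}(\varphi)\,r_{s,f}(v),\qquad L_{s,f}^n\varphi(v)=\frac1{\langle f,v\rangle^s}L_s^n\big(\langle f,\cdot\rangle^s\varphi\big)(v),$$ with $$r_{s,f}(v)=\frac{1}{\langle f,v\rangle^s}r_s(v),\qquad\nu_{s,f}(\varphi)=\frac{\nu_s(\langle f,\cdot\rangle^s\varphi)}{\nu_s(r_s)}.$$ Moreover, $\nu_{s,f}(r_{s,f})=1$, $M_{s,f}L_{s,f}=L_{s,f}M_{s,f}=0$ and $\rho(L_{s,f})<\kappa(s)$ for any $f\in\mathcal S$.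
   Context: Let $d\ge2$. $\mathbb R^d$ carries the standard scalar product and the norm $\|v\|=\sum_i|v_i|$; $\mathbb R^d_+$ is the set of vectors with non-negative coordinates; $\mathcal S=\{v\in\mathbb R^d_+:\|v\|=1\}$; $\mathcal S_\epsilon=\{v\in\mathcal S:\langle f,v\rangle\ge\epsilon\ \forall f\in\mathcal S\}$. $\mathbb G$ is the semigroup of non-negative $d\times d$ matrices, $\|g\|=\sum_{i,j}g^{i,j}$, $g>0$ means all entries strictly positive, $g^{\mathrm T}$ the transpose, $g\cdot v=gv/\|gv\|$. $(g_n)$ are i.i.d. in $\mathbb G$ with law $\mu$, $G_n=g_n\cdots g_1$; $\Gamma_\mu$ is the closed semigroup spanned by $\operatorname{supp}\mu$. Throughout, $\epsilon\in(0,1)$ is a fixed constant such that $g\cdot\mathcal S\subseteq\mathcal S_\epsilon$ for all $g\in\operatorname{supp}\mu$, and in case (i) also $g^{\mathrm T}\cdot\mathcal S\subseteq\mathcal S_\epsilon$ (such $\epsilon$ exists under the hypotheses). $I_\mu=\{s\in\mathbb R:\mathbb E\|g_1\|^s<\infty\}$ with interior $I_\mu^\circ$. $\kappa(s)=\lim_n(\mathbb E\|G_n\|^s)^{1/n}$. $P_s\varphi(v)=\int\|gv\|^s\varphi(g\cdot v)\mu(dg)$, $P_s^*\varphi(v)=\int\|g^{\mathrm T}v\|^s\varphi(g^{\mathrm T}\cdot v)\mu(dg)$, and on measures $(P_s\eta)\varphi=\eta(P_s\varphi)$ (likewise $P_s^*$). Under the hypotheses there are unique probability measures $\nu_s,\nu_s^*$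 on $\mathcal S$ with $P_s\nu_s=\kappa(s)\nu_s$, $P_s^*\nu_s^*=\kappa(s)\nu_s^*$ (and $\operatorname{supp}\nu_s\subseteq\mathcal S_\epsilon$), and $r_s(v)=\int\langle v,u\rangle^s\nu_s^*(du)$ is strictly positive, continuous and satisfies $P_sr_s=\kappa(s)r_s$. Put $M_s\varphi=\frac{\nu_s(\varphi)}{\nu_s(r_s)}r_s$ and $L_s=P_s-\kappa(s)M_s$, so that $P_s^n=\kappa(s)^nM_s+L_s^n$ with $M_sL_s=L_sM_s=0$. For $f\in\mathcal S$ and $\varphi\in\mathcal C(\mathcal S_\epsilon)$ (continuous functions on $\mathcal S_\epsilon$), $$P_{s,f}\varphi(v)=\int_{\mathbb G}\frac{\langle f,gv\rangle^s}{\langle f,v\rangle^s}\varphi(g\cdot v)\,\mu(dg),\quad v\in\mathcal S_\epsilon.$$ The space $\mathcal S$ is equipped with the Hilbert cross-ratio metric $\mathbf d(u,v)=\frac{1-m(u,v)m(v,u)}{1+m(u,v)m(v,u)}$, $m(u,v)=\sup\{\lambda\ge0:\lambda v_i\le u_i\ \forall i\}$. $\mathscr B_\gamma$ is the Banach space of complex-valued continuous $\varphi$ with $\|\varphi\|_\gamma=\sup|\varphi|+\sup_{u\ne v}|\varphi(u)-\varphi(v)|/\mathbf d(u,v)^\gamma<\infty$; for the operators indexed by $f$ the functions are considered on $\mathcal S_\epsilon$ ($P_s$ and $L_s$ make sense on such functions because $g\cdot\mathcal S\subseteq\mathcal S_\epsilon$ for $g\in\operatorname{supp}\mu$). $\rho(\cdot)$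 is the spectral radius on $\mathscr B_\gamma$. *)

theory Defs
  imports "HOL-Probability.Probability"
begin

section \<open>Vectors, non-negative matrices and the projective action\<close>

definition norm1 :: "real ^ 'd \<Rightarrow> real" where
  "norm1 v = (\<Sum>i\<in>UNIV. \<bar>v $ i\<bar>)"

definition sphere_pos :: "(real ^ 'd) set" where
  "sphere_pos = {v. (\<forall>i. 0 \<le> v $ i) \<and> norm1 v = 1}"

definition sphere_eps :: "real \<Rightarrow> (real ^ 'd) set" where
  "sphere_eps \<epsilon> = {v \<in> sphere_pos. \<forall>f\<in>sphere_pos. \<epsilon> \<le> f \<bullet> v}"

definition nonneg_mat :: "real ^ 'd ^ 'd \<Rightarrow> bool" where
  "nonneg_mat g \<longleftrightarrow> (\<forall>i j. 0 \<le> g $ i $ j)"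

definition pos_mat :: "real ^ 'd ^ 'd \<Rightarrow> bool" where
  "pos_mat g \<longleftrightarrow> (\<forall>i j. 0 < g $ i $ j)"

definition mat_norm :: "real ^ 'd ^ 'd \<Rightarrow> real" where
  "mat_norm g = (\<Sum>i\<in>UNIV. \<Sum>j\<in>UNIV. g $ i $ j)"

text \<open>The action is meaningful only for \<open>g *v v \<noteq> 0\<close>; otherwise its value here is \<open>0\<close>.\<close>

definition act :: "real ^ 'd ^ 'd \<Rightarrow> real ^ 'd \<Rightarrow> real ^ 'd" where
  "act g v = (1 / norm1 (g *v v)) *\<^sub>R (g *v v)"

text \<open>\<open>act g\<close> sends \<open>sphere_pos\<close> into \<open>sphere_eps \<epsilon>\<close>.  Points where the action is undefined are
  left out: the support of a law concentrated on positive matrices may contain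
  (in a null set) matrices with a zero column.\<close>

definition act_into :: "real \<Rightarrow> real ^ 'd ^ 'd \<Rightarrow> bool" where
  "act_into \<epsilon> g \<longleftrightarrow> act g ` {v \<in> sphere_pos. g *v v \<noteq> 0} \<subseteq> sphere_eps \<epsilon>"

section \<open>The law of the matrices\<close>

definition msupport :: "('a::topological_space) measure \<Rightarrow> 'a set" where
  "msupport \<mu> = {x. \<forall>U. open U \<longrightarrow> x \<in> U \<longrightarrow> 0 < emeasure \<mu> U}"

definition Gamma_mu :: "(real ^ 'd ^ 'd) measure \<Rightarrow> (real ^ 'd ^ 'd) set" where
  "Gamma_mu \<mu> = (\<lambda>T. closed T \<and> (\<forall>a\<in>T. \<forall>b\<in>T. a ** b \<in> T)) hull msupport \<mu>"

text \<open>Here and below \<open>0 powr s = 0\<close> also for \<open>s < 0\<close>; this is harmless when \<open>0 \<notin> Gamma_mu \<mu>\<close>,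
  since then \<open>mat_norm g > 0\<close> almost surely.\<close>

definition I_mu :: "(real ^ 'd ^ 'd) measure \<Rightarrow> real set" where
  "I_mu \<mu> = {s. (\<integral>\<^sup>+ g. ennreal (mat_norm g powr s) \<partial>\<mu>) < \<infinity>}"

text \<open>\<open>left_prod g n = g\<^sub>n \<cdots> g\<^sub>1\<close>; the value \<open>g 0\<close> is never used.\<close>

primrec left_prod :: "(nat \<Rightarrow> 'w \<Rightarrow> real ^ 'd ^ 'd) \<Rightarrow> nat \<Rightarrow> 'w \<Rightarrow> real ^ 'd ^ 'd" where
  "left_prod g 0 \<omega> = mat 1"
| "left_prod g (Suc n) \<omega> = g (Suc n) \<omega> ** left_prod g n \<omega>"

definition kappa :: "'w measure \<Rightarrow> (nat \<Rightarrow> 'w \<Rightarrow> real ^ 'd ^ 'd) \<Rightarrow> real \<Rightarrow> real" where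
  "kappa \<Omega> g s = lim (\<lambda>n. (\<integral>\<omega>. mat_norm (left_prod g n \<omega>) powr s \<partial>\<Omega>) powr (1 / real n))"

section \<open>Function spaces\<close>

text \<open>A function on \<open>X\<close> is represented by its extension by \<open>0\<close> to the whole space.  Hence equality
  of functions on \<open>X\<close> is equality in HOL, and continuous functions on a closed \<open>X\<close> are
  Borel measurable.\<close>

definition ext0 :: "(real ^ 'd) set \<Rightarrow> (real ^ 'd \<Rightarrow> complex) \<Rightarrow> real ^ 'd \<Rightarrow> complex" where
  "ext0 X \<phi> = (\<lambda>v. if v \<in> X then \<phi> v else 0)"

definition Cfun :: "(real ^ 'd) set \<Rightarrow> (real ^ 'd \<Rightarrow> complex) set" where
  "Cfun X = {\<phi>. continuous_on X \<phi> \<and> (\<forall>v. v \<notin> X \<longrightarrow> \<phi> v = 0)}"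

definition cross_m :: "real ^ 'd \<Rightarrow> real ^ 'd \<Rightarrow> real" where
  "cross_m u v = Sup {l. 0 \<le> l \<and> (\<forall>i. l * v $ i \<le> u $ i)}"

definition hdist :: "real ^ 'd \<Rightarrow> real ^ 'd \<Rightarrow> real" where
  "hdist u v = (1 - cross_m u v * cross_m v u) / (1 + cross_m u v * cross_m v u)"

definition gnorm :: "(real ^ 'd) set \<Rightarrow> real \<Rightarrow> (real ^ 'd \<Rightarrow> complex) \<Rightarrow> ennreal" where
  "gnorm X \<gamma> \<phi> =
     (SUP v\<in>X. ennreal (cmod (\<phi> v))) +
     (SUP (u, v)\<in>{(u, v). u \<in> X \<and> v \<in> X \<and> u \<noteq> v}.
        ennreal (cmod (\<phi> u - \<phi> v) / hdist u v powr \<gamma>))"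

definition Bspace :: "(real ^ 'd) set \<Rightarrow> real \<Rightarrow> (real ^ 'd \<Rightarrow> complex) set" where
  "Bspace X \<gamma> = {\<phi> \<in> Cfun X. gnorm X \<gamma> \<phi> < \<infinity>}"

section \<open>Bounded operators and spectral radius on \<open>Bspace X \<gamma>\<close>\<close>

definition bounded_op ::
  "(real ^ 'd) set \<Rightarrow> real \<Rightarrow> ((real ^ 'd \<Rightarrow> complex) \<Rightarrow> real ^ 'd \<Rightarrow> complex) \<Rightarrow> bool" where
  "bounded_op X \<gamma> T \<longleftrightarrow>
     (\<forall>\<phi>\<in>Bspace X \<gamma>. T \<phi> \<in> Bspace X \<gamma>) \<and>
     (\<forall>\<phi>\<in>Bspace X \<gamma>. \<forall>\<psi>\<in>Bspace X \<gamma>. T (\<lambda>v. \<phi> v + \<psi> v) = (\<lambda>v. T \<phi> v + T \<psi> v)) \<and>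
     (\<forall>\<phi>\<in>Bspace X \<gamma>. \<forall>c. T (\<lambda>v. c * \<phi> v) = (\<lambda>v. c * T \<phi> v)) \<and>
     (\<exists>C::real. \<forall>\<phi>\<in>Bspace X \<gamma>. gnorm X \<gamma> (T \<phi>) \<le> ennreal C * gnorm X \<gamma> \<phi>)"

definition op_spectrum ::
  "(real ^ 'd) set \<Rightarrow> real \<Rightarrow> ((real ^ 'd \<Rightarrow> complex) \<Rightarrow> real ^ 'd \<Rightarrow> complex) \<Rightarrow> complex set" where
  "op_spectrum X \<gamma> T =
     {z. \<not> (\<exists>R. bounded_op X \<gamma> R \<and>
              (\<forall>\<phi>\<in>Bspace X \<gamma>.
                 R (\<lambda>v. z * \<phi> v - T \<phi> v) = \<phi> \<and>
                 (\<lambda>v. z * R \<phi> v - T (R \<phi>) v) = \<phi>))}"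

definition spectral_radius ::
  "(real ^ 'd) set \<Rightarrow> real \<Rightarrow> ((real ^ 'd \<Rightarrow> complex) \<Rightarrow> real ^ 'd \<Rightarrow> complex) \<Rightarrow> real" where
  "spectral_radius X \<gamma> T = (SUP z\<in>op_spectrum X \<gamma> T. cmod z)"

section \<open>Transfer operators\<close>

text \<open>The set \<open>X\<close> is the domain of the functions acted on (\<open>sphere_pos\<close> or \<open>sphere_eps \<epsilon>\<close>).\<close>

definition P_op ::
  "(real ^ 'd ^ 'd) measure \<Rightarrow> real \<Rightarrow> (real ^ 'd) set \<Rightarrow> (real ^ 'd \<Rightarrow> complex) \<Rightarrow> real ^ 'd \<Rightarrow> complex" where
  "P_op \<mu> s X \<phi> =
     ext0 X (\<lambda>v. \<integral>g. complex_of_real (norm1 (g *v v) powr s) * \<phi> (act g v) \<partial>\<mu>)"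

definition P_star_op ::
  "(real ^ 'd ^ 'd) measure \<Rightarrow> real \<Rightarrow> (real ^ 'd) set \<Rightarrow> (real ^ 'd \<Rightarrow> complex) \<Rightarrow> real ^ 'd \<Rightarrow> complex" where
  "P_star_op \<mu> s X \<phi> =
     ext0 X (\<lambda>v. \<integral>g. complex_of_real (norm1 (transpose g *v v) powr s) * \<phi> (act (transpose g) v) \<partial>\<mu>)"

text \<open>\<open>\<eta>\<close> is a probability measure on \<open>sphere_pos\<close> with \<open>T \<eta> = k \<eta>\<close>, where
  \<open>(T \<eta>) \<phi> = \<eta> (T \<phi>)\<close> for continuous \<open>\<phi>\<close>.\<close>

definition eigenmeasure ::
  "((real ^ 'd \<Rightarrow> complex) \<Rightarrow> real ^ 'd \<Rightarrow> complex) \<Rightarrow> real \<Rightarrow> (real ^ 'd) measure \<Rightarrow> bool" where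
  "eigenmeasure T k \<eta> \<longleftrightarrow>
     prob_space \<eta> \<and> sets \<eta> = sets borel \<and> emeasure \<eta> sphere_pos = 1 \<and>
     (\<forall>\<phi>\<in>Cfun sphere_pos. (\<integral>v. T \<phi> v \<partial>\<eta>) = complex_of_real k * (\<integral>v. \<phi> v \<partial>\<eta>))"

definition r_fun :: "(real ^ 'd) measure \<Rightarrow> real \<Rightarrow> real ^ 'd \<Rightarrow> real" where
  "r_fun \<nu>' s v = (\<integral>u. (v \<bullet> u) powr s \<partial>\<nu>')"

definition M_op ::
  "(real ^ 'd) measure \<Rightarrow> (real ^ 'd) measure \<Rightarrow> real \<Rightarrow> (real ^ 'd) set \<Rightarrow>
   (real ^ 'd \<Rightarrow> complex) \<Rightarrow> real ^ 'd \<Rightarrow> complex" where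
  "M_op \<nu> \<nu>' s X \<phi> =
     ext0 X (\<lambda>v. (\<integral>u. \<phi> u \<partial>\<nu>) / complex_of_real (\<integral>u. r_fun \<nu>' s u \<partial>\<nu>) * complex_of_real (r_fun \<nu>' s v))"

definition L_op ::
  "(real ^ 'd ^ 'd) measure \<Rightarrow> real \<Rightarrow> (real ^ 'd) measure \<Rightarrow> (real ^ 'd) measure \<Rightarrow> real \<Rightarrow> (real ^ 'd) set \<Rightarrow>
   (real ^ 'd \<Rightarrow> complex) \<Rightarrow> real ^ 'd \<Rightarrow> complex" where
  "L_op \<mu> k \<nu> \<nu>' s X \<phi> = (\<lambda>v. P_op \<mu> s X \<phi> v - complex_of_real k * M_op \<nu> \<nu>' s X \<phi> v)"

section \<open>The operators indexed by \<open>f\<close>\<close>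

definition weight :: "real \<Rightarrow> real ^ 'd \<Rightarrow> (real ^ 'd \<Rightarrow> complex) \<Rightarrow> real ^ 'd \<Rightarrow> complex" where
  "weight s f \<phi> = (\<lambda>v. complex_of_real ((f \<bullet> v) powr s) * \<phi> v)"

definition Pf_op ::
  "(real ^ 'd ^ 'd) measure \<Rightarrow> real \<Rightarrow> (real ^ 'd) set \<Rightarrow> real ^ 'd \<Rightarrow>
   (real ^ 'd \<Rightarrow> complex) \<Rightarrow> real ^ 'd \<Rightarrow> complex" where
  "Pf_op \<mu> s X f \<phi> =
     ext0 X (\<lambda>v. \<integral>g. complex_of_real ((f \<bullet> (g *v v)) powr s / (f \<bullet> v) powr s) * \<phi> (act g v) \<partial>\<mu>)"

definition rf_fun ::
  "(real ^ 'd) measure \<Rightarrow> real \<Rightarrow> (real ^ 'd) set \<Rightarrow> real ^ 'd \<Rightarrow> real ^ 'd \<Rightarrow> complex" where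
  "rf_fun \<nu>' s X f = ext0 X (\<lambda>v. complex_of_real (1 / (f \<bullet> v) powr s * r_fun \<nu>' s v))"

definition nuf ::
  "(real ^ 'd) measure \<Rightarrow> (real ^ 'd) measure \<Rightarrow> real \<Rightarrow> real ^ 'd \<Rightarrow> (real ^ 'd \<Rightarrow> complex) \<Rightarrow> complex" where
  "nuf \<nu> \<nu>' s f \<phi> = (\<integral>v. weight s f \<phi> v \<partial>\<nu>) / complex_of_real (\<integral>u. r_fun \<nu>' s u \<partial>\<nu>)"

definition Mf_op ::
  "(real ^ 'd) measure \<Rightarrow> (real ^ 'd) measure \<Rightarrow> real \<Rightarrow> (real ^ 'd) set \<Rightarrow> real ^ 'd \<Rightarrow>
   (real ^ 'd \<Rightarrow> complex) \<Rightarrow> real ^ 'd \<Rightarrow> complex" where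
  "Mf_op \<nu> \<nu>' s X f \<phi> = (\<lambda>v. nuf \<nu> \<nu>' s f \<phi> * rf_fun \<nu>' s X f v)"

definition Lf_op ::
  "(real ^ 'd ^ 'd) measure \<Rightarrow> real \<Rightarrow> (real ^ 'd) measure \<Rightarrow> (real ^ 'd) measure \<Rightarrow> real \<Rightarrow> (real ^ 'd) set \<Rightarrow>
   real ^ 'd \<Rightarrow> (real ^ 'd \<Rightarrow> complex) \<Rightarrow> real ^ 'd \<Rightarrow> complex" where
  "Lf_op \<mu> k \<nu> \<nu>' s X f \<phi> =
     (\<lambda>v. complex_of_real (1 / (f \<bullet> v) powr s) * L_op \<mu> k \<nu> \<nu>' s X (weight s f \<phi>) v)"

end

theory Submission
  imports Defs
begin

text \<open>On \<open>sphere_eps \<epsilon>\<close> the matrices in the support contract the cross-ratio metric by the factor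
  \<open>1 - \<epsilon>\<^sup>2\<close>, and the logarithm of the weight \<open>(\<langle>f, g v\<rangle> / \<langle>f, v\<rangle>)\<^sup>s\<close> is Lipschitz in \<open>v\<close>, uniformly in \<open>g\<close>.
  Hence \<open>P\<^sub>s\<^sub>,\<^sub>f / \<kappa>(s)\<close> maps a cone of positive functions \<open>h\<close> with \<open>h u \<le> exp (A d(u,v)\<^sup>\<gamma>) h v\<close>
  into a smaller cone of the same kind, and a fixed proportion \<open>\<delta>\<close> of the rank-one part
  \<open>\<nu>\<^sub>s\<^sub>,\<^sub>f(h) r\<^sub>s\<^sub>,\<^sub>f\<close> can be subtracted from the image without leaving the original cone. Each step
  multiplies \<open>\<nu>\<^sub>s\<^sub>,\<^sub>f\<close> by \<open>1 - \<delta>\<close>, and \<open>\<nu>\<^sub>s\<^sub>,\<^sub>f\<close> controls the Hoelder norm on the cone; so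
  \<open>L\<^sub>s\<^sub>,\<^sub>f\<^sup>n\<close> decays like \<open>(\<kappa>(s) (1 - \<delta>))\<^sup>n\<close>, and the Neumann series gives the resolvent outside the
  disc of that radius.\<close>

section \<open>Contraction of a cone of positive functions\<close>

text \<open>Let \<open>T\<close> be the real form of the operator indexed by \<open>f\<close>. The
  operator \<open>L = T - k N(.) r\<close> does not preserve positivity, so the cone estimates are
  made for an auxiliary operator \<open>S\<close> that removes only the proportion
  \<open>\<delta>\<close> of the rank-one term. For each function, \<open>S\<close> and
  \<open>L / k\<close> differ by a multiple of \<open>r\<close>, and \<open>L r = 0\<close>, so the
  powers of \<open>L\<close> can be read off from those of \<open>S\<close>. Room for the
  subtraction exists because \<open>T\<close> turns the cone constant \<open>A\<close> into
  \<open>c + q * A\<close>, which is smaller than \<open>A\<close> once \<open>A\<close> is large;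
  \<open>q < 1\<close> is the contraction of \<open>hdist\<close> raised to \<open>\<gamma>\<close>,
  and \<open>c\<close> is a log-Lipschitz constant shared by weight and eigenfunction. Thus
  \<open>\<delta>\<close> depends on \<open>\<epsilon>\<close>, \<open>s\<close> and
  \<open>\<gamma>\<close>, not on \<open>f\<close>. A complex function enters the cone after
  splitting into real and imaginary part and adding a multiple of the constant 1. The eigenmeasure
  equation of \<open>\<nu>'\<close> yields the eigenfunction by Fubini, that of \<open>\<nu>\<close>
  the invariant functional, once \<open>\<nu>\<close> is known to live on
  \<open>sphere_eps \<epsilon>\<close>, where dividing by the inner product with \<open>f\<close> is
  safe.\<close>

definition holder :: "'a set \<Rightarrow> ('a \<Rightarrow> 'a \<Rightarrow> real) \<Rightarrow> real \<Rightarrow> ('a \<Rightarrow> 'b::real_normed_vector) \<Rightarrow> bool" where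
  "holder X E C \<phi> \<longleftrightarrow> 0 \<le> C \<and> (\<forall>v. v \<notin> X \<longrightarrow> \<phi> v = 0) \<and> (\<forall>v\<in>X. norm (\<phi> v) \<le> C) \<and>
     (\<forall>u\<in>X. \<forall>v\<in>X. norm (\<phi> u - \<phi> v) \<le> C * E u v)"

lemma holderI:
  assumes "0 \<le> C" "\<And>v. v \<notin> X \<Longrightarrow> \<phi> v = 0" "\<And>v. v \<in> X \<Longrightarrow> norm (\<phi> v) \<le> C"
    "\<And>u v. u \<in> X \<Longrightarrow> v \<in> X \<Longrightarrow> norm (\<phi> u - \<phi> v) \<le> C * E u v"
  shows "holder X E C \<phi>"
  using assms by (auto simp: holder_def)

lemma holderD:
  assumes "holder X E C \<phi>"
  shows "0 \<le> C" "\<And>v. v \<notin> X \<Longrightarrow> \<phi> v = 0" "\<And>v. v \<in> X \<Longrightarrow> norm (\<phi> v) \<le> C"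
    "\<And>u v. u \<in> X \<Longrightarrow> v \<in> X \<Longrightarrow> norm (\<phi> u - \<phi> v) \<le> C * E u v"
  using assms by (auto simp: holder_def)

lemma holder_add:
  assumes "holder X E C \<phi>" "holder X E D \<psi>"
  shows "holder X E (C + D) (\<lambda>v. \<phi> v + \<psi> v)"
proof (rule holderI)
  fix u v assume "u \<in> X" "v \<in> X"
  then have "norm (\<phi> u - \<phi> v) \<le> C * E u v" "norm (\<psi> u - \<psi> v) \<le> D * E u v"
    using assms by (auto simp: holder_def)
  moreover have "norm ((\<phi> u + \<psi> u) - (\<phi> v + \<psi> v)) \<le> norm (\<phi> u - \<phi> v) + norm (\<psi> u - \<psi> v)"
    by (rule norm_diff_triangle_ineq)
  ultimately show "norm (\<phi> u + \<psi> u - (\<phi> v + \<psi> v)) \<le> (C + D) * E u v"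
    by (simp add: distrib_right)
next
  fix v assume "v \<in> X"
  then show "norm (\<phi> v + \<psi> v) \<le> C + D"
    using assms by (intro norm_triangle_mono) (auto simp: holder_def)
qed (use assms in \<open>auto simp: holder_def\<close>)

lemma holder_cmult:
  fixes \<phi> :: "'a \<Rightarrow> 'b::real_normed_field"
  assumes "holder X E C \<phi>"
  shows "holder X E (norm c * C) (\<lambda>v. c * \<phi> v)"
proof (rule holderI)
  fix u v assume "u \<in> X" "v \<in> X"
  then have "norm (\<phi> u - \<phi> v) \<le> C * E u v"
    using assms by (auto simp: holder_def)
  then show "norm (c * \<phi> u - c * \<phi> v) \<le> norm c * C * E u v"
    by (simp add: right_diff_distrib[symmetric] norm_mult mult.assoc mult_left_mono)
qed (use assms in \<open>auto simp: holder_def norm_mult mult_left_mono\<close>)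

lemma holder_mono:
  assumes "holder X E C \<phi>" "C \<le> D" "\<And>u v. u \<in> X \<Longrightarrow> v \<in> X \<Longrightarrow> 0 \<le> E u v"
  shows "holder X E D \<phi>"
proof (rule holderI)
  fix u v assume uv: "u \<in> X" "v \<in> X"
  have "norm (\<phi> u - \<phi> v) \<le> C * E u v"
    using uv assms by (auto simp: holder_def)
  also have "\<dots> \<le> D * E u v"
    using assms(2) assms(3)[OF uv] by (rule mult_right_mono)
  finally show "norm (\<phi> u - \<phi> v) \<le> D * E u v" .
qed (use assms in \<open>force simp: holder_def\<close>)+

definition is_holder :: "'a set \<Rightarrow> ('a \<Rightarrow> 'a \<Rightarrow> real) \<Rightarrow> ('a \<Rightarrow> 'b::real_normed_vector) \<Rightarrow> bool" where
  "is_holder X E \<phi> \<longleftrightarrow> (\<exists>C. holder X E C \<phi>)"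

lemma is_holder_add:
  "is_holder X E \<phi> \<Longrightarrow> is_holder X E \<psi> \<Longrightarrow> is_holder X E (\<lambda>v. \<phi> v + \<psi> v)"
  unfolding is_holder_def using holder_add by blast

lemma is_holder_cmult:
  fixes \<phi> :: "'a \<Rightarrow> 'b::real_normed_field"
  shows "is_holder X E \<phi> \<Longrightarrow> is_holder X E (\<lambda>v. c * \<phi> v)"
  unfolding is_holder_def using holder_cmult by blast

lemma is_holder_diff:
  fixes \<phi> :: "'a \<Rightarrow> 'b::real_normed_field"
  assumes "is_holder X E \<phi>" "is_holder X E \<psi>" shows "is_holder X E (\<lambda>v. \<phi> v - \<psi> v)"
  using is_holder_add[OF assms(1) is_holder_cmult[OF assms(2), of "-1"]] by simp

text \<open>Multiplicative form of the requirement that log \<open>h\<close> be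
  \<open>A\<close>-Lipschitz for \<open>E\<close>; in this form the zero function belongs to the
  cone.\<close>

definition log_cone :: "'a set \<Rightarrow> ('a \<Rightarrow> 'a \<Rightarrow> real) \<Rightarrow> real \<Rightarrow> ('a \<Rightarrow> real) \<Rightarrow> bool" where
  "log_cone X E A h \<longleftrightarrow> (\<forall>v. v \<notin> X \<longrightarrow> h v = 0) \<and> (\<forall>v\<in>X. 0 \<le> h v) \<and>
     (\<forall>u\<in>X. \<forall>v\<in>X. h u \<le> exp (A * E u v) * h v)"

lemma coneI:
  assumes "\<And>v. v \<notin> X \<Longrightarrow> h v = 0" "\<And>v. v \<in> X \<Longrightarrow> 0 \<le> h v"
    "\<And>u v. u \<in> X \<Longrightarrow> v \<in> X \<Longrightarrow> h u \<le> exp (A * E u v) * h v"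
  shows "log_cone X E A h"
  using assms by (auto simp: log_cone_def)

lemma coneD:
  assumes "log_cone X E A h"
  shows "\<And>v. v \<notin> X \<Longrightarrow> h v = 0" "\<And>v. v \<in> X \<Longrightarrow> 0 \<le> h v"
    "\<And>u v. u \<in> X \<Longrightarrow> v \<in> X \<Longrightarrow> h u \<le> exp (A * E u v) * h v"
  using assms by (auto simp: log_cone_def)

text \<open>Convexity of exp: the slope of a chord lies between the slopes of the tangents at its
  ends.\<close>

lemma exp_diff_le:
  fixes x y :: real
  assumes "y \<le> x" shows "exp x - exp y \<le> (x - y) * exp x" "(x - y) * exp y \<le> exp x - exp y"
proof -
  have "exp x * (1 + (y - x)) \<le> exp x * exp (y - x)"
    by (intro mult_left_mono exp_ge_add_one_self) auto
  then show "exp x - exp y \<le> (x - y) * exp x"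
    by (simp add: exp_add[symmetric] algebra_simps)
  have "exp y * (1 + (x - y)) \<le> exp y * exp (x - y)"
    by (intro mult_left_mono exp_ge_add_one_self) auto
  then show "(x - y) * exp y \<le> exp x - exp y"
    by (simp add: exp_add[symmetric] algebra_simps)
qed

text \<open>\<open>E\<close> stands for \<open>hdist\<close> raised to \<open>\<gamma>\<close>.
  Values at most 1 turn the local factor \<open>exp (A * E u v)\<close> into the uniform factor
  \<open>exp A\<close>.\<close>

locale unit_gauge =
  fixes X :: "'a set" and E :: "'a \<Rightarrow> 'a \<Rightarrow> real"
  assumes E_nonneg: "u \<in> X \<Longrightarrow> v \<in> X \<Longrightarrow> 0 \<le> E u v"
    and E_le_1: "u \<in> X \<Longrightarrow> v \<in> X \<Longrightarrow> E u v \<le> 1"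
    and E_sym: "E u v = E v u"
begin

text \<open>A Harnack inequality: all values of a cone function are comparable.\<close>

lemma cone_le:
  assumes "0 \<le> A" "log_cone X E A h" "u \<in> X" "v \<in> X"
  shows "h u \<le> exp A * h v"
proof -
  have "A * E u v \<le> A"
    using assms E_le_1 by (simp add: mult_left_le)
  then have "exp (A * E u v) * h v \<le> exp A * h v"
    using coneD(2)[OF assms(2,4)] by (intro mult_right_mono) auto
  then show ?thesis using coneD(3)[OF assms(2-4)] by linarith
qed

text \<open>For a cone function an upper bound alone controls the oscillation, because
  \<open>h u - h v\<close> is at most \<open>(exp (A * E u v) - 1) * h v\<close> and exp is
  Lipschitz on the interval from 0 to \<open>A\<close>.\<close>

lemma cone_holder:
  assumes "0 \<le> A" "log_cone X E A h" "0 \<le> G" and le: "\<And>v. v \<in> X \<Longrightarrow> h v \<le> G"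
  shows "holder X E ((1 + A * exp A) * G) h"
proof -
  have *: "h u - h v \<le> (A * exp A * G) * E u v" if "u \<in> X" "v \<in> X" for u v
  proof -
    have e: "exp (A * E u v) - exp 0 \<le> (A * E u v - 0) * exp (A * E u v)"
      using assms(1) E_nonneg[OF that] by (intro exp_diff_le) auto
    also have "\<dots> \<le> (A * E u v) * exp A"
      using assms(1) E_nonneg[OF that] E_le_1[OF that]
      by (auto intro!: mult_left_mono simp: mult_left_le)
    finally have e: "exp (A * E u v) - 1 \<le> A * E u v * exp A" by simp
    have "h u - h v \<le> (exp (A * E u v) - 1) * h v"
      using coneD(3)[OF assms(2) that] by (simp add: algebra_simps)
    also have "\<dots> \<le> (A * E u v * exp A) * h v"
      using e coneD(2)[OF assms(2) that(2)] by (intro mult_right_mono)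
    also have "\<dots> \<le> (A * E u v * exp A) * G"
      using le[OF that(2)] assms(1) E_nonneg[OF that] by (intro mult_left_mono) auto
    finally show ?thesis by (simp add: mult_ac)
  qed
  have ge: "A * exp A * G \<le> (1 + A * exp A) * G"
    using assms by (intro mult_right_mono) auto
  show ?thesis
  proof (rule holderI)
    fix u v assume uv: "u \<in> X" "v \<in> X"
    have "(A * exp A * G) * E u v \<le> ((1 + A * exp A) * G) * E u v"
      using ge E_nonneg[OF uv] by (rule mult_right_mono)
    then show "norm (h u - h v) \<le> (1 + A * exp A) * G * E u v"
      using *[OF uv] *[OF uv(2,1)] E_sym[of u v] by (simp add: abs_le_iff)
  next
    fix v assume v: "v \<in> X"
    have "G \<le> (1 + A * exp A) * G"
      using assms by (simp add: distrib_right)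
    then show "norm (h v) \<le> (1 + A * exp A) * G"
      using le[OF v] coneD(2)[OF assms(2) v] by simp
  qed (use assms in \<open>auto simp: log_cone_def\<close>)
qed

lemma cone_is_holder:
  assumes "0 \<le> A" "log_cone X E A h" shows "is_holder X E h"
proof (cases "X = {}")
  case True
  then have "holder X E 0 h" using assms by (auto simp: holder_def log_cone_def)
  then show ?thesis by (auto simp: is_holder_def)
next
  case False
  then obtain w where w: "w \<in> X" by auto
  have "0 \<le> exp A * h w" using coneD(2)[OF assms(2) w] by simp
  then have "holder X E ((1 + A * exp A) * (exp A * h w)) h"
    using cone_le[OF assms _ w] by (intro cone_holder[OF assms]) auto
  then show ?thesis by (auto simp: is_holder_def)
qed

lemma cone_mono: "log_cone X E a h \<Longrightarrow> a \<le> b \<Longrightarrow> log_cone X E b h"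
proof (rule coneI)
  fix u v assume *: "log_cone X E a h" "a \<le> b" "u \<in> X" "v \<in> X"
  then have "a * E u v \<le> b * E u v" using E_nonneg by (intro mult_right_mono) auto
  then have "exp (a * E u v) * h v \<le> exp (b * E u v) * h v"
    using coneD(2)[OF *(1,4)] by (intro mult_right_mono) auto
  then show "h u \<le> exp (b * E u v) * h v" using coneD(3)[OF *(1,3,4)] by linarith
qed (auto simp: log_cone_def)

end

text \<open>\<open>T\<close>, \<open>N\<close>, \<open>r\<close> and \<open>k\<close> abstract the
  operator, its invariant functional, the eigenfunction and the eigenvalue, for real functions.
  \<open>T_cone\<close> is a Doeblin-Fortet inequality for logarithms: the old constant is
  contracted by \<open>q\<close>, and \<open>c\<close> is what one application adds.\<close>

locale cone_contraction =
  unit_gauge X E for X :: "'a set" and E :: "'a \<Rightarrow> 'a \<Rightarrow> real" +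
  fixes T :: "('a \<Rightarrow> real) \<Rightarrow> 'a \<Rightarrow> real"
    and N :: "('a \<Rightarrow> real) \<Rightarrow> real" and r :: "'a \<Rightarrow> real" and k c q :: real
  assumes T_lin: "is_holder X E h \<Longrightarrow> is_holder X E h' \<Longrightarrow>
      T (\<lambda>v. a * h v + b * h' v) = (\<lambda>v. a * T h v + b * T h' v)"
    and N_lin: "is_holder X E h \<Longrightarrow> is_holder X E h' \<Longrightarrow> N (\<lambda>v. a * h v + b * h' v) = a * N h + b * N h'"
    and N_mono: "is_holder X E h \<Longrightarrow> is_holder X E h' \<Longrightarrow> (\<And>v. v \<in> X \<Longrightarrow> h v \<le> h' v) \<Longrightarrow> N h \<le> N h'"
    and N_T: "is_holder X E h \<Longrightarrow> N (T h) = k * N h"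
    and T_r: "T r = (\<lambda>v. k * r v)"
    and N_r: "N r = 1"
    and r_cone: "log_cone X E c r"
    and c_nonneg: "0 \<le> c" and q: "0 \<le> q" "q < 1" and k_pos: "0 < k"
    and T_cone: "0 \<le> A \<Longrightarrow> log_cone X E A h \<Longrightarrow> log_cone X E (c + q * A) (T h)"
begin

definition one :: "'a \<Rightarrow> real" where "one v = (if v \<in> X then 1 else 0)"

lemma one_holder: "holder X E 1 one"
  using E_nonneg by (auto simp: holder_def one_def)

lemma is_holder_one [simp]: "is_holder X E one"
  using one_holder is_holder_def by blast

lemma is_holder_r [simp]: "is_holder X E r"
  using cone_is_holder c_nonneg r_cone by blast

lemma N_cmult: "is_holder X E h \<Longrightarrow> N (\<lambda>v. a * h v) = a * N h"
  using N_lin[of h h a 0] by simp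

text \<open>Apply the monotone functional \<open>N\<close> to the Harnack inequality with one of the
  two points fixed.\<close>

lemma cone_N_bounds:
  assumes "0 \<le> A" "log_cone X E A h" "v \<in> X"
  shows "N h \<le> exp A * h v * N one" "h v * N one \<le> exp A * N h" "0 \<le> N h"
proof -
  note h = cone_is_holder[OF assms(1,2)]
  have "N h \<le> N (\<lambda>u. (exp A * h v) * one u)"
    using cone_le[OF assms(1,2) _ assms(3)]
    by (intro N_mono h is_holder_cmult is_holder_one) (auto simp: one_def)
  then show "N h \<le> exp A * h v * N one" by (simp add: N_cmult)
  have "N (\<lambda>u. h v * one u) \<le> N (\<lambda>u. exp A * h u)"
    using cone_le[OF assms(1,2,3)]
    by (intro N_mono h is_holder_cmult is_holder_one) (auto simp: one_def)
  then show "h v * N one \<le> exp A * N h" by (simp add: N_cmult h)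
  have "N (\<lambda>u. 0 * h u) \<le> N h"
    using coneD(2)[OF assms(2)] by (intro N_mono h is_holder_cmult) auto
  then show "0 \<le> N h" using N_cmult[OF h, of 0] by simp
qed

lemma X_ne: "X \<noteq> {}"
proof
  assume "X = {}"
  then have "r = (\<lambda>v. 0 * r v)" using coneD(1)[OF r_cone] by (auto simp: fun_eq_iff)
  then have "N r = N (\<lambda>v. 0 * r v)" by (rule arg_cong)
  also have "\<dots> = 0" using N_cmult[OF is_holder_r, of 0] by simp
  finally show False using N_r by simp
qed

text \<open>The normalisation \<open>N r = 1\<close> and the Harnack inequality give
  \<open>1 \<le> exp c * r v * N one\<close>, which excludes \<open>N one \<le> 0\<close>.\<close>

lemma N_one_pos: "0 < N one"
proof -
  obtain v where v: "v \<in> X" using X_ne by auto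
  have "1 \<le> exp c * r v * N one" "0 \<le> r v"
    using cone_N_bounds(1)[OF c_nonneg r_cone v] N_r coneD(2)[OF r_cone v] by auto
  show ?thesis
  proof (rule ccontr)
    assume "\<not> 0 < N one"
    then have "exp c * r v * N one \<le> 0"
      using \<open>0 \<le> r v\<close> by (intro mult_nonneg_nonpos) auto
    then show False using \<open>1 \<le> exp c * r v * N one\<close> by linarith
  qed
qed

text \<open>The solution of \<open>A = 2 * c + 2 + q * A\<close>. It leaves the gap
  \<open>A - A' = c + 2\<close>, puts \<open>r\<close> into the cone since \<open>c \<le> A\<close>,
  and exceeds the constant 1 on which \<open>cone_shift\<close> relies.\<close>

definition A where "A = (2 * c + 2) / (1 - q)"
definition A' where "A' = c + q * A"

lemma A_facts: "2 \<le> A" "c \<le> A" "c \<le> A'" "0 \<le> A'" "A' < A"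
proof -
  have "A * (1 - q) = 2 * c + 2" using q by (simp add: A_def)
  then have eq: "A = 2 * c + 2 + q * A" by (simp add: algebra_simps)
  have "0 \<le> A" using q c_nonneg by (simp add: A_def)
  then have "0 \<le> q * A" using q by simp
  then show "2 \<le> A" "c \<le> A" "c \<le> A'" "0 \<le> A'" "A' < A"
    using eq c_nonneg by (auto simp: A'_def)
qed

text \<open>Quotient of the lower bound \<open>(A - A') * e\<close> for
  \<open>exp (A * e) - exp (A' * e)\<close> by the upper bound \<open>2 * A * e * exp A\<close> for
  \<open>exp (A * e) - exp (-(A' * e))\<close>; the \<open>e\<close> cancels. It is the share of
  \<open>\<psi>\<close> that \<open>cone_subtract\<close> can give up.\<close>

definition \<eta> where "\<eta> = (A - A') / (2 * A * exp A)"
text \<open>The factor \<open>exp (-(2 * A))\<close> pays for two Harnack inequalities in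
  \<open>S_cone\<close>, one for \<open>T h\<close> and one for \<open>r\<close>.\<close>

definition \<delta> where "\<delta> = \<eta> * exp (-(2 * A))"

lemma eta: "0 < \<eta>" "\<eta> \<le> 1"
proof -
  note A = A_facts
  have "A * 1 \<le> A * exp A" using A by (intro mult_left_mono) auto
  then have "A - A' \<le> 2 * A * exp A" using A by linarith
  then show "0 < \<eta>" "\<eta> \<le> 1" using A by (auto simp: \<eta>_def)
qed

lemma delta: "0 < \<delta>" "\<delta> \<le> 1"
proof -
  have "\<eta> * exp (-(2 * A)) \<le> 1 * 1"
    using eta A_facts by (intro mult_mono) auto
  then show "0 < \<delta>" "\<delta> \<le> 1" using eta by (auto simp: \<delta>_def)
qed

lemma cone_cmult: "log_cone X E a h \<Longrightarrow> 0 \<le> b \<Longrightarrow> log_cone X E a (\<lambda>v. b * h v)"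
  by (auto simp: log_cone_def mult_left_mono mult.left_commute)

text \<open>With \<open>e = E u v\<close> the cone inequality reduces to \<open>(exp (A * e) - exp
  (-(A' * e))) * \<rho> v \<le> (exp (A * e) - exp (A' * e)) * \<psi> v\<close>. As
  \<open>A' < A\<close>, both brackets are of exact order \<open>e\<close> near 0, so one ratio
  \<open>\<eta>\<close> works for all \<open>e\<close>.\<close>

lemma cone_subtract:
  assumes \<psi>: "log_cone X E A' \<psi>" and \<rho>: "log_cone X E A' \<rho>" and le: "\<And>v. v \<in> X \<Longrightarrow> \<rho> v \<le> \<eta> * \<psi> v"
  shows "log_cone X E A (\<lambda>v. \<psi> v - \<rho> v)"
proof (rule coneI)
  fix v assume v: "v \<in> X"
  have "\<eta> * \<psi> v \<le> 1 * \<psi> v"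
    using eta coneD(2)[OF \<psi> v] by (intro mult_right_mono) auto
  then show "0 \<le> \<psi> v - \<rho> v" using le[OF v] by linarith
next
  fix u v assume uv: "u \<in> X" "v \<in> X"
  define e where "e = E u v"
  have e: "0 \<le> e" "e \<le> 1" using E_nonneg[OF uv] E_le_1[OF uv] by (auto simp: e_def)
  note A = A_facts
  have "exp (-(A' * e)) * \<rho> v \<le> exp (-(A' * e)) * (exp (A' * e) * \<rho> u)"
    using coneD(3)[OF \<rho> uv(2,1)] E_sym[of u v] by (intro mult_left_mono) (auto simp: e_def)
  then have 1: "exp (-(A' * e)) * \<rho> v \<le> \<rho> u"
    by (simp add: mult.assoc[symmetric] exp_add[symmetric])
  have 2: "\<psi> u \<le> exp (A' * e) * \<psi> v" using coneD(3)[OF \<psi> uv] by (simp add: e_def)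
  have le1: "A' * e \<le> A * e" and le2: "-(A' * e) \<le> A * e" and le3: "A * e \<le> A"
    
  proof -
    show "A' * e \<le> A * e" using A e by (intro mult_right_mono) auto
    have "0 \<le> A' * e" "0 \<le> A * e" using A e by auto
    then show "-(A' * e) \<le> A * e" by linarith
    show "A * e \<le> A" using A e by (simp add: mult_left_le)
  qed
  have "(A - A') * e \<le> (A * e - A' * e) * exp (A' * e)"
  proof -
    have "(A - A') * e * 1 \<le> (A - A') * e * exp (A' * e)"
      using A e by (intro mult_left_mono) auto
    then show ?thesis by (simp add: algebra_simps)
  qed
  also have "\<dots> \<le> exp (A * e) - exp (A' * e)" by (rule exp_diff_le(2)[OF le1])
  finally have 3: "(A - A') * e \<le> exp (A * e) - exp (A' * e)" .
  have "exp (A * e) - exp (-(A' * e)) \<le> (A * e - -(A' * e)) * exp (A * e)"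
    by (rule exp_diff_le(1)[OF le2])
  also have "\<dots> \<le> (2 * A * e) * exp A"
  proof (rule mult_mono)
    show "A * e - -(A' * e) \<le> 2 * A * e" using le1 by linarith
  qed (use A e le3 in auto)
  finally have "\<eta> * (exp (A * e) - exp (-(A' * e))) \<le> \<eta> * ((2 * A * e) * exp A)"
    using eta by (intro mult_left_mono) auto
  also have "\<dots> = (A - A') * e" using A by (simp add: \<eta>_def)
  finally have 4: "\<eta> * (exp (A * e) - exp (-(A' * e))) \<le> exp (A * e) - exp (A' * e)"
    using 3 by linarith
  have "(exp (A * e) - exp (-(A' * e))) * \<rho> v \<le> (exp (A * e) - exp (-(A' * e))) * (\<eta> * \<psi> v)"
    using le[OF uv(2)] le2 by (intro mult_left_mono) auto
  also have "\<dots> = (\<eta> * (exp (A * e) - exp (-(A' * e)))) * \<psi> v" by (simp add: mult_ac)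
  also have "\<dots> \<le> (exp (A * e) - exp (A' * e)) * \<psi> v"
    using 4 coneD(2)[OF \<psi> uv(2)] by (rule mult_right_mono)
  finally show "\<psi> u - \<rho> u \<le> exp (A * E u v) * (\<psi> v - \<rho> v)"
    using 1 2 unfolding e_def[symmetric] by (simp add: algebra_simps)
qed (use \<psi> \<rho> in \<open>auto simp: log_cone_def\<close>)

section \<open>The cone-preserving operator \<open>S\<close> and the powers of
  \<open>L\<close>\<close>

definition S where "S h = (\<lambda>v. (1 / k) * T h v + (- (\<delta> * N h)) * r v)"
definition L where "L h = (\<lambda>v. T h v - k * N h * r v)"

text \<open>Comparing \<open>T h\<close> and \<open>r\<close> with \<open>N one\<close> gives
  \<open>N h * r v \<le> exp (2 * A) * (T h v / k)\<close>, so the choice of \<open>\<delta>\<close>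
  meets the condition of \<open>cone_subtract\<close>. The factor \<open>1 - \<delta>\<close> comes
  from \<open>N (T h) = k * N h\<close> and \<open>N r = 1\<close>.\<close>

lemma S_cone:
  assumes h: "log_cone X E A h" shows "log_cone X E A (S h)" "N (S h) = (1 - \<delta>) * N h"
proof -
  have A0: "0 \<le> A" and A'0: "0 \<le> A'" using A_facts by auto
  have Th: "log_cone X E A' (T h)" using T_cone[OF A0 h] by (simp add: A'_def)
  note hh = cone_is_holder[OF A0 h] and hTh = cone_is_holder[OF A'0 Th]
  have Nh: "0 \<le> N h" using X_ne cone_N_bounds(3)[OF A0 h] by auto
  show "N (S h) = (1 - \<delta>) * N h"
    unfolding S_def N_lin[OF hTh is_holder_r] using N_T[OF hh] N_r k_pos
    by (simp add: algebra_simps)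
  have \<psi>: "log_cone X E A' (\<lambda>v. (1 / k) * T h v)"
    using k_pos by (intro cone_cmult Th) auto
  have \<rho>: "log_cone X E A' (\<lambda>v. (\<delta> * N h) * r v)"
    using Nh delta A_facts by (intro cone_cmult cone_mono[OF r_cone]) auto
  have "log_cone X E A (\<lambda>v. (1 / k) * T h v - (\<delta> * N h) * r v)"
  proof (rule cone_subtract[OF \<psi> \<rho>])
    fix v assume v: "v \<in> X"
    have rA: "log_cone X E A r" and TA: "log_cone X E A (T h)"
      using cone_mono r_cone Th A_facts by auto
    have a: "k * N h \<le> exp A * T h v * N one"
      using cone_N_bounds(1)[OF A0 TA v] N_T[OF hh] by simp
    have b: "r v * N one \<le> exp A"
      using cone_N_bounds(2)[OF A0 rA v] N_r by simp
    have "k * N h * (r v * N one) \<le> exp A * T h v * N one * exp A"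
      using Nh k_pos coneD(2)[OF r_cone v] coneD(2)[OF Th v] N_one_pos
      by (intro mult_mono[OF a b]) auto
    then have "(k * N h * r v) * N one \<le> (exp A * T h v * exp A) * N one"
      by (simp only: mult_ac)
    then have "k * N h * r v \<le> exp A * T h v * exp A"
      using N_one_pos by (rule mult_right_le_imp_le)
    moreover have "exp (2 * A) = exp A * exp A" by (simp add: exp_add[symmetric])
    ultimately have "N h * r v \<le> exp (2 * A) * ((1 / k) * T h v)"
      using k_pos by (simp only:) (simp add: field_simps)
    then have "\<delta> * (N h * r v) \<le> \<delta> * (exp (2 * A) * ((1 / k) * T h v))"
      using delta by (intro mult_left_mono) auto
    also have "\<dots> = \<eta> * ((1 / k) * T h v)"
      by (simp add: \<delta>_def exp_minus)
    finally show "\<delta> * N h * r v \<le> \<eta> * (1 / k * T h v)" by (simp add: mult_ac)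
  qed
  then show "log_cone X E A (S h)" by (simp add: S_def)
qed

lemma Sn_cone:
  assumes "log_cone X E A h"
  shows "log_cone X E A ((S ^^ n) h) \<and> N ((S ^^ n) h) = (1 - \<delta>) ^ n * N h"
  by (induction n) (use assms S_cone in auto)

text \<open>After adding \<open>2 * G\<close> the values are at least \<open>G\<close>, while the
  oscillation is still at most \<open>G * E u v\<close>, so the logarithm is 1-Lipschitz for
  \<open>E\<close>. Every Hoelder function is thus a difference of two cone functions.\<close>

lemma cone_shift:
  assumes "holder X E G h"
  shows "log_cone X E A (\<lambda>v. h v + (2 * G) * one v)" "log_cone X E A (\<lambda>v. (2 * G) * one v)"
proof -
  have G: "0 \<le> G" and A1: "1 \<le> A" using assms A_facts by (auto simp: holder_def)
  show "log_cone X E A (\<lambda>v. h v + (2 * G) * one v)"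
  proof (rule coneI)
    fix v assume v: "v \<in> X"
    show "0 \<le> h v + (2 * G) * one v"
      using holderD(3)[OF assms v] G v by (simp add: one_def)
  next
    fix u v assume uv: "u \<in> X" "v \<in> X"
    have hv: "G \<le> h v + 2 * G" using holderD(3)[OF assms uv(2)] by simp
    have "h u - h v \<le> G * E u v" using holderD(4)[OF assms uv] by simp
    also have "\<dots> \<le> (h v + 2 * G) * (A * E u v)"
    proof (rule mult_mono)
      show "E u v \<le> A * E u v"
        using mult_right_mono[OF A1 E_nonneg[OF uv]] by simp
    qed (use hv E_nonneg[OF uv] G in auto)
    finally have "h u + 2 * G \<le> (1 + A * E u v) * (h v + 2 * G)"
      by (simp add: algebra_simps)
    also have "\<dots> \<le> exp (A * E u v) * (h v + 2 * G)"
      using hv G by (intro mult_right_mono exp_ge_add_one_self) auto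
    finally show "h u + (2 * G) * one u \<le> exp (A * E u v) * (h v + (2 * G) * one v)"
      using uv by (simp add: one_def)
  qed (use assms in \<open>auto simp: holder_def one_def\<close>)
  show "log_cone X E A (\<lambda>v. (2 * G) * one v)"
  proof (rule coneI)
    fix u v assume uv: "u \<in> X" "v \<in> X"
    have "1 \<le> exp (A * E u v)" using A1 E_nonneg[OF uv] by simp
    then have "(2 * G) * 1 \<le> (2 * G) * exp (A * E u v)" using G by (intro mult_left_mono) auto
    then show "(2 * G) * one u \<le> exp (A * E u v) * ((2 * G) * one v)"
      using uv by (simp add: one_def mult.commute)
  qed (use G in \<open>auto simp: one_def\<close>)
qed

text \<open>\<open>T_cone\<close> speaks of cone functions only; the splitting of
  \<open>cone_shift\<close> extends it to all Hoelder functions.\<close>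

lemma is_holder_T:
  assumes "is_holder X E h" shows "is_holder X E (T h)"
proof -
  obtain G where G: "holder X E G h" using assms by (auto simp: is_holder_def)
  have A0: "0 \<le> A" "0 \<le> c + q * A" using A_facts by (auto simp: A'_def[symmetric])
  note c1 = cone_shift(1)[OF G] and c2 = cone_shift(2)[OF G]
  have hol: "is_holder X E (T (\<lambda>v. h v + (2 * G) * one v))" "is_holder X E (T (\<lambda>v. (2 * G) * one v))"
    using T_cone[OF A0(1) c1] T_cone[OF A0(1) c2] cone_is_holder[OF A0(2)] by auto
  have "T h = T (\<lambda>v. 1 * (h v + (2 * G) * one v) + (-1) * ((2 * G) * one v))"
    by (simp add: algebra_simps)
  also have "\<dots> = (\<lambda>v. T (\<lambda>v. h v + (2 * G) * one v) v - T (\<lambda>v. (2 * G) * one v) v)"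
    by (subst T_lin[OF cone_is_holder[OF A0(1) c1] cone_is_holder[OF A0(1) c2]]) simp
  finally have eq: "T h = (\<lambda>v. T (\<lambda>v. h v + (2 * G) * one v) v - T (\<lambda>v. (2 * G) * one v) v)" .
  show ?thesis unfolding eq by (rule is_holder_diff[OF hol])
qed

lemma is_holder_L: "is_holder X E h \<Longrightarrow> is_holder X E (L h)"
  unfolding L_def by (intro is_holder_diff is_holder_T is_holder_cmult is_holder_r)

lemma L_lin:
  assumes "is_holder X E h" "is_holder X E h'"
  shows "L (\<lambda>v. a * h v + b * h' v) = (\<lambda>v. a * L h v + b * L h' v)"
  unfolding L_def T_lin[OF assms] N_lin[OF assms] by (simp add: algebra_simps)

lemma is_holder_Ln: "is_holder X E h \<Longrightarrow> is_holder X E ((L ^^ n) h)"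
  by (induction n) (auto intro: is_holder_L)

lemma Ln_lin:
  assumes "is_holder X E h" "is_holder X E h'"
  shows "(L ^^ n) (\<lambda>v. a * h v + b * h' v) = (\<lambda>v. a * (L ^^ n) h v + b * (L ^^ n) h' v)"
  by (induction n) (use assms in \<open>auto simp: L_lin is_holder_Ln\<close>)

lemma L_r: "L r = (\<lambda>v. 0)"
  by (simp add: L_def T_r N_r)

lemma N_L: "is_holder X E h \<Longrightarrow> N (L h) = 0"
  unfolding L_def using N_lin[of "T h" r 1 "- (k * N h)"]
  by (simp add: is_holder_T N_T N_r)

text \<open>Since \<open>L r = 0\<close>, each step acts on the iterate of \<open>S\<close> only,
  and \<open>L \<psi> = k * (S \<psi> - (1 - \<delta>) * N \<psi> * r)\<close>. The identity starts
  at exponent 1: at exponent 0 the right-hand side would be \<open>h - N h * r\<close>.\<close>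

lemma Ln_cone:
  assumes h: "log_cone X E A h"
  shows "(L ^^ Suc n) h =
    (\<lambda>v. k ^ Suc n * (S ^^ Suc n) h v + (- (k ^ Suc n * (1 - \<delta>) ^ Suc n * N h)) * r v)"
proof (induction n)
  case 0
  then show ?case using k_pos by (simp add: L_def S_def fun_eq_iff algebra_simps)
next
  case (Suc n)
  have c: "log_cone X E A ((S ^^ Suc n) h)" and N: "N ((S ^^ Suc n) h) = (1 - \<delta>) ^ Suc n * N h"
    using Sn_cone[OF h, of "Suc n"] by auto
  define \<psi> where "\<psi> = (S ^^ Suc n) h"
  have hol: "is_holder X E \<psi>" using cone_is_holder[OF _ c] A_facts by (auto simp: \<psi>_def)
  have "(L ^^ Suc (Suc n)) h = L ((L ^^ Suc n) h)" by simp
  also have "\<dots> = (\<lambda>v. k ^ Suc n * L \<psi> v)"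
    unfolding Suc \<psi>_def[symmetric] L_lin[OF hol is_holder_r] L_r by simp
  also have "\<dots> = (\<lambda>v. k ^ Suc (Suc n) * S \<psi> v
      + (- (k ^ Suc (Suc n) * (1 - \<delta>) ^ Suc (Suc n) * N h)) * r v)"
  proof -
    define P K where "P = (1 - \<delta>) ^ Suc n * N h" and "K = k ^ Suc n"
    have "K * (T \<psi> v - k * P * r v)
        = k * K * (1 / k * T \<psi> v + - (\<delta> * P) * r v) + - (k * K * ((1 - \<delta>) * P)) * r v" for v
      using k_pos by (simp add: field_simps)
    then show ?thesis
      unfolding L_def S_def N[folded \<psi>_def] P_def[symmetric] K_def[symmetric]
        power_Suc[of _ "Suc n"] mult.assoc[of "k" "k ^ Suc n"] mult.assoc[of "1 - \<delta>"]
      by (simp add: fun_eq_iff mult.assoc, simp add: P_def)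
  qed
  finally show ?case by (simp add: \<psi>_def)
qed

text \<open>A cone function \<open>\<psi>\<close> is bounded by
  \<open>exp A * N \<psi> / N one\<close>. This is applied to the iterate of \<open>S\<close> and to
  \<open>r\<close>, and the two resulting terms are equal; hence the 2.\<close>

lemma Ln_cone_bound:
  assumes h: "log_cone X E A h"
  shows "holder X E ((2 * (1 + A * exp A) * exp A / N one) * (k * (1 - \<delta>)) ^ Suc n * N h)
    ((L ^^ Suc n) h)"
proof -
  define B where "B = (1 + A * exp A) * (exp A / N one)"
  define x where "x = (1 - \<delta>) ^ Suc n * N h"
  have A0: "0 \<le> A" using A_facts by simp
  have bd: "holder X E (B * N \<psi>) \<psi>" if \<psi>: "log_cone X E A \<psi>" for \<psi>
  proof -
    have "holder X E ((1 + A * exp A) * (exp A * N \<psi> / N one)) \<psi>"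
      using cone_N_bounds[OF A0 \<psi>] X_ne N_one_pos
      by (intro cone_holder[OF A0 \<psi>]) (auto simp: field_simps)
    then show ?thesis by (simp add: B_def mult.assoc)
  qed
  have c: "log_cone X E A ((S ^^ Suc n) h)" and N: "N ((S ^^ Suc n) h) = x"
    using Sn_cone[OF h, of "Suc n"] by (auto simp: x_def)
  have x0: "0 \<le> x"
    using cone_N_bounds(3)[OF A0 c] N X_ne by auto
  have r: "holder X E B r"
    using bd[OF cone_mono[OF r_cone]] A_facts N_r by simp
  have "holder X E (norm (k ^ Suc n) * (B * x) + norm (- (k ^ Suc n * x)) * B)
     (\<lambda>v. k ^ Suc n * (S ^^ Suc n) h v + (- (k ^ Suc n * x)) * r v)"
    using bd[OF c] unfolding N by (intro holder_add holder_cmult r)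
  moreover have "norm (k ^ Suc n) * (B * x) + norm (- (k ^ Suc n * x)) * B
      = (2 * (1 + A * exp A) * exp A / N one) * (k * (1 - \<delta>)) ^ Suc n * N h"
  proof -
    have "norm (k ^ Suc n) * (B * x) + norm (- (k ^ Suc n * x)) * B = 2 * B * (k ^ Suc n * x)"
      using k_pos x0 by (simp add: abs_mult)
    then show ?thesis by (simp add: x_def power_mult_distrib B_def)
  qed
  ultimately show ?thesis
    unfolding Ln_cone[OF h] x_def by (simp add: mult.assoc)
qed

theorem L_decay:
  "\<exists>C b. 0 \<le> C \<and> 0 \<le> b \<and> b < k \<and>
    (\<forall>h G n. holder X E G h \<longrightarrow> holder X E (C * b ^ n * G) ((L ^^ n) h))"
proof -
  define D where "D = 2 * (1 + A * exp A) * exp A / N one"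
  define b where "b = k * (1 - \<delta>)"
  \<comment> \<open>The summand 1 serves \<open>n = 0\<close>; the 5 comes from
    \<open>N h1 \<le> 3 * G * N one\<close> and \<open>N h2 = 2 * G * N one\<close>.\<close>
  define C where "C = 1 + D * (5 * N one)"
  have A0: "0 \<le> A" using A_facts by simp
  have D: "0 \<le> D" using A0 N_one_pos by (auto simp: D_def)
  have C: "0 \<le> C" "1 \<le> C" using D N_one_pos by (auto simp: C_def)
  have b: "0 \<le> b" "b < k" using delta k_pos by (auto simp: b_def)
  have "holder X E (C * b ^ n * G) ((L ^^ n) h)" if G: "holder X E G h" for h G n
  proof (cases n)
    case 0
    then show ?thesis
      using holder_mono[OF G, of "C * G"] E_nonneg C holderD(1)[OF G] mult_right_mono[OF C(2)]
      by auto
  next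
    case (Suc m)
    have G0: "0 \<le> G" using G by (simp add: holder_def)
    have hh: "is_holder X E h" using G by (auto simp: is_holder_def)
    define h1 where "h1 = (\<lambda>v. h v + (2 * G) * one v)"
    define h2 where "h2 = (\<lambda>v. (2 * G) * one v)"
    have c: "log_cone X E A h1" "log_cone X E A h2"
      using cone_shift[OF G] by (auto simp: h1_def h2_def)
    note hol = cone_is_holder[OF A0 c(1)] cone_is_holder[OF A0 c(2)]
    have "N h \<le> N (\<lambda>v. G * one v)"
    proof (rule N_mono[OF hh])
      show "is_holder X E (\<lambda>v. G * one v)" by (intro is_holder_cmult) simp
      show "h v \<le> G * one v" if "v \<in> X" for v
        using holderD(3)[OF G that] that by (simp add: one_def)
    qed
    then have Nh: "N h1 + N h2 \<le> 5 * G * N one"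
      using N_lin[OF hh is_holder_one, of 1 "2 * G"] N_cmult[OF is_holder_one, of "2 * G"]
        N_cmult[OF is_holder_one, of G]
      by (simp add: h1_def h2_def algebra_simps)
    have eq: "h = (\<lambda>v. 1 * h1 v + (-1) * h2 v)" by (simp add: h1_def h2_def)
    have eqL: "(L ^^ n) h = (\<lambda>v. (L ^^ n) h1 v + (-1) * (L ^^ n) h2 v)"
      by (subst eq, subst Ln_lin[OF hol]) simp
    have bd: "holder X E (D * b ^ n * N h1 + norm (-1::real) * (D * b ^ n * N h2))
       (\<lambda>v. (L ^^ n) h1 v + (-1) * (L ^^ n) h2 v)"
      unfolding Suc D_def b_def by (intro holder_add holder_cmult Ln_cone_bound c)
    have le: "D * b ^ n * N h1 + norm (-1::real) * (D * b ^ n * N h2) \<le> C * b ^ n * G"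
    proof -
      have "D * b ^ n * (N h1 + N h2) \<le> D * b ^ n * (5 * G * N one)"
        using Nh D b by (intro mult_left_mono) auto
      also have "\<dots> = (D * (5 * N one)) * (b ^ n * G)" by (simp add: mult_ac)
      also have "\<dots> \<le> C * (b ^ n * G)"
        using b G0 by (intro mult_right_mono) (auto simp: C_def)
      finally show ?thesis by (simp add: algebra_simps)
    qed
    show ?thesis unfolding eqL by (rule holder_mono[OF bd le E_nonneg])
  qed
  then show ?thesis using C b by blast
qed

end

section \<open>Resolvents by Neumann series\<close>

text \<open>\<open>decay\<close> with \<open>n = 1\<close> says that \<open>L\<close> is bounded;
  for all \<open>n\<close> together it will give the resolvent at every \<open>z\<close> with
  \<open>cmod z > b\<close>.\<close>

locale power_decay =
  fixes X :: "'a set" and E :: "'a \<Rightarrow> 'a \<Rightarrow> real" and L :: "('a \<Rightarrow> complex) \<Rightarrow> 'a \<Rightarrow> complex"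
    and C b :: real
  assumes E_nonneg: "u \<in> X \<Longrightarrow> v \<in> X \<Longrightarrow> 0 \<le> E u v"
    and L_lin: "is_holder X E \<phi> \<Longrightarrow> is_holder X E \<psi> \<Longrightarrow>
      L (\<lambda>v. x * \<phi> v + y * \<psi> v) = (\<lambda>v. x * L \<phi> v + y * L \<psi> v)"
    and C_nonneg: "0 \<le> C" and b_nonneg: "0 \<le> b"
    and decay: "holder X E G \<phi> \<Longrightarrow> holder X E (C * b ^ n * G) ((L ^^ n) \<phi>)"
begin

lemma is_holder_Ln: "is_holder X E \<phi> \<Longrightarrow> is_holder X E ((L ^^ n) \<phi>)"
  unfolding is_holder_def using decay by blast

lemma is_holder_L: "is_holder X E \<phi> \<Longrightarrow> is_holder X E (L \<phi>)"
  using is_holder_Ln[of _ 1] by simp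

lemma Ln_lin:
  assumes "is_holder X E \<phi>" "is_holder X E \<psi>"
  shows "(L ^^ n) (\<lambda>v. x * \<phi> v + y * \<psi> v) = (\<lambda>v. x * (L ^^ n) \<phi> v + y * (L ^^ n) \<psi> v)"
  by (induction n) (use assms in \<open>auto simp: L_lin is_holder_Ln\<close>)

text \<open>The sum is taken pointwise, so it is not immediate that \<open>L\<close> may be applied
  term by term; \<open>L (neumann z \<phi>)\<close> is reached through
  \<open>neumann_commute\<close> instead.\<close>

definition neumann :: "complex \<Rightarrow> ('a \<Rightarrow> complex) \<Rightarrow> 'a \<Rightarrow> complex" where
  "neumann z \<phi> = (\<lambda>v. \<Sum>n. (L ^^ n) \<phi> v / z ^ Suc n)"

context
  fixes z :: complex assumes z: "b < cmod z"
begin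

lemma z_pos: "0 < cmod z" "z \<noteq> 0"
  using z b_nonneg by auto

text \<open>\<open>G\<close> is arbitrary so that the same majorant also serves differences, with
  \<open>G * E u v\<close> in its place.\<close>

lemma majorant_sums:
  "(\<lambda>n. C * b ^ n * G / cmod z ^ Suc n) sums (C / (cmod z - b) * G)"
proof -
  have "(\<lambda>n. (b / cmod z) ^ n) sums (1 / (1 - b / cmod z))"
    using z b_nonneg by (intro geometric_sums) (auto simp: divide_simps)
  then have "(\<lambda>n. (C * G / cmod z) * (b / cmod z) ^ n) sums ((C * G / cmod z) * (1 / (1 - b / cmod z)))"
    by (rule sums_mult)
  moreover have "(C * G / cmod z) * (1 / (1 - b / cmod z)) = C / (cmod z - b) * G"
  proof -
    have "cmod z * (1 - b / cmod z) = cmod z - b" using z_pos by (simp add: field_simps)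
    then show ?thesis by (simp add: divide_simps)
  qed
  moreover have "C * b ^ n * G / cmod z ^ Suc n = (C * G / cmod z) * (b / cmod z) ^ n" for n
    by (simp add: power_divide)
  ultimately show ?thesis by (simp only:)
qed

lemma neumann_summable:
  assumes "is_holder X E \<phi>"
  shows "summable (\<lambda>n. (L ^^ n) \<phi> v / z ^ Suc n)"
proof -
  obtain G where G: "holder X E G \<phi>" using assms by (auto simp: is_holder_def)
  show ?thesis
  proof (rule summable_comparison_test'[OF sums_summable[OF majorant_sums[of G]], of 0])
    fix n :: nat
    have "cmod ((L ^^ n) \<phi> v) \<le> C * b ^ n * G"
      using holderD(1,2,3)[OF decay[OF G, of n]] by (cases "v \<in> X") auto
    then show "norm ((L ^^ n) \<phi> v / z ^ Suc n) \<le> C * b ^ n * G / cmod z ^ Suc n"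
      by (simp only: norm_divide norm_power) (intro divide_right_mono, auto)
  qed
qed

lemma neumann_holder:
  assumes G: "holder X E G \<phi>"
  shows "holder X E (C / (cmod z - b) * G) (neumann z \<phi>)"
proof (rule holderI)
  have sm: "summable (\<lambda>n. (L ^^ n) \<phi> v / z ^ Suc n)" for v
    using neumann_summable G by (auto simp: is_holder_def)
  note maj = majorant_sums
  show "0 \<le> C / (cmod z - b) * G"
    using C_nonneg z holderD(1)[OF G] by auto
  show "neumann z \<phi> v = 0" if "v \<notin> X" for v
    using holderD(2)[OF decay[OF G] that] by (simp add: neumann_def)
  show "norm (neumann z \<phi> v) \<le> C / (cmod z - b) * G" if v: "v \<in> X" for v
    unfolding neumann_def
  proof (rule norm_suminf_le[OF _ sums_summable[OF maj[of G]], THEN order_trans])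
    show "norm ((L ^^ n) \<phi> v / z ^ Suc n) \<le> C * b ^ n * G / cmod z ^ Suc n" for n
      using holderD(3)[OF decay[OF G, of n] v]
      by (simp only: norm_divide norm_power) (intro divide_right_mono, auto)
  qed (use sums_unique[OF maj[of G]] in simp)
  show "norm (neumann z \<phi> u - neumann z \<phi> v) \<le> C / (cmod z - b) * G * E u v"
    if uv: "u \<in> X" "v \<in> X" for u v
    unfolding neumann_def suminf_diff[OF sm sm]
  proof (rule norm_suminf_le[OF _ sums_summable[OF maj[of "G * E u v"]], THEN order_trans])
    show "norm ((L ^^ n) \<phi> u / z ^ Suc n - (L ^^ n) \<phi> v / z ^ Suc n)
        \<le> C * b ^ n * (G * E u v) / cmod z ^ Suc n" for n
      using holderD(4)[OF decay[OF G, of n] uv]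
      by (simp only: norm_divide norm_power diff_divide_distrib[symmetric])
        (intro divide_right_mono, auto simp: mult.assoc)
  qed (use sums_unique[OF maj[of "G * E u v"]] in \<open>simp add: mult.assoc\<close>)
qed

lemma is_holder_neumann: "is_holder X E \<phi> \<Longrightarrow> is_holder X E (neumann z \<phi>)"
  using neumann_holder by (auto simp: is_holder_def)

lemma neumann_lin:
  assumes "is_holder X E \<phi>" "is_holder X E \<psi>"
  shows "neumann z (\<lambda>v. x * \<phi> v + y * \<psi> v) = (\<lambda>v. x * neumann z \<phi> v + y * neumann z \<psi> v)"
proof
  fix v
  note s1 = neumann_summable[OF assms(1), of v] and s2 = neumann_summable[OF assms(2), of v]
  have "neumann z (\<lambda>v. x * \<phi> v + y * \<psi> v) v
      = (\<Sum>n. x * ((L ^^ n) \<phi> v / z ^ Suc n) + y * ((L ^^ n) \<psi> v / z ^ Suc n))"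
    unfolding neumann_def Ln_lin[OF assms] by (simp add: add_divide_distrib)
  also have "\<dots> = (\<Sum>n. x * ((L ^^ n) \<phi> v / z ^ Suc n)) + (\<Sum>n. y * ((L ^^ n) \<psi> v / z ^ Suc n))"
    by (intro suminf_add[symmetric] summable_mult s1 s2)
  also have "\<dots> = x * neumann z \<phi> v + y * neumann z \<psi> v"
    unfolding neumann_def using suminf_mult[OF s1] suminf_mult[OF s2] by simp
  finally show "neumann z (\<lambda>v. x * \<phi> v + y * \<psi> v) v = x * neumann z \<phi> v + y * neumann z \<psi> v" .
qed

text \<open>Replacing \<open>\<phi>\<close> by \<open>L \<phi>\<close> shifts the series by one
  index and multiplies it by \<open>z\<close>; only the term of index 0 survives in the
  difference.\<close>

lemma neumann_L:
  assumes "is_holder X E \<phi>"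
  shows "z * neumann z \<phi> v - neumann z (L \<phi>) v = \<phi> v"
proof -
  define a where "a n = (L ^^ n) \<phi> v / z ^ Suc n" for n
  have s: "summable a" using neumann_summable[OF assms] by (simp add: a_def[abs_def])
  have "neumann z (L \<phi>) v = (\<Sum>n. z * a (Suc n))"
    using z_pos by (simp add: neumann_def a_def funpow_swap1)
  also have "\<dots> = z * (\<Sum>n. a (Suc n))"
    using s by (intro suminf_mult) (simp add: summable_Suc_iff)
  also have "(\<Sum>n. a (Suc n)) = suminf a - a 0"
    by (rule suminf_split_head[OF s])
  finally have "z * neumann z \<phi> v - neumann z (L \<phi>) v = z * a 0"
    by (simp add: neumann_def a_def[abs_def] algebra_simps)
  then show ?thesis using z_pos by (simp add: a_def)
qed

lemma neumann_right_inverse: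
  assumes "is_holder X E \<phi>"
  shows "neumann z (\<lambda>v. z * \<phi> v - L \<phi> v) = \<phi>"
  using neumann_lin[OF assms is_holder_L[OF assms], of z "-1"] neumann_L[OF assms]
  by (simp add: fun_eq_iff)

text \<open>The commutator \<open>D = L R - R L\<close> satisfies \<open>D \<phi> = D (L \<phi>) / z\<close>, so it is \<open>O((b / cmod z) ^ n)\<close>
  for every \<open>n\<close>.\<close>

lemma neumann_commute:
  assumes "is_holder X E \<phi>"
  shows "L (neumann z \<phi>) v = neumann z (L \<phi>) v"
proof -
  define D where "D \<psi> v = L (neumann z \<psi>) v - neumann z (L \<psi>) v" for \<psi> v
  have step: "D \<psi> v = D (L \<psi>) v / z" if \<psi>: "is_holder X E \<psi>" for \<psi>
  proof -
    note hL = is_holder_L[OF \<psi>]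
    \<comment> \<open>One term of the series is split off, so that \<open>L\<close> meets a sum of
      two Hoelder functions and linearity suffices.\<close>
    have "neumann z \<psi> = (\<lambda>v. (1 / z) * \<psi> v + (1 / z) * neumann z (L \<psi>) v)"
    proof
      fix w
      have "z * neumann z \<psi> w = \<psi> w + neumann z (L \<psi>) w"
        using neumann_L[OF \<psi>, of w] by (simp add: algebra_simps)
      then show "neumann z \<psi> w = (1 / z) * \<psi> w + (1 / z) * neumann z (L \<psi>) w"
        using z_pos by (simp add: field_simps)
    qed
    then have "L (neumann z \<psi>) = L (\<lambda>v. (1 / z) * \<psi> v + (1 / z) * neumann z (L \<psi>) v)"
      by simp
    also have "\<dots> = (\<lambda>v. (1 / z) * L \<psi> v + (1 / z) * L (neumann z (L \<psi>)) v)"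
      by (rule L_lin[OF \<psi> is_holder_neumann[OF hL]])
    finally have 1: "L (neumann z \<psi>) v = (L \<psi> v + L (neumann z (L \<psi>)) v) / z"
      by (simp add: add_divide_distrib)
    have 2: "z * neumann z (L \<psi>) v = L \<psi> v + neumann z (L (L \<psi>)) v"
      using neumann_L[OF hL, of v] by (simp add: algebra_simps)
    show ?thesis unfolding D_def 1 using z_pos 2 by (simp add: field_simps)
  qed
  have iter: "D \<phi> v = D ((L ^^ n) \<phi>) v / z ^ n" for n
    by (induction n) (use step is_holder_Ln[OF assms] in auto)
  obtain G where G: "holder X E G \<phi>" using assms by (auto simp: is_holder_def)
  \<comment> \<open>One factor \<open>C / (cmod z - b)\<close> from \<open>neumann_holder\<close>,
    \<open>C * b\<close> from a single \<open>L\<close>, \<open>C * G\<close> from the iterate, and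
    2 for the two terms of \<open>D\<close>.\<close>
  define K where "K = 2 * (C / (cmod z - b) * (C * b)) * (C * G)"
  have bound: "cmod (D \<phi> v) \<le> K * (b / cmod z) ^ n" for n
  proof -
    define H where "H = C * b ^ n * G"
    have h: "holder X E H ((L ^^ n) \<phi>)" using decay[OF G] by (simp add: H_def)
    have 1: "holder X E (C * b ^ 1 * (C / (cmod z - b) * H)) ((L ^^ 1) (neumann z ((L ^^ n) \<phi>)))"
      by (intro decay neumann_holder h)
    have 2: "holder X E (C / (cmod z - b) * (C * b ^ 1 * H)) (neumann z ((L ^^ 1) ((L ^^ n) \<phi>)))"
      by (intro decay neumann_holder h)
    have "cmod (L (neumann z ((L ^^ n) \<phi>)) v) \<le> C * b * (C / (cmod z - b) * H)"
      "cmod (neumann z (L ((L ^^ n) \<phi>)) v) \<le> C / (cmod z - b) * (C * b * H)"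
      using holderD(1-3)[OF 1] holderD(1-3)[OF 2] by (cases "v \<in> X"; simp)+
    then have "cmod (D ((L ^^ n) \<phi>) v) \<le> C * b * (C / (cmod z - b) * H) + C / (cmod z - b) * (C * b * H)"
      unfolding D_def using norm_triangle_ineq4 by (meson add_mono order_trans)
    also have "\<dots> = K * b ^ n" by (simp add: K_def H_def mult_ac)
    finally have "cmod (D ((L ^^ n) \<phi>) v) / cmod z ^ n \<le> K * b ^ n / cmod z ^ n"
      by (intro divide_right_mono) auto
    then show ?thesis unfolding iter[of n] by (simp add: norm_divide norm_power power_divide)
  qed
  have "(\<lambda>n. K * (b / cmod z) ^ n) \<longlonglongrightarrow> K * 0"
    using z b_nonneg by (intro tendsto_mult_left LIMSEQ_realpow_zero) (auto simp: divide_simps)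
  then have "cmod (D \<phi> v) \<le> 0"
    using bound by (intro LIMSEQ_le_const) auto
  then show ?thesis by (simp add: D_def)
qed

lemma neumann_left_inverse:
  assumes "is_holder X E \<phi>"
  shows "(\<lambda>v. z * neumann z \<phi> v - L (neumann z \<phi>) v) = \<phi>"
  using neumann_commute[OF assms] neumann_L[OF assms] by (simp add: fun_eq_iff)

end
end

section \<open>The cross-ratio metric\<close>

lemma sphere_posD:
  assumes "v \<in> sphere_pos"
  shows "0 \<le> v $ i" "(\<Sum>i\<in>UNIV. v $ i) = 1" "v $ i \<le> 1"
proof -
  show *: "0 \<le> v $ i" for i using assms by (auto simp: sphere_pos_def)
  show "(\<Sum>i\<in>UNIV. v $ i) = 1" using assms by (auto simp: sphere_pos_def norm1_def)
  then show "v $ i \<le> 1"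
    using member_le_sum[of i UNIV "\<lambda>i. v $ i"] * by simp
qed

lemma norm1_nonneg: "(\<And>i. 0 \<le> v $ i) \<Longrightarrow> norm1 v = (\<Sum>i\<in>UNIV. v $ i)"
  by (simp add: norm1_def)

lemma norm1_ge_0: "0 \<le> norm1 v"
  by (simp add: norm1_def sum_nonneg)

lemma axis_sphere_pos: "axis i 1 \<in> sphere_pos"
  by (auto simp: sphere_pos_def norm1_def axis_def if_distrib sum.delta cong: if_cong)

text \<open>Coordinates are inner products with the vectors \<open>axis i 1\<close>, which belong to
  \<open>sphere_pos\<close>.\<close>

lemma sphere_epsD:
  assumes "v \<in> sphere_eps \<epsilon>"
  shows "v \<in> sphere_pos" "\<epsilon> \<le> v $ i" "f \<in> sphere_pos \<Longrightarrow> \<epsilon> \<le> f \<bullet> v"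
  using assms axis_sphere_pos[of i] by (auto simp: sphere_eps_def inner_axis' dest: bspec)

lemma inner_sphere_le:
  fixes f v :: "real ^ 'd"
  assumes "f \<in> sphere_pos" "v \<in> sphere_pos"
  shows "f \<bullet> v \<le> 1"
proof -
  have "f \<bullet> v = (\<Sum>i\<in>UNIV. f $ i * v $ i)" by (simp add: inner_vec_def)
  also have "\<dots> \<le> (\<Sum>i\<in>UNIV. f $ i * 1)"
    using sphere_posD assms by (intro sum_mono mult_left_mono) auto
  finally show ?thesis using sphere_posD(2)[OF assms(1)] by simp
qed

lemma inner_nonneg_mono:
  fixes F u v :: "real ^ 'd"
  assumes "\<And>i. 0 \<le> F $ i" "\<And>i. l * u $ i \<le> v $ i"
  shows "l * (F \<bullet> u) \<le> F \<bullet> v"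
proof -
  have "l * (F \<bullet> u) = (\<Sum>i\<in>UNIV. F $ i * (l * u $ i))"
    by (simp add: inner_vec_def sum_distrib_left mult_ac)
  also have "\<dots> \<le> (\<Sum>i\<in>UNIV. F $ i * v $ i)"
    using assms by (intro sum_mono mult_left_mono) auto
  finally show ?thesis by (simp add: inner_vec_def)
qed

lemma closed_sphere_eps: "closed (sphere_eps \<epsilon> :: (real ^ 'd) set)"
proof -
  have "sphere_eps \<epsilon> = (\<Inter>i. {v::real^'d. 0 \<le> v $ i}) \<inter> {v. (\<Sum>i\<in>UNIV. \<bar>v $ i\<bar>) = 1}
      \<inter> (\<Inter>f\<in>sphere_pos. {v. \<epsilon> \<le> f \<bullet> v})"
    by (auto simp: sphere_eps_def sphere_pos_def norm1_def)
  also have "closed \<dots>"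
    by (intro closed_Int closed_INT ballI closed_Collect_le closed_Collect_eq continuous_intros)
  finally show ?thesis .
qed

lemma closed_sphere_pos: "closed (sphere_pos :: (real ^ 'd) set)"
proof -
  have "sphere_pos = (\<Inter>i. {v::real^'d. 0 \<le> v $ i}) \<inter> {v. (\<Sum>i\<in>UNIV. \<bar>v $ i\<bar>) = 1}"
    by (auto simp: sphere_pos_def norm1_def)
  also have "closed \<dots>"
    by (intro closed_Int closed_INT ballI closed_Collect_le closed_Collect_eq continuous_intros)
  finally show ?thesis .
qed

text \<open>For positive \<open>v\<close> the supremum is the minimum of the quotients
  \<open>u $ i / v $ i\<close>; it is finite and attained.\<close>

lemma cross_m_bounds:
  assumes "\<And>i. 0 \<le> u $ i" "\<And>i. 0 < v $ i"
  shows "0 \<le> cross_m u v" "cross_m u v * v $ i \<le> u $ i"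
    "0 \<le> l \<Longrightarrow> (\<And>i. l * v $ i \<le> u $ i) \<Longrightarrow> l \<le> cross_m u v"
proof -
  define K where "K = {l. 0 \<le> l \<and> (\<forall>i. l * v $ i \<le> u $ i)}"
  have K0: "0 \<in> K" using assms by (simp add: K_def)
  have le: "l \<le> u $ i / v $ i" if "l \<in> K" for l i
    using that assms(2)[of i] by (auto simp: K_def pos_le_divide_eq)
  have bdd: "bdd_above K" using le by (auto simp: bdd_above_def)
  show "0 \<le> cross_m u v" using cSup_upper[OF K0 bdd] by (simp add: cross_m_def K_def)
  have "cross_m u v \<le> u $ i / v $ i"
    unfolding cross_m_def K_def[symmetric] using K0 le by (intro cSup_least) auto
  then show "cross_m u v * v $ i \<le> u $ i" using assms(2)[of i] by (simp add: pos_le_divide_eq)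
  show "l \<le> cross_m u v" if "0 \<le> l" "\<And>i. l * v $ i \<le> u $ i"
    using that cSup_upper[OF _ bdd, of l] by (simp add: cross_m_def K_def)
qed

text \<open>On positive vectors this is \<open>exp (- h)\<close> for Hilbert's projective metric
  \<open>h\<close>, so that \<open>hdist\<close> is \<open>tanh (h / 2)\<close>.\<close>

definition cross_p :: "real ^ 'd \<Rightarrow> real ^ 'd \<Rightarrow> real" where
  "cross_p u v = cross_m u v * cross_m v u"

lemma hdist_cross_p: "hdist u v = (1 - cross_p u v) / (1 + cross_p u v)"
  by (simp add: hdist_def cross_p_def)

lemma hdist_commute: "hdist u v = hdist v u"
  by (simp add: hdist_def mult.commute)

text \<open>The symmetric hypotheses and the exponent \<open>- \<bar>s\<bar>\<close> cover both
  signs of \<open>s\<close>: a non-negative power uses the upper bound on \<open>x\<close>, a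
  negative one the lower bound.\<close>

lemma powr_ratio_le:
  fixes x y p s :: real
  assumes "0 < p" "p \<le> 1" "0 < x" "0 < y" "p * x \<le> y" "p * y \<le> x"
  shows "x powr s \<le> p powr (- \<bar>s\<bar>) * y powr s"
proof (cases "0 \<le> s")
  case True
  have "x \<le> y / p" using assms by (simp add: field_simps)
  then have "x powr s \<le> (y / p) powr s" using assms True by (intro powr_mono2) auto
  then show ?thesis using True assms by (simp add: powr_divide powr_minus field_simps)
next
  case False
  have "x powr s \<le> (p * y) powr s" using assms False by (intro powr_mono2') auto
  then show ?thesis using False assms by (simp add: powr_mult)
qed

context
  fixes \<epsilon> :: real
  assumes eps: "0 < \<epsilon>" "\<epsilon> < 1"
begin

text \<open>All coordinates lie between \<open>\<epsilon>\<close> and 1, and comparing the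
  coordinate sums, both equal to 1, bounds \<open>cross_m\<close> by 1. The last bound uses \<open>v
  $ i - u $ i \<le> norm (u - v) \<le> norm (u - v) / \<epsilon> * v $ i\<close>, where
  \<open>norm\<close> is Euclidean.\<close>

lemma cross_m_sphere:
  assumes u: "u \<in> sphere_eps \<epsilon>" and v: "v \<in> sphere_eps \<epsilon>"
  shows "\<epsilon> \<le> cross_m u v" "cross_m u v \<le> 1" "cross_m u v * v $ i \<le> u $ i"
    "1 - norm (u - v) / \<epsilon> \<le> cross_m u v"
proof -
  have pos: "\<And>i. 0 \<le> u $ i" "\<And>i. 0 < v $ i"
    using sphere_epsD(2)[OF u] sphere_epsD(2)[OF v] eps by (meson order_trans less_imp_le order_less_le_trans)+
  note m = cross_m_bounds[OF pos]
  have ue: "\<epsilon> \<le> u $ i" and ve: "\<epsilon> \<le> v $ i" and v1: "v $ i \<le> 1" for i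
    using sphere_epsD u v sphere_posD(3) by blast+
  show "\<epsilon> \<le> cross_m u v"
  proof (rule m(3))
    fix i
    have "\<epsilon> * v $ i \<le> \<epsilon>" using v1[of i] eps by (simp add: mult_left_le)
    then show "\<epsilon> * v $ i \<le> u $ i" using ue[of i] by simp
  qed (use eps in simp)
  show mi: "cross_m u v * v $ i \<le> u $ i" for i by (rule m(2))
  have "cross_m u v * (\<Sum>i\<in>UNIV. v $ i) \<le> (\<Sum>i\<in>UNIV. u $ i)"
    unfolding sum_distrib_left by (intro sum_mono mi)
  then show "cross_m u v \<le> 1"
    using sphere_posD(2)[OF sphere_epsD(1)[OF u]] sphere_posD(2)[OF sphere_epsD(1)[OF v]] by simp
  show "1 - norm (u - v) / \<epsilon> \<le> cross_m u v"
  proof (cases "0 \<le> 1 - norm (u - v) / \<epsilon>")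
    case True
    then show ?thesis
    proof (rule m(3))
      fix i
      have "v $ i - u $ i \<le> norm (u - v)"
        using component_le_norm_cart[of "u - v" i] by simp
      also have "norm (u - v) = norm (u - v) / \<epsilon> * \<epsilon>" using eps by simp
      also have "\<dots> \<le> norm (u - v) / \<epsilon> * v $ i"
        using ve[of i] eps by (intro mult_left_mono) auto
      finally show "(1 - norm (u - v) / \<epsilon>) * v $ i \<le> u $ i"
        by (simp add: left_diff_distrib)
    qed
  next
    case False
    then show ?thesis using m(1) by linarith
  qed
qed

text \<open>Both factors are at most 1, so \<open>cross_p\<close> is at most each of them, and
  \<open>1 - x * y \<le> (1 - x) + (1 - y)\<close>.\<close>

lemma cross_p_sphere:
  assumes u: "u \<in> sphere_eps \<epsilon>" and v: "v \<in> sphere_eps \<epsilon>"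
  shows "\<epsilon>\<^sup>2 \<le> cross_p u v" "cross_p u v \<le> 1" "0 < cross_p u v"
    "cross_p u v * u $ i \<le> v $ i" "cross_p u v * v $ i \<le> u $ i"
    "1 - cross_p u v \<le> 2 / \<epsilon> * norm (u - v)"
    "cross_p u v = 1 \<Longrightarrow> u = v"
proof -
  note a = cross_m_sphere[OF u v] and b = cross_m_sphere[OF v u]
  show "\<epsilon>\<^sup>2 \<le> cross_p u v"
    unfolding cross_p_def power2_eq_square using a b eps by (intro mult_mono) auto
  then show "0 < cross_p u v" using eps by (meson less_le_trans zero_less_power)
  show p1: "cross_p u v \<le> 1"
    unfolding cross_p_def using a b eps by (intro mult_le_one) auto
  have le: "cross_p u v \<le> cross_m u v" "cross_p u v \<le> cross_m v u"
    unfolding cross_p_def using a b eps by (auto simp: mult_left_le mult_left_le_one_le)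
  have nn: "0 \<le> u $ i" "0 \<le> v $ i" for i
    using sphere_posD(1) sphere_epsD(1) u v by blast+
  show "cross_p u v * v $ i \<le> u $ i" for i
    using a(3)[of i] mult_right_mono[OF le(1) nn(2)[of i]] by linarith
  show "cross_p u v * u $ i \<le> v $ i" for i
    using b(3)[of i] mult_right_mono[OF le(2) nn(1)[of i]] by linarith
  define x y where "x = cross_m u v" and "y = cross_m v u"
  have "0 \<le> (1 - x) * (1 - y)" using a b by (auto simp: x_def y_def)
  then have "1 - x * y \<le> (1 - x) + (1 - y)" by (simp add: algebra_simps)
  also have "\<dots> \<le> norm (u - v) / \<epsilon> + norm (v - u) / \<epsilon>"
    using a(4) b(4) by (auto simp: x_def y_def)
  finally show "1 - cross_p u v \<le> 2 / \<epsilon> * norm (u - v)"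
    by (simp add: cross_p_def x_def y_def norm_minus_commute)
  show "u = v" if "cross_p u v = 1"
  proof -
    have "1 \<le> cross_m u v" "1 \<le> cross_m v u" using le that by auto
    then have "u $ i = v $ i" for i
      using a(3)[of i] b(3)[of i] a(2) b(2) by simp
    then show ?thesis by (simp add: vec_eq_iff)
  qed
qed

text \<open>The denominator \<open>1 + cross_p u v\<close> lies between 1 and 2, so
  \<open>hdist\<close> and \<open>1 - cross_p\<close> are comparable. The Euclidean bound is what
  later makes Hoelder functions continuous.\<close>

lemma hdist_sphere:
  assumes u: "u \<in> sphere_eps \<epsilon>" and v: "v \<in> sphere_eps \<epsilon>"
  shows "0 \<le> hdist u v" "hdist u v \<le> 1" "hdist u v \<le> 2 / \<epsilon> * norm (u - v)"
    "u \<noteq> v \<Longrightarrow> 0 < hdist u v" "1 - cross_p u v \<le> 2 * hdist u v"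
proof -
  note p = cross_p_sphere[OF u v]
  show "0 \<le> hdist u v" "hdist u v \<le> 1" using p by (auto simp: hdist_cross_p divide_simps)
  have "hdist u v \<le> (1 - cross_p u v) / 1"
    unfolding hdist_cross_p using p by (intro divide_left_mono) auto
  then show "hdist u v \<le> 2 / \<epsilon> * norm (u - v)" using p(6) by simp
  show "0 < hdist u v" if "u \<noteq> v"
  proof -
    have "cross_p u v < 1" using p(2,7) that by fastforce
    then show ?thesis using p(3) by (simp add: hdist_cross_p)
  qed
  have "(1 - cross_p u v) * (1 + cross_p u v) \<le> (1 - cross_p u v) * 2"
    using p by (intro mult_left_mono) auto
  then show "1 - cross_p u v \<le> 2 * hdist u v"
    using p(3) by (simp add: hdist_cross_p pos_le_divide_eq mult.commute)
qed

text \<open>Since \<open>F\<close> is non-negative, \<open>p = cross_p u v\<close> bounds the ratio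
  of the two inner products from both sides. The constant comes from
  \<open>- ln p \<le> (1 - p) / p \<le> (1 - p) / \<epsilon>\<^sup>2\<close> and
  \<open>1 - p \<le> 2 * hdist u v\<close>.\<close>

lemma inner_powr_ratio:
  fixes F :: "real ^ 'd"
  assumes u: "u \<in> sphere_eps \<epsilon>" and v: "v \<in> sphere_eps \<epsilon>"
    and F: "\<And>i. 0 \<le> F $ i" "F \<noteq> 0"
  shows "0 < F \<bullet> u" "(F \<bullet> u) powr s \<le> exp (2 * \<bar>s\<bar> / \<epsilon>\<^sup>2 * hdist u v) * (F \<bullet> v) powr s"
proof -
  have pos: "0 < F \<bullet> w" if w: "w \<in> sphere_eps \<epsilon>" for w
  proof -
    obtain i where i: "F $ i \<noteq> 0" using F(2) by (auto simp: vec_eq_iff)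
    have wi: "0 < w $ i" for i using sphere_epsD(2)[OF w, of i] eps by linarith
    have "0 < F $ i * w $ i" using i F(1)[of i] wi[of i] by (simp add: order_less_le)
    also have "\<dots> \<le> (\<Sum>i\<in>UNIV. F $ i * w $ i)"
      using F(1) wi by (intro member_le_sum) (auto intro: mult_nonneg_nonneg less_imp_le)
    finally show ?thesis by (simp add: inner_vec_def)
  qed
  show "0 < F \<bullet> u" by (rule pos[OF u])
  note p = cross_p_sphere[OF u v]
  define p' where "p' = cross_p u v"
  have "(F \<bullet> u) powr s \<le> p' powr (- \<bar>s\<bar>) * (F \<bullet> v) powr s"
    unfolding p'_def
    by (intro powr_ratio_le pos u v p inner_nonneg_mono F)
  also have "p' powr (- \<bar>s\<bar>) \<le> exp (2 * \<bar>s\<bar> / \<epsilon>\<^sup>2 * hdist u v)"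
  proof -
    have p0: "0 < p'" using p by (simp add: p'_def)
    have "- ln p' = ln (1 / p')" using p0 by (simp add: ln_div)
    also have "\<dots> \<le> 1 / p' - 1" using p0 by (intro ln_le_minus_one) auto
    also have "\<dots> = (1 - p') / p'" using p0 by (simp add: field_simps)
    also have "\<dots> \<le> (1 - p') / \<epsilon>\<^sup>2"
      using p eps by (intro divide_left_mono) (auto simp: p'_def)
    also have "\<dots> \<le> 2 * hdist u v / \<epsilon>\<^sup>2"
      using hdist_sphere(5)[OF u v] by (intro divide_right_mono) (auto simp: p'_def)
    finally have "\<bar>s\<bar> * (- ln p') \<le> \<bar>s\<bar> * (2 * hdist u v / \<epsilon>\<^sup>2)"
      by (intro mult_left_mono) auto
    then show ?thesis using p0 by (simp add: powr_def mult_ac)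
  qed
  finally show "(F \<bullet> u) powr s \<le> exp (2 * \<bar>s\<bar> / \<epsilon>\<^sup>2 * hdist u v) * (F \<bullet> v) powr s"
    by (simp add: mult_right_mono)
qed

text \<open>A positive matrix sends no point of \<open>sphere_pos\<close> to 0, so the exception
  made in \<open>act_into\<close> does not occur.\<close>

lemma act_mem_sphere_eps:
  assumes "pos_mat a" "act_into \<epsilon> a" "v \<in> sphere_pos"
  shows "act a v \<in> sphere_eps \<epsilon>" "0 < (a *v v) $ i" "0 < norm1 (a *v v)"
proof -
  have sv: "0 \<le> v $ i" "(\<Sum>i\<in>UNIV. v $ i) = 1" for i using sphere_posD[OF assms(3)] by auto
  then obtain j where j: "v $ j \<noteq> 0"
    by (metis sum.neutral zero_neq_one)
  have pos: "0 < (a *v v) $ i" for i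
  proof -
    have "0 < a $ i $ j * v $ j"
      using j sv(1)[of j] assms(1) by (auto simp: pos_mat_def order_less_le)
    also have "\<dots> \<le> (\<Sum>j\<in>UNIV. a $ i $ j * v $ j)"
      using assms(1) sv by (intro member_le_sum mult_nonneg_nonneg) (auto simp: pos_mat_def less_imp_le)
    finally show ?thesis by (simp add: matrix_vector_mult_def)
  qed
  then show "0 < (a *v v) $ i" .
  have "a *v v \<noteq> 0" by (metis pos less_irrefl zero_index)
  then show "act a v \<in> sphere_eps \<epsilon>" using assms(2,3) by (auto simp: act_into_def)
  have "0 < (\<Sum>i\<in>UNIV. \<bar>(a *v v) $ i\<bar>)"
    using pos by (intro sum_pos) (auto simp: order_less_imp_not_eq2)
  then show "0 < norm1 (a *v v)" by (simp add: norm1_def)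
qed

text \<open>By homogeneity this is \<open>act_into\<close> for the normalised vector;
  \<open>w = 0\<close> is trivial.\<close>

lemma nonneg_image_ge:
  assumes a: "pos_mat a" "act_into \<epsilon> a" and w: "\<And>i. 0 \<le> w $ i"
  shows "\<epsilon> * norm1 (a *v w) \<le> (a *v w) $ i"
proof (cases "w = 0")
  case True
  then show ?thesis by (simp add: norm1_def)
next
  case False
  define n where "n = norm1 w"
  have n: "0 < n"
  proof -
    obtain j where "w $ j \<noteq> 0" using False by (auto simp: vec_eq_iff)
    then have "0 < \<bar>w $ j\<bar>" by simp
    also have "\<dots> \<le> (\<Sum>i\<in>UNIV. \<bar>w $ i\<bar>)" by (intro member_le_sum) auto
    finally show ?thesis by (simp add: n_def norm1_def)
  qed
  define v where "v = (1 / n) *\<^sub>R w"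
  have "(\<Sum>i\<in>UNIV. w $ i / n) = 1"
    using n w by (simp add: sum_divide_distrib[symmetric] n_def norm1_nonneg)
  then have v: "v \<in> sphere_pos"
    using w n by (simp add: sphere_pos_def norm1_def v_def)
  note av = act_mem_sphere_eps[OF a v]
  have "\<epsilon> \<le> act a v $ i" using sphere_epsD(2)[OF av(1)] .
  then have "\<epsilon> * norm1 (a *v v) \<le> (a *v v) $ i"
    using av(3) by (simp add: act_def pos_le_divide_eq)
  moreover have "a *v v = (1 / n) *\<^sub>R (a *v w)"
    by (simp add: v_def matrix_vector_mult_scaleR)
  moreover have "norm1 ((1 / n) *\<^sub>R (a *v w)) = norm1 (a *v w) / n"
    using n by (simp add: norm1_def sum_divide_distrib abs_divide)
  ultimately show ?thesis using n by (simp add: field_simps)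
qed

text \<open>The vector \<open>a u - cross_m u v \<cdot> a v\<close> is in the image of the positive orthant, so all its coordinates
  are at least \<open>\<epsilon>\<close> times its \<open>norm1\<close>.\<close>

lemma act_cross_m:
  assumes a: "pos_mat a" "act_into \<epsilon> a" and u: "u \<in> sphere_eps \<epsilon>" and v: "v \<in> sphere_eps \<epsilon>"
  defines "t \<equiv> norm1 (a *v u) / norm1 (a *v v)"
  shows "(1 - \<epsilon>) * (cross_m u v / t) + \<epsilon> \<le> cross_m (act a u) (act a v)" "cross_m u v \<le> t"
proof -
  note us = sphere_epsD(1)[OF u] and vs = sphere_epsD(1)[OF v]
  note au = act_mem_sphere_eps[OF a us] and av = act_mem_sphere_eps[OF a vs]
  define m where "m = cross_m u v"
  define w where "w = u - m *\<^sub>R v"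
  have w: "0 \<le> w $ i" for i
    using cross_m_sphere(3)[OF u v, of i] by (simp add: w_def m_def)
  have aw: "a *v w = a *v u - m *\<^sub>R (a *v v)"
    by (simp add: w_def matrix_vector_mult_diff_distrib matrix_vector_mult_scaleR)
  have aw0: "0 \<le> (a *v w) $ i" for i
    unfolding matrix_vector_mult_def vec_lambda_beta using a(1) w
    by (intro sum_nonneg mult_nonneg_nonneg) (auto simp: pos_mat_def less_imp_le)
  have naw: "norm1 (a *v w) = norm1 (a *v u) - m * norm1 (a *v v)"
  proof -
    have "norm1 (a *v w) = (\<Sum>i\<in>UNIV. (a *v u) $ i - m * (a *v v) $ i)"
      using aw0 by (subst norm1_nonneg) (simp_all add: aw)
    also have "\<dots> = (\<Sum>i\<in>UNIV. (a *v u) $ i) - m * (\<Sum>i\<in>UNIV. (a *v v) $ i)"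
      by (simp add: sum_subtractf sum_distrib_left)
    also have "\<dots> = norm1 (a *v u) - m * norm1 (a *v v)"
      using au(2) av(2) by (simp add: norm1_nonneg less_imp_le)
    finally show ?thesis .
  qed
  have t: "0 < t" using au(3) av(3) by (simp add: t_def)
  have "0 \<le> norm1 (a *v w)" by (rule norm1_ge_0)
  then have mt: "m \<le> t" using av(3) naw by (simp add: t_def pos_le_divide_eq)
  then show "cross_m u v \<le> t" by (simp add: m_def)
  have m0: "0 \<le> m" using cross_m_sphere(1)[OF u v] eps by (simp add: m_def)
  have avle: "(a *v v) $ i \<le> norm1 (a *v v)" for i
    unfolding norm1_def using member_le_sum[of i UNIV "\<lambda>i. \<bar>(a *v v) $ i\<bar>"] by simp
  \<comment> \<open>\<open>(t - m) * norm1 (a *v v)\<close> is the \<open>norm1\<close> of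
    \<open>a *v w\<close>; the lower bound by \<open>\<epsilon>\<close> turns this mass into an
    extra multiple of \<open>a *v v\<close> below \<open>a *v u\<close>.\<close>
  have key: "(m + \<epsilon> * (t - m)) * (a *v v) $ i \<le> (a *v u) $ i" for i
  proof -
    have "\<epsilon> * (t - m) * (a *v v) $ i \<le> \<epsilon> * (t - m) * norm1 (a *v v)"
      using mt eps avle by (intro mult_left_mono) auto
    also have "\<dots> = \<epsilon> * norm1 (a *v w)"
      using av(3) by (simp add: naw t_def field_simps)
    also have "\<dots> \<le> (a *v w) $ i" by (rule nonneg_image_ge[OF a w])
    finally show ?thesis by (simp add: aw algebra_simps)
  qed
  have "(m + \<epsilon> * (t - m)) / t \<le> cross_m (act a u) (act a v)"
  proof (rule cross_m_bounds(3))
    show "0 \<le> act a u $ i" "0 < act a v $ i" for i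
      using au(2)[of i] av(2)[of i] au(3) av(3) by (auto simp: act_def)
    show "0 \<le> (m + \<epsilon> * (t - m)) / t" using mt m0 t eps by simp
    show "(m + \<epsilon> * (t - m)) / t * act a v $ i \<le> act a u $ i" for i
    proof -
      have "(m + \<epsilon> * (t - m)) / t * act a v $ i = (m + \<epsilon> * (t - m)) * (a *v v) $ i / norm1 (a *v u)"
        using au(3) av(3) by (simp add: act_def t_def)
      also have "\<dots> \<le> (a *v u) $ i / norm1 (a *v u)"
        using key[of i] au(3) by (intro divide_right_mono) auto
      finally show ?thesis by (simp add: act_def)
    qed
  qed
  moreover have "(m + \<epsilon> * (t - m)) / t = (1 - \<epsilon>) * (m / t) + \<epsilon>"
    using t by (simp add: field_simps)
  ultimately show "(1 - \<epsilon>) * (cross_m u v / t) + \<epsilon> \<le> cross_m (act a u) (act a v)"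
    by (simp add: m_def)
qed

text \<open>The normalising factor \<open>t\<close> cancels in \<open>p = x * y\<close>. Each
  cross-ratio is moved towards 1 by the affine map with value
  \<open>(1 - \<epsilon>) * x + \<epsilon>\<close>, and \<open>2 * x * y \<le> x + y\<close> for
  numbers between 0 and 1 gives \<open>1 - p' \<le> (1 - \<epsilon>\<^sup>2) * (1 - p)\<close>. Then
  \<open>p \<le> p'\<close> handles the denominators.\<close>

lemma hdist_act_le:
  assumes a: "pos_mat a" "act_into \<epsilon> a" and u: "u \<in> sphere_eps \<epsilon>" and v: "v \<in> sphere_eps \<epsilon>"
  shows "hdist (act a u) (act a v) \<le> (1 - \<epsilon>\<^sup>2) * hdist u v"
proof -
  note us = sphere_epsD(1)[OF u] and vs = sphere_epsD(1)[OF v]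
  note au = act_mem_sphere_eps[OF a us] and av = act_mem_sphere_eps[OF a vs]
  define t where "t = norm1 (a *v u) / norm1 (a *v v)"
  define x y where "x = cross_m u v / t" and "y = cross_m v u / (1 / t)"
  have t: "0 < t" using au(3) av(3) by (simp add: t_def)
  have t': "1 / t = norm1 (a *v v) / norm1 (a *v u)" by (simp add: t_def)
  note 1 = act_cross_m[OF a u v, folded t_def x_def]
  note 2 = act_cross_m[OF a v u, folded t', folded y_def]
  have xy: "0 \<le> x" "x \<le> 1" "0 \<le> y" "y \<le> 1"
    using 1(2) 2(2) cross_m_sphere(1)[OF u v] cross_m_sphere(1)[OF v u] eps t
    by (auto simp: x_def y_def divide_simps)
  define p where "p = cross_p u v"
  define p' where "p' = cross_p (act a u) (act a v)"
  have p: "p = x * y" using t by (simp add: p_def cross_p_def x_def y_def)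
  have "((1 - \<epsilon>) * x + \<epsilon>) * ((1 - \<epsilon>) * y + \<epsilon>) \<le> p'"
    unfolding p'_def cross_p_def using xy eps cross_m_sphere(1)[OF au(1) av(1)]
    by (intro mult_mono 1(1) 2(1)) (auto intro!: add_nonneg_nonneg)
  moreover have "((1 - \<epsilon>) * x + \<epsilon>) * ((1 - \<epsilon>) * y + \<epsilon>)
      = (1 - \<epsilon>)\<^sup>2 * p + \<epsilon>\<^sup>2 + \<epsilon> * (1 - \<epsilon>) * (x + y)"
    by (simp add: p power2_eq_square algebra_simps)
  moreover have "\<epsilon> * (1 - \<epsilon>) * (2 * p) \<le> \<epsilon> * (1 - \<epsilon>) * (x + y)"
  proof (intro mult_left_mono)
    show "2 * p \<le> x + y"
      using xy mult_left_le[of y x] mult_left_le_one_le[of y x] by (simp add: p)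
  qed (use eps in auto)
  ultimately have "(1 - \<epsilon>)\<^sup>2 * p + \<epsilon>\<^sup>2 + \<epsilon> * (1 - \<epsilon>) * (2 * p) \<le> p'" by linarith
  moreover have "(1 - \<epsilon>)\<^sup>2 * p + \<epsilon>\<^sup>2 + \<epsilon> * (1 - \<epsilon>) * (2 * p) = (1 - \<epsilon>\<^sup>2) * p + \<epsilon>\<^sup>2"
    by (simp add: power2_eq_square algebra_simps)
  ultimately have le: "1 - p' \<le> (1 - \<epsilon>\<^sup>2) * (1 - p)" by (simp add: algebra_simps)
  have e2: "0 \<le> 1 - \<epsilon>\<^sup>2" "1 - \<epsilon>\<^sup>2 \<le> 1" using eps by (auto simp: power_le_one)
  have p01: "0 < p" "p \<le> 1" using cross_p_sphere[OF u v] by (auto simp: p_def)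
  have "(1 - \<epsilon>\<^sup>2) * (1 - p) \<le> 1 - p" using e2 p01 by (intro mult_left_le_one_le) auto
  then have pp: "p \<le> p'" using le by linarith
  have "(1 - p') / (1 + p') \<le> ((1 - \<epsilon>\<^sup>2) * (1 - p)) / (1 + p)"
    using le pp p01 e2 by (intro frac_le) auto
  then show ?thesis by (simp add: hdist_cross_p p_def p'_def)
qed

end

section \<open>Hoelder functions for a power of the cross-ratio metric\<close>

definition hpow :: "real \<Rightarrow> real ^ 'd \<Rightarrow> real ^ 'd \<Rightarrow> real" where
  "hpow \<gamma> u v = hdist u v powr \<gamma>"

context
  fixes \<epsilon> \<gamma> :: real and X :: "(real ^ 'd) set"
  assumes eps: "0 < \<epsilon>" "\<epsilon> < 1" and gamma: "0 < \<gamma>" "\<gamma> \<le> 1"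
  defines "X \<equiv> sphere_eps \<epsilon>"
begin

text \<open>\<open>hdist u v \<le> hpow \<gamma> u v\<close> uses \<open>\<gamma> \<le> 1\<close>
  and \<open>hdist u v \<le> 1\<close>; it converts Lipschitz bounds in \<open>hdist\<close> into
  bounds in \<open>hpow \<gamma>\<close>.\<close>

lemma hpow_bounds:
  assumes "u \<in> X" "v \<in> X"
  shows "0 \<le> hpow \<gamma> u v" "hpow \<gamma> u v \<le> 1" "hdist u v \<le> hpow \<gamma> u v"
    "hpow \<gamma> u v \<le> (2 / \<epsilon> * norm (u - v)) powr \<gamma>" "u \<noteq> v \<Longrightarrow> 0 < hpow \<gamma> u v"
proof -
  note h = hdist_sphere[OF eps, of u v, folded X_def, OF assms]
  show "0 \<le> hpow \<gamma> u v" by (simp add: hpow_def)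
  show "hpow \<gamma> u v \<le> 1" using h gamma by (simp add: hpow_def powr_le1)
  show "hpow \<gamma> u v \<le> (2 / \<epsilon> * norm (u - v)) powr \<gamma>"
    using h gamma by (auto simp: hpow_def intro!: powr_mono2)
  show "0 < hpow \<gamma> u v" if "u \<noteq> v" using h(4)[OF that] by (simp add: hpow_def)
  show "hdist u v \<le> hpow \<gamma> u v"
  proof (cases "hdist u v = 0")
    case False
    then have "hdist u v powr 1 \<le> hdist u v powr \<gamma>" using h gamma by (intro powr_mono') auto
    then show ?thesis using False h by (simp add: hpow_def)
  qed (simp add: hpow_def)
qed

lemma holder_continuous:
  fixes \<phi> :: "real ^ 'd \<Rightarrow> 'b::real_normed_vector"
  assumes \<phi>: "holder X (hpow \<gamma>) C \<phi>" shows "continuous_on X \<phi>"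
proof -
  have "(\<phi> \<longlongrightarrow> \<phi> v) (at v within X)" if v: "v \<in> X" for v
  proof -
    have "((\<lambda>u. 2 / \<epsilon> * norm (u - v)) \<longlongrightarrow> 2 / \<epsilon> * norm (v - v)) (at v within X)"
      by (intro tendsto_intros)
    then have "((\<lambda>u. (2 / \<epsilon> * norm (u - v)) powr \<gamma>) \<longlongrightarrow> 0) (at v within X)"
      using gamma eps by (intro tendsto_powr'[where a = 0 and b = \<gamma>, simplified] tendsto_const) auto
    then have "((\<lambda>u. C * (2 / \<epsilon> * norm (u - v)) powr \<gamma>) \<longlongrightarrow> C * 0) (at v within X)"
      by (intro tendsto_intros)
    then have lim: "((\<lambda>u. C * (2 / \<epsilon> * norm (u - v)) powr \<gamma>) \<longlongrightarrow> 0) (at v within X)" by simp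
    have "((\<lambda>u. \<phi> u - \<phi> v) \<longlongrightarrow> 0) (at v within X)"
    proof (rule Lim_null_comparison[OF _ lim])
      show "\<forall>\<^sub>F u in at v within X. norm (\<phi> u - \<phi> v) \<le> C * (2 / \<epsilon> * norm (u - v)) powr \<gamma>"
        unfolding eventually_at_filter
      proof (intro always_eventually allI impI)
        fix u assume "u \<in> X"
        then have "norm (\<phi> u - \<phi> v) \<le> C * hpow \<gamma> u v" by (rule holderD(4)[OF \<phi> _ v])
        also have "\<dots> \<le> C * (2 / \<epsilon> * norm (u - v)) powr \<gamma>"
          using holderD(1)[OF \<phi>] by (intro mult_left_mono hpow_bounds \<open>u \<in> X\<close> v)
        finally show "norm (\<phi> u - \<phi> v) \<le> C * (2 / \<epsilon> * norm (u - v)) powr \<gamma>" .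
      qed
    qed
    then show ?thesis by (simp add: LIM_zero_iff)
  qed
  then show ?thesis by (simp add: continuous_on_def)
qed

text \<open>The constant of \<open>holder\<close> bounds the sup norm and the seminorm separately,
  hence the factor 2; in the other direction \<open>gnorm\<close> itself is an admissible
  constant.\<close>

lemma gnorm_le:
  assumes "holder X (hpow \<gamma>) C \<phi>" shows "gnorm X \<gamma> \<phi> \<le> ennreal (2 * C)"
proof -
  have "(SUP v\<in>X. ennreal (cmod (\<phi> v))) \<le> ennreal C"
    using holderD(3)[OF assms] by (intro SUP_least ennreal_leI) auto
  moreover have "cmod (\<phi> u - \<phi> v) / hdist u v powr \<gamma> \<le> C" if "u \<in> X" "v \<in> X" "u \<noteq> v" for u v
    using holderD(4)[OF assms that(1,2)] hpow_bounds(5)[OF that]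
    by (simp add: hpow_def pos_divide_le_eq)
  then have "(SUP (u, v)\<in>{(u, v). u \<in> X \<and> v \<in> X \<and> u \<noteq> v}.
        ennreal (cmod (\<phi> u - \<phi> v) / hdist u v powr \<gamma>)) \<le> ennreal C"
    by (intro SUP_least) (auto intro!: ennreal_leI)
  ultimately have "gnorm X \<gamma> \<phi> \<le> ennreal C + ennreal C"
    unfolding gnorm_def by (rule add_mono)
  also have "\<dots> = ennreal (2 * C)"
    using holderD(1)[OF assms] by (simp add: ennreal_plus[symmetric] del: ennreal_plus)
  finally show ?thesis .
qed

lemma Bspace_holder:
  assumes "\<phi> \<in> Bspace X \<gamma>"
  shows "holder X (hpow \<gamma>) (enn2real (gnorm X \<gamma> \<phi>)) \<phi>"
proof -
  have fin: "gnorm X \<gamma> \<phi> < top" and zero: "\<And>v. v \<notin> X \<Longrightarrow> \<phi> v = 0"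
    using assms by (auto simp: Bspace_def Cfun_def)
  have conv: "x \<le> enn2real (gnorm X \<gamma> \<phi>)" if "ennreal x \<le> gnorm X \<gamma> \<phi>" "0 \<le> x" for x
    using enn2real_mono[OF that(1) fin] that(2) by simp
  show ?thesis
  proof (rule holderI)
    fix v assume v: "v \<in> X"
    have "ennreal (cmod (\<phi> v)) \<le> (SUP v\<in>X. ennreal (cmod (\<phi> v)))" by (rule SUP_upper[OF v])
    also have "\<dots> \<le> gnorm X \<gamma> \<phi>" by (simp add: gnorm_def)
    finally show "cmod (\<phi> v) \<le> enn2real (gnorm X \<gamma> \<phi>)" by (rule conv) simp
  next
    fix u v assume uv: "u \<in> X" "v \<in> X"
    show "cmod (\<phi> u - \<phi> v) \<le> enn2real (gnorm X \<gamma> \<phi>) * hpow \<gamma> u v"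
    proof (cases "u = v")
      case True
      then show ?thesis using hpow_bounds(1)[OF uv] by simp
    next
      case False
      have "ennreal (cmod (\<phi> u - \<phi> v) / hdist u v powr \<gamma>)
        \<le> (SUP (u, v)\<in>{(u, v). u \<in> X \<and> v \<in> X \<and> u \<noteq> v}. ennreal (cmod (\<phi> u - \<phi> v) / hdist u v powr \<gamma>))"
        using uv False by (intro SUP_upper2[of "(u, v)"]) auto
      also have "\<dots> \<le> gnorm X \<gamma> \<phi>" by (simp add: gnorm_def)
      finally have "cmod (\<phi> u - \<phi> v) / hdist u v powr \<gamma> \<le> enn2real (gnorm X \<gamma> \<phi>)"
        by (rule conv) simp
      then show ?thesis using hpow_bounds(5)[OF uv False] by (simp add: hpow_def pos_divide_le_eq)
    qed
  qed (use zero in auto)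
qed

text \<open>Continuity follows from the Hoelder bound, because \<open>hdist\<close> is dominated by
  the Euclidean distance on \<open>X\<close>.\<close>

lemma Bspace_iff: "\<phi> \<in> Bspace X \<gamma> \<longleftrightarrow> is_holder X (hpow \<gamma>) \<phi>"
proof
  assume "is_holder X (hpow \<gamma>) \<phi>"
  then obtain C where C: "holder X (hpow \<gamma>) C \<phi>" by (auto simp: is_holder_def)
  have "gnorm X \<gamma> \<phi> < top" using gnorm_le[OF C] by (rule le_less_trans) simp
  then show "\<phi> \<in> Bspace X \<gamma>"
    using holder_continuous[OF C] holderD(2)[OF C] by (auto simp: Bspace_def Cfun_def)
qed (use Bspace_holder in \<open>auto simp: is_holder_def\<close>)

end

section \<open>The transfer operator and its eigenfunction\<close>

text \<open>By Lindelof's theorem countably many open null sets cover the complement of the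
  support.\<close>

lemma AE_msupport:
  fixes \<mu> :: "'a::second_countable_topology measure"
  assumes "sets \<mu> = sets borel"
  shows "AE x in \<mu>. x \<in> msupport \<mu>"
proof -
  define F where "F = {U. open U \<and> emeasure \<mu> U = 0}"
  obtain F' where F': "F' \<subseteq> F" "countable F'" "\<Union>F' = \<Union>F"
    using Lindelof[of F] by (auto simp: F_def)
  have "(\<Union>U\<in>F'. U) \<in> null_sets \<mu>"
    using F'(1) assms by (intro null_sets_UN' F'(2)) (auto simp: F_def null_sets_def)
  then have "\<Union>F \<in> null_sets \<mu>" using F'(3) by simp
  moreover have "x \<in> \<Union>F" if "x \<notin> msupport \<mu>" for x
    using that by (auto simp: msupport_def F_def zero_less_iff_neq_zero)
  ultimately show ?thesis by (intro AE_I'[of "\<Union>F"]) auto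
qed

section \<open>Measurability of the projective action\<close>

lemma continuous_on_mat_vec_mult [continuous_intros]:
  fixes A :: "'a::topological_space \<Rightarrow> real ^ 'n ^ 'm" and w :: "'a \<Rightarrow> real ^ 'n"
  assumes "continuous_on S A" "continuous_on S w"
  shows "continuous_on S (\<lambda>x. A x *v w x)"
  unfolding matrix_vector_mult_def by (intro continuous_intros assms)

lemma borel_measurable_mat_vec_mult [measurable (raw)]:
  fixes A :: "'a \<Rightarrow> real ^ 'n ^ 'm" and w :: "'a \<Rightarrow> real ^ 'n"
  assumes [measurable]: "A \<in> borel_measurable M" "w \<in> borel_measurable M"
  shows "(\<lambda>x. A x *v w x) \<in> borel_measurable M"
proof -
  have "continuous_on UNIV (\<lambda>p::(real^'n^'m) \<times> (real^'n). fst p *v snd p)"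
    by (intro continuous_intros)
  then have [measurable]: "(\<lambda>p::(real^'n^'m) \<times> (real^'n). fst p *v snd p) \<in> borel_measurable borel"
    by (rule borel_measurable_continuous_onI)
  have "(\<lambda>x. fst (A x, w x) *v snd (A x, w x)) \<in> borel_measurable M"
    by measurable
  then show ?thesis by simp
qed

lemma borel_measurable_norm1 [measurable (raw)]:
  assumes [measurable]: "w \<in> borel_measurable M"
  shows "(\<lambda>x. norm1 (w x)) \<in> borel_measurable M"
proof -
  have "continuous_on UNIV (\<lambda>v. norm1 v)" unfolding norm1_def by (intro continuous_intros)
  then have [measurable]: "norm1 \<in> borel_measurable borel" by (rule borel_measurable_continuous_onI)
  show ?thesis by measurable
qed

lemma borel_measurable_act [measurable (raw)]:
  assumes [measurable]: "A \<in> borel_measurable M" "w \<in> borel_measurable M"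
  shows "(\<lambda>x. act (A x) (w x)) \<in> borel_measurable M"
  unfolding act_def by measurable

lemma borel_measurable_mat_norm [measurable]: "mat_norm \<in> borel_measurable borel"
proof -
  have "continuous_on UNIV (\<lambda>g. mat_norm g)" unfolding mat_norm_def by (intro continuous_intros)
  then show ?thesis by (rule borel_measurable_continuous_onI)
qed

lemma borel_measurable_continuous_on_closed:
  fixes \<phi> :: "'a::topological_space \<Rightarrow> 'b::real_normed_vector"
  assumes "closed X" "continuous_on X \<phi>" "\<And>v. v \<notin> X \<Longrightarrow> \<phi> v = 0"
  shows "\<phi> \<in> borel_measurable borel"
proof -
  have "(\<lambda>x. indicator X x *\<^sub>R \<phi> x) \<in> borel_measurable borel"
    using assms by (intro borel_measurable_continuous_on_indicator) auto
  moreover have "(\<lambda>x. indicator X x *\<^sub>R \<phi> x) = \<phi>"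
    using assms(3) by (auto simp: indicator_def fun_eq_iff)
  ultimately show ?thesis by simp
qed

text \<open>The vector \<open>f\<close> is fixed. \<open>k\<close> is known as the common eigenvalue
  of the two eigenmeasures; its positivity is derived in \<open>k_pos\<close>.\<close>

locale transfer_operator =
  fixes \<mu> :: "(real ^ 'd ^ 'd) measure" and \<nu> \<nu>' :: "(real ^ 'd) measure"
    and f :: "real ^ 'd" and s \<epsilon> \<gamma> k :: real and X :: "(real ^ 'd) set"
  assumes prob_mu: "prob_space \<mu>" and sets_mu [measurable_cong]: "sets \<mu> = sets borel"
    and pos: "AE a in \<mu>. pos_mat a"
    and eps: "0 < \<epsilon>" "\<epsilon> < 1"
    and into: "AE a in \<mu>. act_into \<epsilon> a"
    and moment: "(\<integral>\<^sup>+ a. ennreal (mat_norm a powr s) \<partial>\<mu>) < \<infinity>"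
    and nu: "eigenmeasure (P_op \<mu> s sphere_pos) k \<nu>"
    and nu': "eigenmeasure (P_star_op \<mu> s sphere_pos) k \<nu>'"
    and gamma: "0 < \<gamma>" "\<gamma> \<le> 1"
    and f: "f \<in> sphere_pos"
    and X_def: "X = sphere_eps \<epsilon>"
begin

sublocale mu: prob_space \<mu> by (rule prob_mu)
sublocale nu: prob_space \<nu> using nu by (simp add: eigenmeasure_def)
sublocale nu': prob_space \<nu>' using nu' by (simp add: eigenmeasure_def)
sublocale mu_nu': pair_sigma_finite \<mu> \<nu>' ..

lemma sets_nu [measurable_cong]: "sets \<nu> = sets borel" using nu by (simp add: eigenmeasure_def)
lemma sets_nu' [measurable_cong]: "sets \<nu>' = sets borel" using nu' by (simp add: eigenmeasure_def)

abbreviation "H \<equiv> hpow \<gamma> :: real ^ 'd \<Rightarrow> real ^ 'd \<Rightarrow> real"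
abbreviation "r \<equiv> r_fun \<nu>' s"

definition good :: "real ^ 'd ^ 'd \<Rightarrow> bool" where "good a \<longleftrightarrow> pos_mat a \<and> act_into \<epsilon> a"

lemma AE_good: "AE a in \<mu>. good a"
  using pos into by eventually_elim (simp add: good_def)

lemma good_act:
  assumes "good a" "v \<in> sphere_pos"
  shows "act a v \<in> X" "0 < norm1 (a *v v)"
  using act_mem_sphere_eps[OF eps _ _ assms(2)] assms(1) by (auto simp: good_def X_def)

lemma X_sphere: "v \<in> X \<Longrightarrow> v \<in> sphere_pos"
  using sphere_epsD(1) by (auto simp: X_def)

lemma inner_X:
  assumes "F \<in> sphere_pos" "v \<in> X"
  shows "\<epsilon> \<le> F \<bullet> v" "F \<bullet> v \<le> 1" "0 < F \<bullet> v"
proof -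
  show "\<epsilon> \<le> F \<bullet> v" using sphere_epsD(3)[of v \<epsilon> F] assms by (simp add: X_def)
  then show "0 < F \<bullet> v" using eps by linarith
  show "F \<bullet> v \<le> 1" using inner_sphere_le[OF assms(1) X_sphere[OF assms(2)]] .
qed

lemma AE_nu'_sphere: "AE u in \<nu>'. u \<in> sphere_pos"
  using nu' nu'.AE_iff_emeasure_eq_1[of "\<lambda>u. u \<in> sphere_pos"] closed_sphere_pos
  by (auto simp: eigenmeasure_def sets_eq_imp_space_eq[OF sets_nu'] intro!: nu'.AE_prob_1
    simp: nu'.emeasure_eq_measure)

lemma inner_mult_act:
  assumes "good a" "v \<in> sphere_pos"
  shows "F \<bullet> (a *v v) = norm1 (a *v v) * (F \<bullet> act a v)"
  using good_act(2)[OF assms] by (simp add: act_def)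

lemma norm1_mult_bounds:
  assumes "good a" "v \<in> X"
  shows "norm1 (a *v v) \<le> mat_norm a" "\<epsilon> * mat_norm a \<le> norm1 (a *v v)" "0 < mat_norm a"
proof -
  note v = X_sphere[OF assms(2)]
  have a: "0 < a $ i $ j" for i j using assms(1) by (simp add: good_def pos_mat_def)
  have ve: "\<epsilon> \<le> v $ i" for i using assms(2) sphere_epsD(2) by (simp add: X_def)
  have eq: "norm1 (a *v v) = (\<Sum>i\<in>UNIV. \<Sum>j\<in>UNIV. a $ i $ j * v $ j)"
    using a sphere_posD(1)[OF v]
    by (subst norm1_nonneg) (auto simp: matrix_vector_mult_def intro!: sum_nonneg mult_nonneg_nonneg intro: less_imp_le)
  have "a $ i $ j * v $ j \<le> a $ i $ j" for i j
    using sphere_posD(3)[OF v] less_imp_le[OF a] by (intro mult_left_le) auto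
  then show 1: "norm1 (a *v v) \<le> mat_norm a"
    unfolding eq mat_norm_def by (intro sum_mono)
  have "\<epsilon> * a $ i $ j \<le> a $ i $ j * v $ j" for i j
    using ve[of j] mult_left_mono[OF ve less_imp_le[OF a]] by (simp add: mult.commute)
  then show "\<epsilon> * mat_norm a \<le> norm1 (a *v v)"
    unfolding eq mat_norm_def sum_distrib_left by (intro sum_mono)
  show "0 < mat_norm a" using 1 good_act(2)[OF assms(1) v] by linarith
qed

text \<open>One factor \<open>\<epsilon>\<close> comes from the coordinates of \<open>v\<close>, the
  other from \<open>act a v \<in> X\<close>. The bound by \<open>mat_norm a powr s\<close> is what
  makes the moment condition applicable to the weights.\<close>

lemma inner_mult_powr_le:
  assumes a: "good a" and v: "v \<in> X" and F: "F \<in> sphere_pos"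
  shows "(F \<bullet> (a *v v)) powr s \<le> (\<epsilon>\<^sup>2) powr (- \<bar>s\<bar>) * mat_norm a powr s" "0 < F \<bullet> (a *v v)"
proof -
  note b = norm1_mult_bounds[OF a v] and i = inner_X[OF F good_act(1)[OF a X_sphere[OF v]]]
  note n = good_act(2)[OF a X_sphere[OF v]]
  note eq = inner_mult_act[OF a X_sphere[OF v]]
  have e2: "\<epsilon>\<^sup>2 \<le> 1" using eps by (simp add: power_le_one)
  show p: "0 < F \<bullet> (a *v v)" unfolding eq using i n by simp
  have "F \<bullet> (a *v v) \<le> norm1 (a *v v)" unfolding eq using i n by (intro mult_left_le) auto
  then have up: "F \<bullet> (a *v v) \<le> mat_norm a" using b by linarith
  have "\<epsilon> * mat_norm a * \<epsilon> \<le> norm1 (a *v v) * (F \<bullet> act a v)"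
    using b i eps n by (intro mult_mono) auto
  then have lo: "\<epsilon>\<^sup>2 * mat_norm a \<le> F \<bullet> (a *v v)"
    by (simp add: eq power2_eq_square mult_ac)
  have "\<epsilon>\<^sup>2 * (F \<bullet> (a *v v)) \<le> F \<bullet> (a *v v)" using p e2 by (intro mult_left_le_one_le) auto
  then have "\<epsilon>\<^sup>2 * (F \<bullet> (a *v v)) \<le> mat_norm a" using up by linarith
  then show "(F \<bullet> (a *v v)) powr s \<le> (\<epsilon>\<^sup>2) powr (- \<bar>s\<bar>) * mat_norm a powr s"
    using lo up b p eps e2 by (intro powr_ratio_le) auto
qed

lemma integrable_mat_norm: "integrable \<mu> (\<lambda>a. mat_norm a powr s)"
  using moment by (intro integrableI_bounded) auto

definition W :: "real ^ 'd ^ 'd \<Rightarrow> real ^ 'd \<Rightarrow> real" where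
  "W a v = (f \<bullet> (a *v v)) powr s / (f \<bullet> v) powr s"

lemma W_nonneg: "0 \<le> W a v" by (simp add: W_def)

lemma measurable_W [measurable]: "(\<lambda>a. W a v) \<in> borel_measurable borel"
  unfolding W_def by measurable

lemma holder_measurable:
  fixes \<phi> :: "real ^ 'd \<Rightarrow> 'b::real_normed_vector"
  assumes "is_holder X H \<phi>" shows "\<phi> \<in> borel_measurable borel"
proof -
  obtain C where C: "holder X H C \<phi>" using assms by (auto simp: is_holder_def)
  show ?thesis
    using holder_continuous[OF eps gamma C[unfolded X_def]] holderD(2)[OF C] closed_sphere_eps[of \<epsilon>]
    by (intro borel_measurable_continuous_on_closed[of X]) (auto simp: X_def)
qed

lemma integrable_W:
  fixes \<phi> :: "real ^ 'd \<Rightarrow> 'b::{banach, second_countable_topology}"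
  assumes \<phi>: "is_holder X H \<phi>" and v: "v \<in> X"
  shows "integrable \<mu> (\<lambda>a. W a v *\<^sub>R \<phi> (act a v))"
proof -
  note [measurable] = holder_measurable[OF \<phi>]
  obtain C where C: "holder X H C \<phi>" using \<phi> by (auto simp: is_holder_def)
  define K where "K = (\<epsilon>\<^sup>2) powr (- \<bar>s\<bar>) / (f \<bullet> v) powr s * C"
  show ?thesis
  proof (rule Bochner_Integration.integrable_bound)
    show "integrable \<mu> (\<lambda>a. K * mat_norm a powr s)"
      by (intro integrable_mult_right integrable_mat_norm)
    show "AE a in \<mu>. norm (W a v *\<^sub>R \<phi> (act a v)) \<le> norm (K * mat_norm a powr s)"
      using AE_good
    proof eventually_elim
      case (elim a)
      have "norm (W a v *\<^sub>R \<phi> (act a v)) = W a v * norm (\<phi> (act a v))"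
        using W_nonneg by simp
      also have "\<dots> \<le> ((\<epsilon>\<^sup>2) powr (- \<bar>s\<bar>) * mat_norm a powr s / (f \<bullet> v) powr s) * C"
        unfolding W_def using inner_mult_powr_le(1)[OF elim v f]
          holderD(3)[OF C good_act(1)[OF elim X_sphere[OF v]]]
        by (intro mult_mono divide_right_mono) auto
      also have "\<dots> = K * mat_norm a powr s" by (simp add: K_def mult_ac)
      also have "\<dots> \<le> norm (K * mat_norm a powr s)" by simp
      finally show ?case .
    qed
  qed measurable
qed

text \<open>\<open>T\<close>, \<open>N\<close> and \<open>rr\<close> are the real-valued
  counterparts of \<open>Pf_op\<close>, \<open>nuf\<close> and \<open>rf_fun\<close>; the cone
  argument requires an order.\<close>

definition T :: "(real ^ 'd \<Rightarrow> real) \<Rightarrow> real ^ 'd \<Rightarrow> real" where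
  "T h v = (if v \<in> X then \<integral>a. W a v * h (act a v) \<partial>\<mu> else 0)"

definition N :: "(real ^ 'd \<Rightarrow> real) \<Rightarrow> real" where
  "N h = (\<integral>v. (f \<bullet> v) powr s * h v \<partial>\<nu>) / (\<integral>v. r v \<partial>\<nu>)"

definition rr :: "real ^ 'd \<Rightarrow> real" where
  "rr v = (if v \<in> X then r v / (f \<bullet> v) powr s else 0)"

lemma integrable_W_real:
  "is_holder X H h \<Longrightarrow> v \<in> X \<Longrightarrow> integrable \<mu> (\<lambda>a. W a v * h (act a v) :: real)"
  using integrable_W[of h v] by simp

lemma T_lin:
  assumes "is_holder X H h" "is_holder X H h'"
  shows "T (\<lambda>v. x * h v + y * h' v) = (\<lambda>v. x * T h v + y * T h' v)"
proof
  fix v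
  show "T (\<lambda>v. x * h v + y * h' v) v = x * T h v + y * T h' v"
  proof (cases "v \<in> X")
    case True
    have "(\<integral>a. W a v * (x * h (act a v) + y * h' (act a v)) \<partial>\<mu>)
        = (\<integral>a. x * (W a v * h (act a v)) + y * (W a v * h' (act a v)) \<partial>\<mu>)"
      by (simp add: algebra_simps)
    also have "\<dots> = x * (\<integral>a. W a v * h (act a v) \<partial>\<mu>) + y * (\<integral>a. W a v * h' (act a v) \<partial>\<mu>)"
      using integrable_W_real[OF assms(1) True] integrable_W_real[OF assms(2) True] by simp
    finally show ?thesis using True by (simp add: T_def)
  qed (simp add: T_def)
qed

text \<open>Prepares moving the matrix to the other side: \<open>f \<bullet> (a *v u)\<close> is
  \<open>(f v* a) \<bullet> u\<close>, to which the ratio estimate applies.\<close>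

lemma row_nonneg:
  assumes "good a"
  shows "0 \<le> (f v* a) $ i" "f v* a \<noteq> 0"
proof -
  have a: "0 < a $ i $ j" for i j using assms by (simp add: good_def pos_mat_def)
  note f0 = sphere_posD(1)[OF f]
  show "0 \<le> (f v* a) $ i"
    unfolding vector_matrix_mult_def vec_lambda_beta using f0 less_imp_le[OF a]
    by (intro sum_nonneg mult_nonneg_nonneg) auto
  \<comment> \<open>An arbitrary coordinate vector serves as test point.\<close>
  have "axis undefined 1 \<in> sphere_pos" by (rule axis_sphere_pos)
  then have "0 < norm1 (a *v axis undefined 1)" "act a (axis undefined 1) \<in> X"
    using good_act[OF assms] by auto
  then have "0 < f \<bullet> (a *v axis undefined 1)"
    using inner_mult_act[OF assms \<open>axis undefined 1 \<in> sphere_pos\<close>] inner_X(3)[OF f] by simp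
  then show "f v* a \<noteq> 0" using dot_lmul_matrix[of f a "axis undefined 1"] by auto
qed

lemma H_bounds:
  assumes "u \<in> X" "v \<in> X"
  shows "0 \<le> H u v" "H u v \<le> 1" "hdist u v \<le> H u v"
  using hpow_bounds[OF eps gamma] assms by (auto simp: X_def)

text \<open>Log-Lipschitz constant of one power of an inner product; the weight \<open>W\<close> is
  a quotient of two such powers and therefore has \<open>2 * c0\<close>.\<close>

abbreviation "c0 \<equiv> 2 * \<bar>s\<bar> / \<epsilon>\<^sup>2"

lemma powr_ratio_H:
  fixes F :: "real ^ 'd"
  assumes "u \<in> X" "v \<in> X" "\<And>i. 0 \<le> F $ i" "F \<noteq> 0"
  shows "(F \<bullet> u) powr s \<le> exp (c0 * H u v) * (F \<bullet> v) powr s"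
proof -
  have "(F \<bullet> u) powr s \<le> exp (c0 * hdist u v) * (F \<bullet> v) powr s"
    using assms by (intro inner_powr_ratio[OF eps]) (auto simp: X_def)
  also have "\<dots> \<le> exp (c0 * H u v) * (F \<bullet> v) powr s"
    using H_bounds(3)[OF assms(1,2)] by (intro mult_right_mono) (auto intro!: divide_right_mono mult_left_mono)
  finally show ?thesis .
qed

lemma W_ratio:
  assumes a: "good a" and u: "u \<in> X" and v: "v \<in> X"
  shows "W a u \<le> exp (2 * c0 * H u v) * W a v"
proof -
  have f': "0 \<le> f $ i" "f \<noteq> 0" for i
    using sphere_posD[OF f] by (auto simp: vec_eq_iff) (metis sum.neutral zero_neq_one)
  have 1: "(f \<bullet> (a *v u)) powr s \<le> exp (c0 * H u v) * (f \<bullet> (a *v v)) powr s"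
    unfolding dot_lmul_matrix[symmetric] by (rule powr_ratio_H[OF u v row_nonneg[OF a]])
  have 2: "(f \<bullet> v) powr s \<le> exp (c0 * H u v) * (f \<bullet> u) powr s"
    using powr_ratio_H[OF v u f'] by (simp add: hpow_def hdist_commute)
  have fpos: "0 < (f \<bullet> u) powr s" "0 < (f \<bullet> v) powr s" using inner_X(3)[OF f u] inner_X(3)[OF f v] by auto
  have "1 / (f \<bullet> u) powr s \<le> exp (c0 * H u v) / (f \<bullet> v) powr s"
    using 2 fpos by (simp add: field_simps)
  then have "(f \<bullet> (a *v u)) powr s * (1 / (f \<bullet> u) powr s)
      \<le> (exp (c0 * H u v) * (f \<bullet> (a *v v)) powr s) * (exp (c0 * H u v) / (f \<bullet> v) powr s)"
    using 1 by (intro mult_mono) auto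
  then show ?thesis
    by (simp add: W_def exp_add[symmetric] mult_ac)
qed

definition q :: real where "q = (1 - \<epsilon>\<^sup>2) powr \<gamma>"

lemma q: "0 \<le> q" "q < 1"
proof -
  have "0 < \<epsilon>\<^sup>2" "\<epsilon>\<^sup>2 < 1" using eps by (auto simp: power_less_one_iff)
  then show "0 \<le> q" "q < 1" using gamma powr_less_mono2[of \<gamma> "1 - \<epsilon>\<^sup>2" 1] by (auto simp: q_def)
qed

lemma H_act:
  assumes a: "good a" and u: "u \<in> X" and v: "v \<in> X"
  shows "H (act a u) (act a v) \<le> q * H u v"
proof -
  have e: "0 \<le> 1 - \<epsilon>\<^sup>2" using eps by (auto simp: power_le_one)
  have le: "hdist (act a u) (act a v) \<le> (1 - \<epsilon>\<^sup>2) * hdist u v"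
    using hdist_act_le[OF eps, of a u v] a u v by (auto simp: good_def X_def)
  have "0 \<le> hdist u v" "0 \<le> hdist (act a u) (act a v)"
    using hdist_sphere(1)[OF eps] u v good_act(1)[OF a] X_sphere by (auto simp: X_def)
  then have "hdist (act a u) (act a v) powr \<gamma> \<le> ((1 - \<epsilon>\<^sup>2) * hdist u v) powr \<gamma>"
    using le gamma by (intro powr_mono2) auto
  then show ?thesis using e \<open>0 \<le> hdist u v\<close> by (simp add: hpow_def q_def powr_mult)
qed

sublocale unit_gauge X H
  by unfold_locales (use H_bounds in \<open>auto simp: hpow_def hdist_commute\<close>)

text \<open>Pointwise in \<open>a\<close>, \<open>W_ratio\<close> contributes \<open>2 * c0\<close>,
  and the constant \<open>A\<close> of \<open>h\<close> is multiplied by \<open>q\<close> because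
  \<open>H_act\<close> brings the arguments closer. Integration preserves the inequality.\<close>

lemma T_cone:
  assumes A: "0 \<le> A" and h: "log_cone X H A h"
  shows "log_cone X H (2 * c0 + q * A) (T h)"
proof (rule coneI)
  note hol = cone_is_holder[OF A h]
  fix v assume v: "v \<in> X"
  have "0 \<le> (\<integral>a. W a v * h (act a v) \<partial>\<mu>)"
  proof (rule integral_nonneg_AE)
    show "AE a in \<mu>. 0 \<le> W a v * h (act a v)"
      using AE_good by eventually_elim
        (use W_nonneg coneD(2)[OF h] good_act(1) X_sphere[OF v] in auto)
  qed
  then show "0 \<le> T h v" using v by (simp add: T_def)
  fix u assume u: "u \<in> X"
  show "T h u \<le> exp ((2 * c0 + q * A) * H u v) * T h v"
  proof -
    have "(\<integral>a. W a u * h (act a u) \<partial>\<mu>)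
        \<le> (\<integral>a. exp ((2 * c0 + q * A) * H u v) * (W a v * h (act a v)) \<partial>\<mu>)"
    proof (rule integral_mono_AE)
      show "AE a in \<mu>. W a u * h (act a u) \<le> exp ((2 * c0 + q * A) * H u v) * (W a v * h (act a v))"
        using AE_good
      proof eventually_elim
        case (elim a)
        note au = good_act(1)[OF elim X_sphere[OF u]] and av = good_act(1)[OF elim X_sphere[OF v]]
        have "h (act a u) \<le> exp (A * H (act a u) (act a v)) * h (act a v)"
          by (rule coneD(3)[OF h au av])
        also have "\<dots> \<le> exp (A * (q * H u v)) * h (act a v)"
          using H_act[OF elim u v] A coneD(2)[OF h av]
          by (intro mult_right_mono) (auto intro: mult_left_mono)
        finally have "W a u * h (act a u)
            \<le> (exp (2 * c0 * H u v) * W a v) * (exp (A * (q * H u v)) * h (act a v))"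
          using W_ratio[OF elim u v] W_nonneg coneD(2)[OF h au]
          by (intro mult_mono) auto
        also have "\<dots> = exp (2 * c0 * H u v) * exp (A * (q * H u v)) * (W a v * h (act a v))"
          by (simp only: mult_ac)
        also have "exp (2 * c0 * H u v) * exp (A * (q * H u v)) = exp ((2 * c0 + q * A) * H u v)"
          unfolding exp_add[symmetric] by (rule arg_cong[of _ _ exp]) (simp add: algebra_simps)
        finally show ?case .
      qed
    qed (intro integrable_mult_right integrable_W_real hol u v)+
    then show ?thesis using u v by (simp add: T_def)
  qed
qed (simp add: T_def)

section \<open>The eigenfunction and the positivity of the eigenvalue\<close>

lemma r_bounds:
  assumes v: "v \<in> X"
  shows "integrable \<nu>' (\<lambda>u. (v \<bullet> u) powr s)" "\<epsilon> powr \<bar>s\<bar> \<le> r v" "r v \<le> \<epsilon> powr (- \<bar>s\<bar>)" "0 < r v"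
proof -
  have AE: "AE u in \<nu>'. \<epsilon> powr \<bar>s\<bar> \<le> (v \<bullet> u) powr s \<and> (v \<bullet> u) powr s \<le> \<epsilon> powr (- \<bar>s\<bar>)"
    using AE_nu'_sphere
  proof eventually_elim
    case (elim u)
    note i = inner_X[OF elim v, unfolded inner_commute[of u]]
    have "\<epsilon> * (v \<bullet> u) \<le> 1 * 1" using i eps by (intro mult_mono) auto
    then have "(v \<bullet> u) powr s \<le> \<epsilon> powr (- \<bar>s\<bar>) * 1 powr s"
      "1 powr s \<le> \<epsilon> powr (- \<bar>s\<bar>) * (v \<bullet> u) powr s"
      using i eps powr_ratio_le[of \<epsilon> "v \<bullet> u" 1 s] powr_ratio_le[of \<epsilon> 1 "v \<bullet> u" s]
      by auto
    then show ?case using eps by (simp add: powr_minus field_simps)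
  qed
  have "AE u in \<nu>'. norm ((v \<bullet> u) powr s) \<le> \<epsilon> powr (- \<bar>s\<bar>)"
    using AE by eventually_elim auto
  then show int: "integrable \<nu>' (\<lambda>u. (v \<bullet> u) powr s)"
    by (rule nu'.integrable_const_bound) measurable
  show 1: "\<epsilon> powr \<bar>s\<bar> \<le> r v" unfolding r_fun_def
    by (intro nu'.integral_ge_const int) (use AE in eventually_elim, auto)
  show "r v \<le> \<epsilon> powr (- \<bar>s\<bar>)" unfolding r_fun_def
    by (intro nu'.integral_le_const int) (use AE in eventually_elim, auto)
  have "0 < \<epsilon> powr \<bar>s\<bar>" using eps by simp
  then show "0 < r v" using 1 by linarith
qed

lemma r_ratio:
  assumes u: "u \<in> X" and v: "v \<in> X"
  shows "r u \<le> exp (c0 * H u v) * r v"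
proof -
  have "r u \<le> (\<integral>w. exp (c0 * H u v) * (v \<bullet> w) powr s \<partial>\<nu>')"
    unfolding r_fun_def
  proof (rule integral_mono_AE)
    show "AE w in \<nu>'. (u \<bullet> w) powr s \<le> exp (c0 * H u v) * (v \<bullet> w) powr s"
      using AE_nu'_sphere
    proof eventually_elim
      case (elim w)
      have "0 \<le> w $ i" "w \<noteq> 0" for i
        using sphere_posD[OF elim] by (auto simp: vec_eq_iff) (metis sum.neutral zero_neq_one)
      then show ?case using powr_ratio_H[OF u v, of w] by (simp add: inner_commute)
    qed
  qed (intro integrable_mult_right r_bounds u v)+
  then show ?thesis by (simp add: r_fun_def)
qed

text \<open>One \<open>c0\<close> for \<open>r\<close>, obtained by integrating
  \<open>powr_ratio_H\<close>, and one for the division by the power of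
  \<open>f \<bullet> v\<close>.\<close>

lemma rr_cone: "log_cone X H (2 * c0) rr"
proof (rule coneI)
  fix u v assume u: "u \<in> X" and v: "v \<in> X"
  have f': "0 \<le> f $ i" "f \<noteq> 0" for i
    using sphere_posD[OF f] by (auto simp: vec_eq_iff) (metis sum.neutral zero_neq_one)
  have 2: "(f \<bullet> v) powr s \<le> exp (c0 * H u v) * (f \<bullet> u) powr s"
    using powr_ratio_H[OF v u f'] by (simp add: hpow_def hdist_commute)
  have fpos: "0 < (f \<bullet> u) powr s" "0 < (f \<bullet> v) powr s" using inner_X(3)[OF f u] inner_X(3)[OF f v] by auto
  have "1 / (f \<bullet> u) powr s \<le> exp (c0 * H u v) / (f \<bullet> v) powr s"
    using 2 fpos by (simp add: field_simps)
  then have "r u * (1 / (f \<bullet> u) powr s)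
      \<le> (exp (c0 * H u v) * r v) * (exp (c0 * H u v) / (f \<bullet> v) powr s)"
    using r_ratio[OF u v] r_bounds(4)[OF u] r_bounds(4)[OF v] by (intro mult_mono) auto
  then show "rr u \<le> exp (2 * c0 * H u v) * rr v"
    using u v by (simp add: rr_def mult_exp_exp mult_ac)
qed (use r_bounds(4) in \<open>auto simp: rr_def less_imp_le\<close>)

lemma c0_nonneg: "0 \<le> 2 * c0" by simp

lemma rr_holder: "is_holder X H rr"
  by (rule cone_is_holder[OF c0_nonneg rr_cone])

lemma measurable_r [measurable]: "r \<in> borel_measurable borel"
  unfolding r_fun_def[abs_def] by measurable

text \<open>\<open>r\<close> is defined on all vectors and is homogeneous of degree
  \<open>s\<close>, so \<open>r (a *v v)\<close> absorbs the factor
  \<open>norm1 (a *v v) powr s\<close> of the transfer operator.\<close>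

lemma r_mult:
  assumes "good a" "v \<in> X"
  shows "r (a *v v) = norm1 (a *v v) powr s * r (act a v)"
proof -
  have "((a *v v) \<bullet> u) powr s = norm1 (a *v v) powr s * (act a v \<bullet> u) powr s" for u
    using inner_mult_act[OF assms(1) X_sphere[OF assms(2)], of u]
    by (simp add: inner_commute powr_mult)
  then show ?thesis by (simp add: r_fun_def)
qed

lemma W_mult:
  assumes "good a" "v \<in> X"
  shows "(f \<bullet> v) powr s * W a v = norm1 (a *v v) powr s * (f \<bullet> act a v) powr s"
  using inner_mult_act[OF assms(1) X_sphere[OF assms(2)], of f] inner_X(3)[OF f assms(2)]
  by (simp add: W_def powr_mult)

text \<open>Multiplication by the power of \<open>f \<bullet> v\<close> conjugates the kernel
  \<open>W\<close> to that of \<open>P_op\<close>; all occurrences of \<open>f\<close>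
  cancel.\<close>

lemma W_rr:
  assumes "good a" "v \<in> X"
  shows "(f \<bullet> v) powr s * (W a v * rr (act a v)) = r (a *v v)"
proof -
  note av = good_act(1)[OF assms(1) X_sphere[OF assms(2)]]
  have "(f \<bullet> v) powr s * (W a v * rr (act a v)) = ((f \<bullet> v) powr s * W a v) * rr (act a v)"
    by simp
  also have "\<dots> = r (a *v v)"
    unfolding W_mult[OF assms] r_mult[OF assms] using av inner_X(3)[OF f av] by (simp add: rr_def)
  finally show ?thesis .
qed

lemma sets_X [measurable]: "X \<in> sets borel" "sphere_pos \<in> sets borel"
  using closed_sphere_eps[of \<epsilon>] closed_sphere_pos by (auto simp: X_def intro: borel_closed)

lemma integrable_r_mult:
  assumes v: "v \<in> X"
  shows "integrable \<mu> (\<lambda>a. r (a *v v))"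
proof -
  have "integrable \<mu> (\<lambda>a. (f \<bullet> v) powr s * (W a v * rr (act a v)))"
    by (intro integrable_mult_right integrable_W_real rr_holder v)
  also have "?this \<longleftrightarrow> ?thesis"
  proof (rule integrable_cong_AE)
    note [measurable] = holder_measurable[OF rr_holder]
    show "(\<lambda>a. (f \<bullet> v) powr s * (W a v * rr (act a v))) \<in> borel_measurable \<mu>" by measurable
    show "(\<lambda>a. r (a *v v)) \<in> borel_measurable \<mu>" by measurable
    show "AE a in \<mu>. (f \<bullet> v) powr s * (W a v * rr (act a v)) = r (a *v v)"
      using AE_good by eventually_elim (rule W_rr[OF _ v])
  qed
  finally show ?thesis .
qed

text \<open>Fubini, together with \<open>\<langle>a v, u\<rangle> = \<langle>v, a\<^sup>T u\<rangle>\<close>.\<close>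

lemma integral_r_mult:
  assumes v: "v \<in> X"
  shows "(\<integral>a. r (a *v v) \<partial>\<mu>) = k * r v"
proof -
  define F where "F a u = ((a *v v) \<bullet> u) powr s" for a :: "real ^ 'd ^ 'd" and u
  have [measurable]: "case_prod F \<in> borel_measurable (\<mu> \<Otimes>\<^sub>M \<nu>')"
    unfolding F_def by measurable
  \<comment> \<open>The kernel is non-negative, so its inner integral is \<open>r (a *v v)\<close>,
    which \<open>integrable_r_mult\<close> covers.\<close>
  have intF: "integrable (\<mu> \<Otimes>\<^sub>M \<nu>') (case_prod F)"
  proof (rule mu_nu'.Fubini_integrable)
    show "integrable \<mu> (\<lambda>a. \<integral>u. norm (case_prod F (a, u)) \<partial>\<nu>')"
      using integrable_r_mult[OF v] by (simp add: F_def r_fun_def)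
    show "AE a in \<mu>. integrable \<nu>' (\<lambda>u. case_prod F (a, u))"
      using AE_good
    proof eventually_elim
      case (elim a)
      have "F a u = norm1 (a *v v) powr s * (act a v \<bullet> u) powr s" for u
        using inner_mult_act[OF elim X_sphere[OF v], of u]
        by (simp add: F_def inner_commute powr_mult)
      then show ?case
        using r_bounds(1)[OF good_act(1)[OF elim X_sphere[OF v]]] by simp
    qed
  qed measurable
  \<comment> \<open>Test function for the eigenmeasure equation of \<open>\<nu>'\<close>. As
    \<open>v \<in> X\<close>, the inner product stays positive on \<open>sphere_pos\<close>, so the
    power is continuous also for negative \<open>s\<close>.\<close>
  define \<phi> where "\<phi> u = (if u \<in> sphere_pos then complex_of_real ((v \<bullet> u) powr s) else 0)" for u
  have "continuous_on sphere_pos (\<lambda>u. complex_of_real ((v \<bullet> u) powr s))"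
    using less_imp_neq[OF inner_X(3)[OF _ v]]
    by (intro continuous_intros) (force simp: inner_commute[of v])+
  then have "continuous_on sphere_pos \<phi>"
    by (rule continuous_on_eq) (simp add: \<phi>_def)
  then have \<phi>: "\<phi> \<in> Cfun sphere_pos" by (simp add: Cfun_def \<phi>_def)
  have P: "P_star_op \<mu> s sphere_pos \<phi> =
      (\<lambda>u. if u \<in> sphere_pos then complex_of_real (\<integral>a. F a u \<partial>\<mu>) else 0)"
  proof
    fix u :: "real ^ 'd"
    show "P_star_op \<mu> s sphere_pos \<phi> u = (if u \<in> sphere_pos then complex_of_real (\<integral>a. F a u \<partial>\<mu>) else 0)"
    proof (cases "u \<in> sphere_pos")
      case True
      have "(\<integral>a. complex_of_real (norm1 (transpose a *v u) powr s) * \<phi> (act (transpose a) u) \<partial>\<mu>)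
          = (\<integral>a. complex_of_real (F a u) \<partial>\<mu>)"
      proof (rule integral_cong_AE)
        have [measurable]: "\<phi> \<in> borel_measurable borel" unfolding \<phi>_def by measurable
        have "continuous_on UNIV (\<lambda>a. transpose a :: real ^ 'd ^ 'd)"
          unfolding transpose_def by (intro continuous_intros)
        then have [measurable]: "(\<lambda>a. transpose a :: real ^ 'd ^ 'd) \<in> borel_measurable borel"
          by (rule borel_measurable_continuous_onI)
        show "(\<lambda>a. complex_of_real (norm1 (transpose a *v u) powr s) * \<phi> (act (transpose a) u))
            \<in> borel_measurable \<mu>" by measurable
        show "(\<lambda>a. complex_of_real (F a u)) \<in> borel_measurable \<mu>"
          unfolding F_def by measurable
        show "AE a in \<mu>. complex_of_real (norm1 (transpose a *v u) powr s) * \<phi> (act (transpose a) u)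
            = complex_of_real (F a u)"
          using AE_good
        proof eventually_elim
          case (elim a)
          have a: "0 < a $ i $ j" for i j using elim by (simp add: good_def pos_mat_def)
          note u0 = sphere_posD(1)[OF True]
          have nn: "0 \<le> (transpose a *v u) $ i" for i
            unfolding matrix_vector_mult_def vec_lambda_beta transpose_def
            using u0 less_imp_le[OF a] by (intro sum_nonneg mult_nonneg_nonneg) auto
          have inner: "(a *v v) \<bullet> u = v \<bullet> (transpose a *v u)"
            using dot_lmul_matrix[of u a v] by (simp add: inner_commute transpose_matrix_vector)
          \<comment> \<open>Gives \<open>transpose a *v u \<noteq> 0\<close>, so
            \<open>act (transpose a) u\<close> is a genuine point of
            \<open>sphere_pos\<close>.\<close>
          have "0 < (a *v v) \<bullet> u"
            using inner_mult_powr_le(2)[OF elim v True] by (simp add: inner_commute)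
          then have ne: "transpose a *v u \<noteq> 0" using inner by auto
          then have n0: "0 < norm1 (transpose a *v u)"
            unfolding norm1_def by (auto simp: vec_eq_iff intro!: sum_pos2)
          have "(\<Sum>i\<in>UNIV. (transpose a *v u) $ i / norm1 (transpose a *v u)) = 1"
            unfolding sum_divide_distrib[symmetric] using n0 nn by (simp add: norm1_nonneg)
          then have act: "act (transpose a) u \<in> sphere_pos"
            using nn n0 by (simp add: sphere_pos_def act_def norm1_def[of "_ *\<^sub>R _"])
          have "norm1 (transpose a *v u) powr s * (v \<bullet> act (transpose a) u) powr s = F a u"
            using n0 by (simp add: F_def inner act_def powr_mult[symmetric])
          then show ?case using act by (simp add: \<phi>_def flip: of_real_mult)
        qed
      qed
      then show ?thesis using True by (simp add: P_star_op_def ext0_def)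
    qed (simp add: P_star_op_def ext0_def)
  qed
  have "complex_of_real (\<integral>a. r (a *v v) \<partial>\<mu>) = complex_of_real (\<integral>a. \<integral>u. F a u \<partial>\<nu>' \<partial>\<mu>)"
    by (simp add: F_def r_fun_def)
  also have "(\<integral>a. \<integral>u. F a u \<partial>\<nu>' \<partial>\<mu>) = (\<integral>u. \<integral>a. F a u \<partial>\<mu> \<partial>\<nu>')"
    using mu_nu'.Fubini_integral[OF intF] by simp
  also have "complex_of_real \<dots> = (\<integral>u. complex_of_real (\<integral>a. F a u \<partial>\<mu>) \<partial>\<nu>')" by simp
  also have "\<dots> = (\<integral>u. P_star_op \<mu> s sphere_pos \<phi> u \<partial>\<nu>')"
    unfolding P
  proof (rule integral_cong_AE)
    show "(\<lambda>u. complex_of_real (\<integral>a. F a u \<partial>\<mu>)) \<in> borel_measurable \<nu>'"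
      unfolding F_def by measurable
    show "(\<lambda>u. if u \<in> sphere_pos then complex_of_real (\<integral>a. F a u \<partial>\<mu>) else 0) \<in> borel_measurable \<nu>'"
      unfolding F_def by measurable
    show "AE u in \<nu>'. complex_of_real (\<integral>a. F a u \<partial>\<mu>) =
        (if u \<in> sphere_pos then complex_of_real (\<integral>a. F a u \<partial>\<mu>) else 0)"
      using AE_nu'_sphere by eventually_elim simp
  qed
  also have "\<dots> = complex_of_real k * (\<integral>u. \<phi> u \<partial>\<nu>')"
    using nu' \<phi> by (simp add: eigenmeasure_def)
  also have "(\<integral>u. \<phi> u \<partial>\<nu>') = (\<integral>u. complex_of_real ((v \<bullet> u) powr s) \<partial>\<nu>')"
  proof (rule integral_cong_AE)
    show "\<phi> \<in> borel_measurable \<nu>'" unfolding \<phi>_def by measurable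
    show "(\<lambda>u. complex_of_real ((v \<bullet> u) powr s)) \<in> borel_measurable \<nu>'" by measurable
    show "AE u in \<nu>'. \<phi> u = complex_of_real ((v \<bullet> u) powr s)"
      using AE_nu'_sphere by eventually_elim (simp add: \<phi>_def)
  qed
  also have "complex_of_real k * \<dots> = complex_of_real (k * r v)" by (simp add: r_fun_def)
  finally show ?thesis by (simp only: of_real_eq_iff)
qed

lemma T_rr: "T rr = (\<lambda>v. k * rr v)"
proof
  fix v
  show "T rr v = k * rr v"
  proof (cases "v \<in> X")
    case True
    note [measurable] = holder_measurable[OF rr_holder]
    have "(f \<bullet> v) powr s * T rr v = (\<integral>a. (f \<bullet> v) powr s * (W a v * rr (act a v)) \<partial>\<mu>)"
      using True by (simp add: T_def)
    also have "\<dots> = (\<integral>a. r (a *v v) \<partial>\<mu>)"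
      by (rule integral_cong_AE, measurable, use AE_good in eventually_elim, rule W_rr[OF _ True])
    also have "\<dots> = k * r v" by (rule integral_r_mult[OF True])
    finally show ?thesis using True inner_X(3)[OF f True] by (simp add: rr_def field_simps)
  qed (simp add: T_def rr_def)
qed

text \<open>Almost every \<open>a\<close> sends a coordinate vector into \<open>X\<close>, and under
  a probability measure at least one such \<open>a\<close> exists.\<close>

lemma X_ne: "X \<noteq> {}"
proof
  assume "X = {}"
  then have "\<not> good a" for a
    using good_act(1)[of a "axis undefined 1"] axis_sphere_pos by auto
  then show False using mu.AE_contr[of good] AE_good by auto
qed

text \<open>\<open>k * r v\<close> is the integral of an almost everywhere positive function, and
  \<open>r v\<close> is positive.\<close>

lemma k_pos: "0 < k"
proof -
  obtain v where v: "v \<in> X" using X_ne by auto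
  have nn: "AE a in \<mu>. 0 < r (a *v v)"
    using AE_good
  proof eventually_elim
    case (elim a)
    then show ?case
      using r_mult[OF elim v] good_act[OF elim X_sphere[OF v]] r_bounds(4) by simp
  qed
  have nn': "AE a in \<mu>. 0 \<le> r (a *v v)" using nn by eventually_elim simp
  have "0 \<le> (\<integral>a. r (a *v v) \<partial>\<mu>)" by (rule integral_nonneg_AE[OF nn'])
  moreover have "(\<integral>a. r (a *v v) \<partial>\<mu>) \<noteq> 0"
  proof
    assume "(\<integral>a. r (a *v v) \<partial>\<mu>) = 0"
    then have "AE a in \<mu>. r (a *v v) = 0"
      using integral_nonneg_eq_0_iff_AE[OF integrable_r_mult[OF v] nn'] by simp
    then have "AE a in \<mu>. \<not> 0 < r (a *v v)" by eventually_elim simp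
    then show False using mu.AE_contr[OF nn] by simp
  qed
  ultimately have "0 < k * r v" using integral_r_mult[OF v] by linarith
  then show ?thesis using r_bounds(4)[OF v] by (simp add: zero_less_mult_iff)
qed

section \<open>Concentration of \<open>\<nu>\<close> on \<open>X\<close> and the functional
  \<open>N\<close>\<close>

lemma AE_nu_sphere: "AE u in \<nu>. u \<in> sphere_pos"
  using nu by (intro nu.AE_prob_1) (simp add: eigenmeasure_def nu.emeasure_eq_measure)

text \<open>The test function is the distance to \<open>X\<close>, which \<open>P_op\<close> sends to \<open>0\<close>.\<close>

lemma AE_nu_X: "AE v in \<nu>. v \<in> X"
proof -
  obtain x where x: "x \<in> X" using X_ne by auto
  have closed: "closed X" using closed_sphere_eps by (simp add: X_def)
  define h where "h v = (if v \<in> sphere_pos then infdist v X else 0)" for v :: "real ^ 'd"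
  have [measurable]: "h \<in> borel_measurable borel"
  proof -
    have "(\<lambda>v. infdist v X) \<in> borel_measurable borel"
      by (intro borel_measurable_continuous_onI continuous_intros)
    then show ?thesis unfolding h_def by measurable
  qed
  have "continuous_on sphere_pos (\<lambda>v. complex_of_real (infdist v X))" by (intro continuous_intros)
  then have "continuous_on sphere_pos (\<lambda>v. complex_of_real (h v))"
    by (rule continuous_on_eq) (simp add: h_def)
  then have \<phi>: "(\<lambda>v. complex_of_real (h v)) \<in> Cfun sphere_pos" by (simp add: Cfun_def h_def)
  have "P_op \<mu> s sphere_pos (\<lambda>v. complex_of_real (h v)) v = 0" for v
  proof (cases "v \<in> sphere_pos")
    case True
    have "(\<integral>a. complex_of_real (norm1 (a *v v) powr s) * complex_of_real (h (act a v)) \<partial>\<mu>) = 0"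
    proof (rule integral_eq_zero_AE)
      show "AE a in \<mu>. complex_of_real (norm1 (a *v v) powr s) * complex_of_real (h (act a v)) = 0"
        using AE_good
        by eventually_elim (use good_act(1)[OF _ True] in \<open>auto simp: h_def\<close>)
    qed
    then show ?thesis by (simp add: P_op_def ext0_def)
  qed (simp add: P_op_def ext0_def)
  then have "complex_of_real k * (\<integral>v. complex_of_real (h v) \<partial>\<nu>) = 0"
    using nu \<phi> by (auto simp: eigenmeasure_def dest!: bspec)
  then have int0: "(\<integral>v. h v \<partial>\<nu>) = 0" using k_pos by simp
  have h0: "0 \<le> h v" for v by (simp add: h_def infdist_nonneg)
  have "integrable \<nu> h"
  proof (rule nu.integrable_const_bound)
    show "AE v in \<nu>. norm (h v) \<le> 1 + norm x"
    proof (intro AE_I2)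
      fix v :: "real ^ 'd"
      show "norm (h v) \<le> 1 + norm x"
      proof (cases "v \<in> sphere_pos")
        case True
        have "infdist v X \<le> dist v x" by (rule infdist_le[OF x])
        also have "\<dots> \<le> norm v + norm x" by (simp add: dist_norm norm_triangle_ineq4)
        also have "norm v \<le> 1"
          using norm_le_l1_cart[of v] True by (simp only: sphere_pos_def norm1_def mem_Collect_eq)
        finally show ?thesis using True by (simp add: h_def infdist_nonneg)
      qed (simp add: h_def)
    qed
  qed measurable
  then have "AE v in \<nu>. h v = 0"
    using integral_nonneg_eq_0_iff_AE[of \<nu> h] int0 h0 by simp
  then show ?thesis
    using AE_nu_sphere
    by eventually_elim (use in_closed_iff_infdist_zero[OF closed X_ne] in \<open>auto simp: h_def\<close>)
qed

lemma integral_r_pos: "0 < (\<integral>v. r v \<partial>\<nu>)"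
proof -
  have "integrable \<nu> r"
  proof (rule nu.integrable_const_bound)
    show "AE v in \<nu>. norm (r v) \<le> \<epsilon> powr (- \<bar>s\<bar>)"
      using AE_nu_X by eventually_elim (use r_bounds(3,4) in \<open>auto simp: less_imp_le\<close>)
  qed measurable
  then have "\<epsilon> powr \<bar>s\<bar> \<le> (\<integral>v. r v \<partial>\<nu>)"
    using AE_nu_X r_bounds(2) by (intro nu.integral_ge_const) auto
  moreover have "0 < \<epsilon> powr \<bar>s\<bar>" using eps by simp
  ultimately show ?thesis by linarith
qed

lemma integrable_weight:
  fixes \<phi> :: "real ^ 'd \<Rightarrow> 'b::{banach, second_countable_topology}"
  assumes \<phi>: "is_holder X H \<phi>"
  shows "integrable \<nu> (\<lambda>v. (f \<bullet> v) powr s *\<^sub>R \<phi> v)"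
proof -
  note [measurable] = holder_measurable[OF \<phi>]
  obtain C where C: "holder X H C \<phi>" using \<phi> by (auto simp: is_holder_def)
  show ?thesis
  proof (rule nu.integrable_const_bound)
    show "AE v in \<nu>. norm ((f \<bullet> v) powr s *\<^sub>R \<phi> v) \<le> \<epsilon> powr (- \<bar>s\<bar>) * C"
      using AE_nu_X
    proof eventually_elim
      case (elim v)
      note i = inner_X[OF f elim]
      have "\<epsilon> * (f \<bullet> v) \<le> 1 * 1" using i eps by (intro mult_mono) auto
      then have "(f \<bullet> v) powr s \<le> \<epsilon> powr (- \<bar>s\<bar>)"
        using i eps powr_ratio_le[of \<epsilon> "f \<bullet> v" 1 s] by auto
      then show ?case using holderD(3)[OF C elim] by (auto intro!: mult_mono)
    qed
  qed measurable
qed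

lemma N_lin:
  assumes "is_holder X H h" "is_holder X H h'"
  shows "N (\<lambda>v. x * h v + y * h' v) = x * N h + y * N h'"
proof -
  have i: "integrable \<nu> (\<lambda>v. (f \<bullet> v) powr s * h v)" "integrable \<nu> (\<lambda>v. (f \<bullet> v) powr s * h' v)"
    using integrable_weight[OF assms(1)] integrable_weight[OF assms(2)] by auto
  have "(\<integral>v. (f \<bullet> v) powr s * (x * h v + y * h' v) \<partial>\<nu>)
      = (\<integral>v. x * ((f \<bullet> v) powr s * h v) + y * ((f \<bullet> v) powr s * h' v) \<partial>\<nu>)"
    by (simp add: algebra_simps)
  also have "\<dots> = x * (\<integral>v. (f \<bullet> v) powr s * h v \<partial>\<nu>) + y * (\<integral>v. (f \<bullet> v) powr s * h' v \<partial>\<nu>)"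
    using i by simp
  finally show ?thesis by (simp add: N_def add_divide_distrib)
qed

lemma N_mono:
  assumes "is_holder X H h" "is_holder X H h'" "\<And>v. v \<in> X \<Longrightarrow> h v \<le> h' v"
  shows "N h \<le> N h'"
proof -
  have i: "integrable \<nu> (\<lambda>v. (f \<bullet> v) powr s * h v)" "integrable \<nu> (\<lambda>v. (f \<bullet> v) powr s * h' v)"
    using integrable_weight[OF assms(1)] integrable_weight[OF assms(2)] by auto
  have "(\<integral>v. (f \<bullet> v) powr s * h v \<partial>\<nu>) \<le> (\<integral>v. (f \<bullet> v) powr s * h' v \<partial>\<nu>)"
  proof (rule integral_mono_AE[OF i])
    show "AE v in \<nu>. (f \<bullet> v) powr s * h v \<le> (f \<bullet> v) powr s * h' v"
      using AE_nu_X by eventually_elim (use assms(3) in \<open>auto intro: mult_left_mono\<close>)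
  qed
  then show ?thesis using integral_r_pos by (simp add: N_def divide_right_mono)
qed

lemma N_rr: "N rr = 1"
proof -
  note [measurable] = holder_measurable[OF rr_holder]
  have "(\<integral>v. (f \<bullet> v) powr s * rr v \<partial>\<nu>) = (\<integral>v. r v \<partial>\<nu>)"
  proof (rule integral_cong_AE)
    show "AE v in \<nu>. (f \<bullet> v) powr s * rr v = r v"
      using AE_nu_X
    proof eventually_elim
      case (elim v)
      then show ?case using inner_X(3)[OF f elim] by (simp add: rr_def)
    qed
  qed measurable
  then show ?thesis using integral_r_pos by (simp add: N_def)
qed

text \<open>The eigenmeasure equation is only available for continuous functions on the whole of
  \<open>sphere_pos\<close>, hence the Tietze extension.\<close>

lemma N_T:
  assumes h: "is_holder X H h" shows "N (T h) = k * N h"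
proof -
  note [measurable] = holder_measurable[OF h]
  have closed: "closed X" using closed_sphere_eps by (simp add: X_def)
  obtain C where C: "holder X H C h" using h by (auto simp: is_holder_def)
  have "continuous_on X (\<lambda>v. complex_of_real ((f \<bullet> v) powr s * h v))"
    using holder_continuous[OF eps gamma C[unfolded X_def]] less_imp_neq[OF inner_X(3)[OF f]]
    by (intro continuous_intros) (force simp: X_def)+
  then obtain g where g: "continuous_on UNIV g" "\<And>v. v \<in> X \<Longrightarrow> g v = complex_of_real ((f \<bullet> v) powr s * h v)"
    using Tietze_unbounded[of X "\<lambda>v. complex_of_real ((f \<bullet> v) powr s * h v)" UNIV] closed by auto
  have [measurable]: "g \<in> borel_measurable borel" using g(1) by (rule borel_measurable_continuous_onI)
  define \<phi> where "\<phi> = ext0 sphere_pos g"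
  have [measurable]: "\<phi> \<in> borel_measurable borel" unfolding \<phi>_def ext0_def by measurable
  have "continuous_on sphere_pos g" using g(1) by (rule continuous_on_subset) simp
  then have "continuous_on sphere_pos \<phi>" by (rule continuous_on_eq) (simp add: \<phi>_def ext0_def)
  then have "\<phi> \<in> Cfun sphere_pos" by (simp add: Cfun_def \<phi>_def ext0_def)
  then have eig: "(\<integral>v. P_op \<mu> s sphere_pos \<phi> v \<partial>\<nu>) = complex_of_real k * (\<integral>v. \<phi> v \<partial>\<nu>)"
    using nu by (simp add: eigenmeasure_def)
  \<comment> \<open>Only the values on \<open>X\<close> enter: \<open>\<nu>\<close> is carried by
    \<open>X\<close>, and almost every \<open>act a v\<close> lies in \<open>X\<close>.\<close>
  have \<phi>_eq: "\<phi> v = complex_of_real ((f \<bullet> v) powr s * h v)" if "v \<in> X" for v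
    using g(2)[OF that] X_sphere[OF that] by (simp add: \<phi>_def ext0_def)
  have "(\<integral>v. \<phi> v \<partial>\<nu>) = (\<integral>v. complex_of_real ((f \<bullet> v) powr s * h v) \<partial>\<nu>)"
    by (rule integral_cong_AE, measurable, use AE_nu_X in eventually_elim, rule \<phi>_eq)
  moreover have "(\<integral>v. P_op \<mu> s sphere_pos \<phi> v \<partial>\<nu>) = (\<integral>v. complex_of_real ((f \<bullet> v) powr s * T h v) \<partial>\<nu>)"
  proof (rule integral_cong_AE)
    show "P_op \<mu> s sphere_pos \<phi> \<in> borel_measurable \<nu>"
      unfolding P_op_def ext0_def by measurable
    show "(\<lambda>v. complex_of_real ((f \<bullet> v) powr s * T h v)) \<in> borel_measurable \<nu>"
      unfolding T_def W_def by measurable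
    show "AE v in \<nu>. P_op \<mu> s sphere_pos \<phi> v = complex_of_real ((f \<bullet> v) powr s * T h v)"
      using AE_nu_X
    proof eventually_elim
      case (elim v)
      have "P_op \<mu> s sphere_pos \<phi> v = (\<integral>a. complex_of_real (norm1 (a *v v) powr s) * \<phi> (act a v) \<partial>\<mu>)"
        using X_sphere[OF elim] by (simp add: P_op_def ext0_def)
      also have "\<dots> = (\<integral>a. complex_of_real ((f \<bullet> v) powr s * (W a v * h (act a v))) \<partial>\<mu>)"
      proof (rule integral_cong_AE)
        show "AE a in \<mu>. complex_of_real (norm1 (a *v v) powr s) * \<phi> (act a v) =
            complex_of_real ((f \<bullet> v) powr s * (W a v * h (act a v)))"
          using AE_good
        proof eventually_elim
          case (elim a)
          have "complex_of_real (norm1 (a *v v) powr s) * \<phi> (act a v)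
            = complex_of_real (norm1 (a *v v) powr s * (f \<bullet> act a v) powr s * h (act a v))"
            using \<phi>_eq[OF good_act(1)[OF elim X_sphere[OF \<open>v \<in> X\<close>]]] by simp
          also have "\<dots> = complex_of_real ((f \<bullet> v) powr s * (W a v * h (act a v)))"
            unfolding W_mult[OF elim \<open>v \<in> X\<close>, symmetric] by (simp only: mult.assoc)
          finally show ?case .
        qed
      qed measurable
      also have "\<dots> = complex_of_real ((f \<bullet> v) powr s * T h v)"
        using elim by (simp only: integral_complex_of_real) (simp add: T_def)
      finally show ?case .
    qed
  qed
  ultimately have "complex_of_real (\<integral>v. (f \<bullet> v) powr s * T h v \<partial>\<nu>)
      = complex_of_real k * complex_of_real (\<integral>v. (f \<bullet> v) powr s * h v \<partial>\<nu>)"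
    using eig by (simp only: integral_complex_of_real)
  then have "(\<integral>v. (f \<bullet> v) powr s * T h v \<partial>\<nu>) = k * (\<integral>v. (f \<bullet> v) powr s * h v \<partial>\<nu>)"
    by (simp only: flip: of_real_mult) (simp only: of_real_eq_iff)
  then show ?thesis by (simp add: N_def)
qed

sublocale cc: cone_contraction X H T N rr k "2 * c0" q
  by unfold_locales
    (fact T_lin N_lin N_mono N_T T_rr N_rr rr_cone c0_nonneg q k_pos T_cone)+

end

section \<open>Complex-valued functions and the operators of the statement\<close>

lemma holder_complex:
  fixes \<phi> :: "'a \<Rightarrow> complex"
  shows "holder X E C \<phi> \<Longrightarrow> holder X E C (\<lambda>v. Re (\<phi> v))"
    and "holder X E C \<phi> \<Longrightarrow> holder X E C (\<lambda>v. Im (\<phi> v))"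
    and "holder X E C (\<lambda>v. Re (\<phi> v)) \<Longrightarrow> holder X E D (\<lambda>v. Im (\<phi> v)) \<Longrightarrow> holder X E (C + D) \<phi>"
proof -
  assume h: "holder X E C \<phi>"
  have "\<bar>Re (\<phi> u) - Re (\<phi> v)\<bar> \<le> cmod (\<phi> u - \<phi> v)" "\<bar>Im (\<phi> u) - Im (\<phi> v)\<bar> \<le> cmod (\<phi> u - \<phi> v)" for u v
    using abs_Re_le_cmod[of "\<phi> u - \<phi> v"] abs_Im_le_cmod[of "\<phi> u - \<phi> v"] by auto
  note diff = order_trans[OF this(1) holderD(4)[OF h]] order_trans[OF this(2) holderD(4)[OF h]]
  note abs = order_trans[OF abs_Re_le_cmod holderD(3)[OF h]] order_trans[OF abs_Im_le_cmod holderD(3)[OF h]]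
  show "holder X E C (\<lambda>v. Re (\<phi> v))" "holder X E C (\<lambda>v. Im (\<phi> v))"
    using holderD(1,2)[OF h] by (auto intro!: holderI diff abs)
next
  assume h: "holder X E C (\<lambda>v. Re (\<phi> v))" "holder X E D (\<lambda>v. Im (\<phi> v))"
  show "holder X E (C + D) \<phi>"
  proof (rule holderI)
    show "\<phi> v = 0" if "v \<notin> X" for v
      using holderD(2)[OF h(1) that] holderD(2)[OF h(2) that] by (simp add: complex_eq_iff)
    show "norm (\<phi> v) \<le> C + D" if "v \<in> X" for v
      using holderD(3)[OF h(1) that] holderD(3)[OF h(2) that] cmod_le[of "\<phi> v"] by simp
    show "norm (\<phi> u - \<phi> v) \<le> (C + D) * E u v" if "u \<in> X" "v \<in> X" for u v
      using holderD(4)[OF h(1) that] holderD(4)[OF h(2) that] cmod_le[of "\<phi> u - \<phi> v"]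
      by (simp add: distrib_right)
  qed (use h in \<open>auto simp: holder_def\<close>)
qed

context transfer_operator
begin

abbreviation "PF \<equiv> Pf_op \<mu> s X f"
abbreviation "MF \<equiv> Mf_op \<nu> \<nu>' s X f"
abbreviation "LF \<equiv> Lf_op \<mu> k \<nu> \<nu>' s X f"
abbreviation "nf \<equiv> nuf \<nu> \<nu>' s f"
abbreviation "rf \<equiv> rf_fun \<nu>' s X f"

lemma Bspace_X: "\<phi> \<in> Bspace X \<gamma> \<longleftrightarrow> is_holder X H \<phi>"
  unfolding X_def by (rule Bspace_iff[OF eps gamma])

lemma PF_eq: "PF \<phi> v = (if v \<in> X then \<integral>a. W a v *\<^sub>R \<phi> (act a v) \<partial>\<mu> else 0)"
  by (simp add: Pf_op_def ext0_def W_def scaleR_conv_of_real)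

lemma nf_eq: "nf \<phi> = (1 / (\<integral>v. r v \<partial>\<nu>)) *\<^sub>R (\<integral>v. (f \<bullet> v) powr s *\<^sub>R \<phi> v \<partial>\<nu>)"
  by (simp add: nuf_def weight_def scaleR_conv_of_real)

lemma rf_eq: "rf v = complex_of_real (rr v)"
  by (simp add: rf_fun_def ext0_def rr_def)

text \<open>\<open>Lf_op\<close> is defined by conjugating \<open>L_op\<close> with the weight,
  which is nonzero on \<open>X\<close>. By \<open>W_mult\<close> the conjugate of
  \<open>P_op\<close> is \<open>PF\<close>, and that of \<open>M_op\<close> is \<open>MF\<close>.
  Off \<open>X\<close> all terms are 0.\<close>

lemma LF_eq:
  assumes \<phi>: "is_holder X H \<phi>"
  shows "LF \<phi> v = PF \<phi> v - complex_of_real k * MF \<phi> v"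
proof (cases "v \<in> X")
  case True
  note [measurable] = holder_measurable[OF \<phi>]
  note fv = inner_X(3)[OF f True]
  have "(\<integral>a. complex_of_real (norm1 (a *v v) powr s) * weight s f \<phi> (act a v) \<partial>\<mu>)
      = (\<integral>a. complex_of_real ((f \<bullet> v) powr s) * (W a v *\<^sub>R \<phi> (act a v)) \<partial>\<mu>)"
  proof (rule integral_cong_AE)
    show "(\<lambda>a. complex_of_real (norm1 (a *v v) powr s) * weight s f \<phi> (act a v)) \<in> borel_measurable \<mu>"
      unfolding weight_def by measurable
    show "(\<lambda>a. complex_of_real ((f \<bullet> v) powr s) * (W a v *\<^sub>R \<phi> (act a v))) \<in> borel_measurable \<mu>"
      by measurable
    show "AE a in \<mu>. complex_of_real (norm1 (a *v v) powr s) * weight s f \<phi> (act a v)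
        = complex_of_real ((f \<bullet> v) powr s) * (W a v *\<^sub>R \<phi> (act a v))"
      using AE_good
    proof eventually_elim
      case (elim a)
      have "complex_of_real (norm1 (a *v v) powr s) * weight s f \<phi> (act a v)
          = complex_of_real (norm1 (a *v v) powr s * (f \<bullet> act a v) powr s) * \<phi> (act a v)"
        by (simp add: weight_def)
      also have "\<dots> = complex_of_real ((f \<bullet> v) powr s * W a v) * \<phi> (act a v)"
        by (simp only: W_mult[OF elim True])
      finally show ?case by (simp add: scaleR_conv_of_real)
    qed
  qed
  also have "\<dots> = complex_of_real ((f \<bullet> v) powr s) * PF \<phi> v"
    unfolding PF_eq if_P[OF True] by (rule integral_mult_right_zero)
  finally have P: "P_op \<mu> s X (weight s f \<phi>) v = complex_of_real ((f \<bullet> v) powr s) * PF \<phi> v"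
    using True by (simp add: P_op_def ext0_def)
  have M: "M_op \<nu> \<nu>' s X (weight s f \<phi>) v = complex_of_real ((f \<bullet> v) powr s) * MF \<phi> v"
    using True fv by (simp add: M_op_def ext0_def Mf_op_def rf_fun_def nuf_def)
  show ?thesis
    using fv by (simp add: Lf_op_def L_op_def P M field_simps)
qed (simp add: Lf_op_def L_op_def P_op_def M_op_def Mf_op_def ext0_def PF_eq rf_eq rr_def)

lemma is_holder_Re: "is_holder X H \<phi> \<Longrightarrow> is_holder X H (\<lambda>v. Re (\<phi> v))"
  and is_holder_Im: "is_holder X H \<phi> \<Longrightarrow> is_holder X H (\<lambda>v. Im (\<phi> v))"
  using holder_complex(1,2) by (force simp: is_holder_def)+

lemma is_holder_complexI:
  "is_holder X H (\<lambda>v. Re (\<phi> v)) \<Longrightarrow> is_holder X H (\<lambda>v. Im (\<phi> v)) \<Longrightarrow> is_holder X H \<phi>"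
  using holder_complex(3) by (force simp: is_holder_def)

text \<open>The kernel \<open>W\<close> is real, so real and imaginary parts evolve separately under
  \<open>T\<close>.\<close>

lemma PF_Re_Im:
  assumes "is_holder X H \<phi>"
  shows "Re (PF \<phi> v) = T (\<lambda>v. Re (\<phi> v)) v" "Im (PF \<phi> v) = T (\<lambda>v. Im (\<phi> v)) v"
proof -
  have "Re (PF \<phi> v) = T (\<lambda>v. Re (\<phi> v)) v \<and> Im (PF \<phi> v) = T (\<lambda>v. Im (\<phi> v)) v"
  proof (cases "v \<in> X")
    case True
    show ?thesis
      using integral_Re[OF integrable_W[OF assms True]] integral_Im[OF integrable_W[OF assms True]] True
      by (simp add: PF_eq T_def)
  qed (simp add: PF_eq T_def)
  then show "Re (PF \<phi> v) = T (\<lambda>v. Re (\<phi> v)) v" "Im (PF \<phi> v) = T (\<lambda>v. Im (\<phi> v)) v" by auto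
qed

lemma nf_Re_Im:
  assumes "is_holder X H \<phi>"
  shows "Re (nf \<phi>) = N (\<lambda>v. Re (\<phi> v))" "Im (nf \<phi>) = N (\<lambda>v. Im (\<phi> v))"
  using integral_Re[OF integrable_weight[OF assms]] integral_Im[OF integrable_weight[OF assms]]
  by (simp_all add: nf_eq N_def)

lemma LF_Re_Im:
  assumes "is_holder X H \<phi>"
  shows "Re (LF \<phi> v) = cc.L (\<lambda>v. Re (\<phi> v)) v" "Im (LF \<phi> v) = cc.L (\<lambda>v. Im (\<phi> v)) v"
  unfolding LF_eq[OF assms]
  by (simp_all add: PF_Re_Im[OF assms] nf_Re_Im[OF assms] Mf_op_def rf_eq cc.L_def)

lemma is_holder_LF: "is_holder X H \<phi> \<Longrightarrow> is_holder X H (LF \<phi>)"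
  by (rule is_holder_complexI) (simp_all add: LF_Re_Im cc.is_holder_L is_holder_Re is_holder_Im)

lemma is_holder_LFn: "is_holder X H \<phi> \<Longrightarrow> is_holder X H ((LF ^^ n) \<phi>)"
  by (induction n) (auto intro: is_holder_LF)

lemma LFn_Re_Im:
  assumes "is_holder X H \<phi>"
  shows "Re ((LF ^^ n) \<phi> v) = (cc.L ^^ n) (\<lambda>v. Re (\<phi> v)) v"
    "Im ((LF ^^ n) \<phi> v) = (cc.L ^^ n) (\<lambda>v. Im (\<phi> v)) v"
proof (induction n arbitrary: v)
  case (Suc n)
  case 1
  show ?case using Suc(1) LF_Re_Im(1)[OF is_holder_LFn[OF assms]] by simp
next
  case (Suc n)
  case 2
  show ?case using Suc(2) LF_Re_Im(2)[OF is_holder_LFn[OF assms]] by simp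
qed simp_all

lemma is_holder_rf: "is_holder X H rf"
  by (rule is_holder_complexI)
    (simp_all add: rf_eq rr_holder is_holder_cmult[OF rr_holder, of 0, simplified])

lemma nf_rf: "nf rf = 1"
  using nf_Re_Im[OF is_holder_rf] N_lin[OF rr_holder rr_holder, of 0 0]
  by (simp add: complex_eq_iff rf_eq N_rr)

lemma PF_lin:
  assumes "is_holder X H \<phi>" "is_holder X H \<psi>"
  shows "PF (\<lambda>v. x * \<phi> v + y * \<psi> v) = (\<lambda>v. x * PF \<phi> v + y * PF \<psi> v)"
proof
  fix v
  show "PF (\<lambda>v. x * \<phi> v + y * \<psi> v) v = x * PF \<phi> v + y * PF \<psi> v"
  proof (cases "v \<in> X")
    case True
    have "(\<integral>a. W a v *\<^sub>R (x * \<phi> (act a v) + y * \<psi> (act a v)) \<partial>\<mu>)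
        = (\<integral>a. x * (W a v *\<^sub>R \<phi> (act a v)) + y * (W a v *\<^sub>R \<psi> (act a v)) \<partial>\<mu>)"
      by (simp add: scaleR_add_right)
    also have "\<dots> = x * (\<integral>a. W a v *\<^sub>R \<phi> (act a v) \<partial>\<mu>) + y * (\<integral>a. W a v *\<^sub>R \<psi> (act a v) \<partial>\<mu>)"
      using integrable_W[OF assms(1) True] integrable_W[OF assms(2) True]
      by (subst Bochner_Integration.integral_add) (simp_all del: mult_scaleR_right)
    finally show ?thesis using True by (simp add: PF_eq)
  qed (simp add: PF_eq)
qed

lemma nf_lin:
  assumes "is_holder X H \<phi>" "is_holder X H \<psi>"
  shows "nf (\<lambda>v. x * \<phi> v + y * \<psi> v) = x * nf \<phi> + y * nf \<psi>"
proof -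
  have "(\<integral>v. (f \<bullet> v) powr s *\<^sub>R (x * \<phi> v + y * \<psi> v) \<partial>\<nu>)
      = (\<integral>v. x * ((f \<bullet> v) powr s *\<^sub>R \<phi> v) + y * ((f \<bullet> v) powr s *\<^sub>R \<psi> v) \<partial>\<nu>)"
    by (simp add: scaleR_add_right)
  also have "\<dots> = x * (\<integral>v. (f \<bullet> v) powr s *\<^sub>R \<phi> v \<partial>\<nu>) + y * (\<integral>v. (f \<bullet> v) powr s *\<^sub>R \<psi> v \<partial>\<nu>)"
    using integrable_weight[OF assms(1)] integrable_weight[OF assms(2)]
    by (subst Bochner_Integration.integral_add) (simp_all del: mult_scaleR_right)
  finally show ?thesis by (simp add: nf_eq scaleR_add_right)
qed

lemma LF_lin:
  assumes "is_holder X H \<phi>" "is_holder X H \<psi>"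
  shows "LF (\<lambda>v. x * \<phi> v + y * \<psi> v) = (\<lambda>v. x * LF \<phi> v + y * LF \<psi> v)"
proof
  fix v
  have h: "is_holder X H (\<lambda>v. x * \<phi> v + y * \<psi> v)"
    by (intro is_holder_add is_holder_cmult assms)
  show "LF (\<lambda>v. x * \<phi> v + y * \<psi> v) v = x * LF \<phi> v + y * LF \<psi> v"
    unfolding LF_eq[OF h] LF_eq[OF assms(1)] LF_eq[OF assms(2)] PF_lin[OF assms]
      Mf_op_def nf_lin[OF assms] by (simp add: algebra_simps)
qed

lemma nf_LF: "is_holder X H \<phi> \<Longrightarrow> nf (LF \<phi>) = 0"
  using nf_Re_Im[OF is_holder_LF, of \<phi>]
  by (simp add: complex_eq_iff LF_Re_Im cc.N_L is_holder_Re is_holder_Im)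

lemma LF_rf: "LF rf = (\<lambda>v. 0)"
proof
  fix v
  show "LF rf v = 0"
    using LF_Re_Im[OF is_holder_rf, of v] cc.L_lin[OF rr_holder rr_holder, of 0 0]
    by (simp add: complex_eq_iff rf_eq cc.L_r)
qed

lemma PF_MF:
  assumes "is_holder X H \<phi>"
  shows "PF (MF \<phi>) v = complex_of_real k * MF \<phi> v" "LF (MF \<phi>) v = 0" "is_holder X H (MF \<phi>)"
proof -
  show h: "is_holder X H (MF \<phi>)"
    unfolding Mf_op_def by (intro is_holder_cmult is_holder_rf)
  show L: "LF (MF \<phi>) v = 0"
    using LF_lin[OF is_holder_rf is_holder_rf, of "nf \<phi>" 0] by (simp add: Mf_op_def LF_rf)
  have "nf (MF \<phi>) = nf \<phi>"
    using nf_lin[OF is_holder_rf is_holder_rf, of "nf \<phi>" 0] by (simp add: Mf_op_def nf_rf)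
  then show "PF (MF \<phi>) v = complex_of_real k * MF \<phi> v"
    using L LF_eq[OF h, of v] by (simp add: Mf_op_def)
qed

text \<open>\<open>nf\<close> vanishes on the range of \<open>LF\<close>, so \<open>PF\<close> and
  \<open>LF\<close> agree there, while \<open>PF\<close> multiplies \<open>MF \<phi>\<close> by
  \<open>k\<close>. The exponent starts at 1, since at 0 the identity would read
  \<open>\<phi> = MF \<phi> + \<phi>\<close>.\<close>

lemma PFn:
  assumes "is_holder X H \<phi>"
  shows "(PF ^^ Suc n) \<phi> = (\<lambda>v. complex_of_real (k ^ Suc n) * MF \<phi> v + (LF ^^ Suc n) \<phi> v)"
proof (induction n)
  case 0
  show ?case using LF_eq[OF assms] by (simp add: fun_eq_iff)
next
  case (Suc n)
  define \<psi> where "\<psi> = (LF ^^ Suc n) \<phi>"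
  have \<psi>: "is_holder X H \<psi>" unfolding \<psi>_def by (rule is_holder_LFn[OF assms])
  have "nf \<psi> = 0" unfolding \<psi>_def using nf_LF[OF is_holder_LFn[OF assms, of n]] by simp
  then have P: "PF \<psi> v = LF \<psi> v" for v using LF_eq[OF \<psi>, of v] by (simp add: Mf_op_def)
  have "(PF ^^ Suc (Suc n)) \<phi> = PF (\<lambda>v. complex_of_real (k ^ Suc n) * MF \<phi> v + 1 * \<psi> v)"
    using Suc by (simp add: \<psi>_def)
  also have "\<dots> = (\<lambda>v. complex_of_real (k ^ Suc (Suc n)) * MF \<phi> v + LF \<psi> v)"
    unfolding PF_lin[OF PF_MF(3)[OF assms] \<psi>] by (simp add: PF_MF(1)[OF assms] P fun_eq_iff)
  finally show ?case by (simp add: \<psi>_def)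
qed

text \<open>The weights cancel between consecutive factors. Off \<open>X\<close>, where
  \<open>f \<bullet> v\<close> may be 0, both sides of the conjugation vanish.\<close>

lemma LFn_weight:
  "(LF ^^ n) \<phi> v = complex_of_real (1 / (f \<bullet> v) powr s) * (L_op \<mu> k \<nu> \<nu>' s X ^^ n) (weight s f \<phi>) v"
  if "v \<in> X" and "\<And>v. v \<notin> X \<Longrightarrow> \<phi> v = 0"
proof -
  have *: "weight s f ((LF ^^ n) \<phi>) = (L_op \<mu> k \<nu> \<nu>' s X ^^ n) (weight s f \<phi>)"
  proof (induction n)
    case (Suc n)
    have "weight s f (LF \<psi>) = L_op \<mu> k \<nu> \<nu>' s X (weight s f \<psi>)" for \<psi>
    proof
      fix v
      show "weight s f (LF \<psi>) v = L_op \<mu> k \<nu> \<nu>' s X (weight s f \<psi>) v"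
      proof (cases "v \<in> X")
        case True
        then show ?thesis using inner_X(3)[OF f True] by (simp add: weight_def Lf_op_def)
      qed (simp add: weight_def Lf_op_def L_op_def P_op_def M_op_def ext0_def)
    qed
    then show ?case using Suc by simp
  qed simp
  show ?thesis
    unfolding *[symmetric] using inner_X(3)[OF f that(1)] by (simp add: weight_def)
qed

text \<open>A bound \<open>K\<close> between constants of \<open>holder\<close> becomes the bound
  \<open>2 * K\<close> for \<open>gnorm\<close>.\<close>

lemma bounded_opI:
  assumes lin: "\<And>\<phi> \<psi> x y. is_holder X H \<phi> \<Longrightarrow> is_holder X H \<psi> \<Longrightarrow>
      R (\<lambda>v. x * \<phi> v + y * \<psi> v) = (\<lambda>v. x * R \<phi> v + y * R \<psi> v)"
    and K: "0 \<le> K" and bd: "\<And>G \<phi>. holder X H G \<phi> \<Longrightarrow> holder X H (K * G) (R \<phi>)"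
  shows "bounded_op X \<gamma> R"
  unfolding bounded_op_def
proof (intro conjI ballI allI exI)
  fix \<phi> assume B: "\<phi> \<in> Bspace X \<gamma>"
  have h: "holder X H (enn2real (gnorm X \<gamma> \<phi>)) \<phi>"
    using Bspace_holder[OF eps gamma] B by (simp add: X_def)
  have \<phi>: "is_holder X H \<phi>" and fin: "gnorm X \<gamma> \<phi> < top"
    using B by (simp_all add: Bspace_X[symmetric] Bspace_def)
  show "R \<phi> \<in> Bspace X \<gamma>" using bd[OF h] by (auto simp: Bspace_X is_holder_def)
  show "R (\<lambda>v. c * \<phi> v) = (\<lambda>v. c * R \<phi> v)" for c
    using lin[OF \<phi> \<phi>, of c 0] by simp
  show "R (\<lambda>v. \<phi> v + \<psi> v) = (\<lambda>v. R \<phi> v + R \<psi> v)" if "\<psi> \<in> Bspace X \<gamma>" for \<psi>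
    using lin[OF \<phi>, of \<psi> 1 1] that by (simp add: Bspace_X)
  have "gnorm X \<gamma> (R \<phi>) \<le> ennreal (2 * (K * enn2real (gnorm X \<gamma> \<phi>)))"
    using gnorm_le[OF eps gamma] bd[OF h] by (simp add: X_def)
  also have "\<dots> = ennreal (2 * K) * gnorm X \<gamma> \<phi>"
    using K fin by (simp add: mult.assoc[symmetric] ennreal_mult'' del: mult.assoc)
  finally show "gnorm X \<gamma> (R \<phi>) \<le> ennreal (2 * K) * gnorm X \<gamma> \<phi>" .
qed

lemma spectral_gap: "bounded_op X \<gamma> LF" "spectral_radius X \<gamma> LF < k"
proof -
  obtain C b where C: "0 \<le> C" and b: "0 \<le> b" "b < k"
    and decay: "\<And>h G n. holder X H G h \<Longrightarrow> holder X H (C * b ^ n * G) ((cc.L ^^ n) h)"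
    using cc.L_decay by blast
  \<comment> \<open>The factor 2 adds the bounds for the real and the imaginary part.\<close>
  have LFn: "holder X H (2 * C * b ^ n * G) ((LF ^^ n) \<phi>)" if G: "holder X H G \<phi>" for G \<phi> n
  proof -
    have \<phi>: "is_holder X H \<phi>" using G by (auto simp: is_holder_def)
    have "holder X H (C * b ^ n * G + C * b ^ n * G) ((LF ^^ n) \<phi>)"
      using decay holder_complex(1,2)[OF G]
      by (intro holder_complex(3)) (simp_all add: LFn_Re_Im[OF \<phi>])
    then show ?thesis by (simp add: algebra_simps)
  qed
  interpret pd: power_decay X H LF "2 * C" b
    by unfold_locales (use C b LFn LF_lin E_nonneg in auto)
  show "bounded_op X \<gamma> LF"
    using C b pd.decay[where n = 1]
    by (intro bounded_opI[where K = "2 * C * b"] LF_lin) auto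
  have le: "cmod z \<le> b" if z: "z \<in> op_spectrum X \<gamma> LF" for z
  proof (rule ccontr)
    assume "\<not> cmod z \<le> b"
    then have zb: "b < cmod z" by simp
    have "bounded_op X \<gamma> (pd.neumann z)"
    proof (rule bounded_opI)
      show "0 \<le> 2 * C / (cmod z - b)" using C zb by simp
    qed (fact pd.neumann_lin[OF zb] pd.neumann_holder[OF zb])+
    moreover have "pd.neumann z (\<lambda>v. z * \<phi> v - LF \<phi> v) = \<phi> \<and>
        (\<lambda>v. z * pd.neumann z \<phi> v - LF (pd.neumann z \<phi>) v) = \<phi>" if "\<phi> \<in> Bspace X \<gamma>" for \<phi>
      using pd.neumann_right_inverse[OF zb] pd.neumann_left_inverse[OF zb] that
      by (auto simp: Bspace_X)
    ultimately show False using z unfolding op_spectrum_def by blast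
  qed
  \<comment> \<open>A real supremum over the empty set is unspecified, so the spectrum must be shown
    to be nonempty. \<open>LF\<close> kills the nonzero function \<open>rf\<close>, hence 0 is a
    spectral value.\<close>
  have "0 \<in> op_spectrum X \<gamma> LF"
    unfolding op_spectrum_def
  proof (intro CollectI notI, elim exE conjE)
    fix R assume R: "bounded_op X \<gamma> R"
      and inv: "\<forall>\<phi>\<in>Bspace X \<gamma>. R (\<lambda>v. 0 * \<phi> v - LF \<phi> v) = \<phi> \<and> (\<lambda>v. 0 * R \<phi> v - LF (R \<phi>) v) = \<phi>"
    have rf: "rf \<in> Bspace X \<gamma>" using is_holder_rf by (simp add: Bspace_X)
    have "R (\<lambda>v. 0 * rf v) = (\<lambda>v. 0 * R rf v)"
      using R rf unfolding bounded_op_def by blast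
    moreover have "R (\<lambda>v. 0 * rf v - LF rf v) = rf" using inv rf by blast
    ultimately have rf0: "rf = (\<lambda>v. 0)" by (simp add: LF_rf)
    obtain v where v: "v \<in> X" using X_ne by auto
    have "0 < rr v" using r_bounds(4)[OF v] inner_X(3)[OF f v] v by (simp add: rr_def)
    then show False using rf0 rf_eq[of v] by simp
  qed
  then have "spectral_radius X \<gamma> LF \<le> b"
    unfolding spectral_radius_def using le by (intro cSUP_least) auto
  then show "spectral_radius X \<gamma> LF < k" using b by simp
qed

end

theorem proposition3p3:
  fixes \<Omega> :: "'w measure"
    and g :: "nat \<Rightarrow> 'w \<Rightarrow> real ^ 'd ^ ('d::finite)"
    and \<mu> :: "(real ^ 'd ^ 'd) measure"
    and \<nu> \<nu>' :: "(real ^ 'd) measure"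
    and f :: "real ^ 'd"
    and s \<epsilon> \<gamma> :: real
  defines "X \<equiv> sphere_eps \<epsilon>"
    and "k \<equiv> kappa \<Omega> g s"
  defines "M \<equiv> Mf_op \<nu> \<nu>' s X f"
    and "L \<equiv> Lf_op \<mu> k \<nu> \<nu>' s X f"
  assumes dim: "CARD('d) \<ge> 2"
    and prob: "prob_space \<Omega>"
    and indep: "prob_space.indep_vars \<Omega> (\<lambda>_. borel) g {1..}"
    and law: "\<And>n. n \<ge> 1 \<Longrightarrow> distr \<Omega> borel (g n) = \<mu>"
    and nonneg: "AE a in \<mu>. nonneg_mat a"
    and eps: "0 < \<epsilon>" "\<epsilon> < 1" "\<forall>a\<in>msupport \<mu>. act_into \<epsilon> a"
    and Gamma: "0 \<notin> Gamma_mu \<mu>"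
    and s: "s \<in> interior (I_mu \<mu>)" "s \<noteq> 0"
    and cases:
      "(s < 0 \<and>
        (\<exists>\<kappa>\<^sub>0>1. AE a in \<mu>. pos_mat a \<and>
           Max (range (\<lambda>(i, j). a $ i $ j)) \<le> \<kappa>\<^sub>0 * Min (range (\<lambda>(i, j). a $ i $ j))) \<and>
        (\<forall>a\<in>msupport \<mu>. act_into \<epsilon> (transpose a)))
       \<or>
       (s > 0 \<and>
        (\<exists>\<kappa>\<^sub>1>1. AE a in \<mu>. pos_mat a \<and>
           (\<forall>j. Max (range (\<lambda>i. a $ i $ j)) \<le> \<kappa>\<^sub>1 * Min (range (\<lambda>i. a $ i $ j)))))"
    and nu: "eigenmeasure (P_op \<mu> s sphere_pos) k \<nu>"
    and nu': "eigenmeasure (P_star_op \<mu> s sphere_pos) k \<nu>'"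
    and gamma: "0 < \<gamma>" "\<gamma> \<le> min \<bar>s\<bar> 1"
    and f: "f \<in> sphere_pos"
  shows
    "(\<forall>n\<ge>1. \<forall>\<phi>\<in>Bspace X \<gamma>. \<forall>v\<in>X.
        (Pf_op \<mu> s X f ^^ n) \<phi> v = complex_of_real (k ^ n) * M \<phi> v + (L ^^ n) \<phi> v \<and>
        (L ^^ n) \<phi> v =
          complex_of_real (1 / (f \<bullet> v) powr s) * (L_op \<mu> k \<nu> \<nu>' s X ^^ n) (weight s f \<phi>) v) \<and>
     nuf \<nu> \<nu>' s f (rf_fun \<nu>' s X f) = 1 \<and>
     (\<forall>\<phi>\<in>Bspace X \<gamma>. \<forall>v\<in>X. M (L \<phi>) v = 0 \<and> L (M \<phi>) v = 0) \<and>
     bounded_op X \<gamma> L \<and> spectral_radius X \<gamma> L < k"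
proof -
  interpret \<Omega>: prob_space \<Omega> by (rule prob)
  have "g 1 \<in> borel_measurable \<Omega>"
    using indep by (auto simp: \<Omega>.indep_vars_def)
  then have prob_mu: "prob_space \<mu>" using \<Omega>.prob_space_distr[of "g 1" borel] law[of 1] by simp
  have sets: "sets \<mu> = sets borel" using law[of 1] by auto
  have pos: "AE a in \<mu>. pos_mat a"
    using cases
  proof (elim disjE conjE exE)
    fix K assume "AE a in \<mu>. pos_mat a \<and>
      Max (range (\<lambda>(i, j). a $ i $ j)) \<le> K * Min (range (\<lambda>(i, j). a $ i $ j))"
    then show ?thesis by eventually_elim simp
  next
    fix K assume "AE a in \<mu>. pos_mat a \<and>
      (\<forall>j. Max (range (\<lambda>i. a $ i $ j)) \<le> K * Min (range (\<lambda>i. a $ i $ j)))"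
    then show ?thesis by eventually_elim simp
  qed
  \<comment> \<open>The hypothesis speaks of the support, which has full measure.\<close>
  have into: "AE a in \<mu>. act_into \<epsilon> a"
    using AE_msupport[OF sets] by eventually_elim (rule bspec[OF eps(3)])
  have "s \<in> I_mu \<mu>" using s(1) interior_subset by blast
  then have moment: "(\<integral>\<^sup>+ a. ennreal (mat_norm a powr s) \<partial>\<mu>) < \<infinity>" by (simp add: I_mu_def)
  have "\<gamma> \<le> 1" using gamma(2) by simp
  then interpret to: transfer_operator \<mu> \<nu> \<nu>' f s \<epsilon> \<gamma> k X
    by (intro transfer_operator.intro prob_mu sets pos eps(1,2) into moment nu nu' gamma(1) f)
      (simp_all add: X_def)
  show ?thesis
  proof (intro conjI allI impI ballI)
    fix n :: nat and \<phi> v assume n: "1 \<le> n" and \<phi>: "\<phi> \<in> Bspace X \<gamma>" and v: "v \<in> X"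
    have hol: "is_holder X to.H \<phi>" using \<phi> by (simp add: to.Bspace_X)
    obtain m where "n = Suc m" using n by (cases n) auto
    then show "(Pf_op \<mu> s X f ^^ n) \<phi> v = complex_of_real (k ^ n) * M \<phi> v + (L ^^ n) \<phi> v"
      using to.PFn[OF hol, of m] by (simp add: M_def L_def)
    show "(L ^^ n) \<phi> v =
        complex_of_real (1 / (f \<bullet> v) powr s) * (L_op \<mu> k \<nu> \<nu>' s X ^^ n) (weight s f \<phi>) v"
      unfolding L_def using v by (rule to.LFn_weight) (use \<phi> in \<open>auto simp: Bspace_def Cfun_def\<close>)
  next
    fix \<phi> v assume "\<phi> \<in> Bspace X \<gamma>"
    then have hol: "is_holder X to.H \<phi>" by (simp add: to.Bspace_X)
    show "M (L \<phi>) v = 0" using to.nf_LF[OF hol] by (simp add: M_def L_def Mf_op_def)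
    show "L (M \<phi>) v = 0" using to.PF_MF(2)[OF hol] by (simp add: M_def L_def)
  qed (use to.nf_rf to.spectral_gap in \<open>simp_all add: L_def\<close>)
qed

end
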